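(* For any $z_0\in\overline{\mathbb{Q}}^*$ such that $z_0\notin[1,+\infty)$, infinitely many of the values $\mathrm{Li}_s(z_0)$, $s\ge1$, are linearly independent over $\mathbb{Q}(z_0)$.
   Context: $\overline{\mathbb{Q}}$ is embedded in $\mathbb{C}$. For an integer $s\ge1$, $\mathrm{Li}_s(z)=\sum_{k=1}^\infty z^k/k^s$ for $|z|<1$, and $\mathrm{Li}_s$ is analytically continued to $\mathbb{C}\setminus[1,+\infty)$. "Infinitely many are linearly independent over $\mathbb{Q}(z_0)$" means that the $\mathbb{Q}(z_0)$-vector space spanned by these numbers, $s\ge1$, is infinite-dimensional. *)

theory Defs
  imports
    "HOL-Complex_Analysis.Complex_Analysis"
    "HOL-Algebra.Algebraic_Closure_Type"
    "HOL-Algebra.Generated_Fields"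
    "HOL-Algebra.Embedded_Algebras"
begin

section \<open>Polylogarithms\<close>

definition cut_plane :: "complex set" where
  "cut_plane = - (complex_of_real ` {1..})"

definition is_polylog :: "nat \<Rightarrow> (complex \<Rightarrow> complex) \<Rightarrow> bool" where
  "is_polylog s f \<longleftrightarrow> f holomorphic_on cut_plane \<and>
     (\<forall>z. norm z < 1 \<longrightarrow> (\<lambda>k. z ^ Suc k / of_nat (Suc k) ^ s) sums f z)"

text \<open>By \<open>is_polylog_polylog\<close> and \<open>is_polylog_unique\<close> below, such a function exists and its
  values on the cut plane are determined; the values on the cut itself are arbitrary.\<close>

definition polylog :: "nat \<Rightarrow> complex \<Rightarrow> complex" where
  "polylog s = (SOME f. is_polylog s f)"

lemma open_cut_plane: "open cut_plane"
proof -
  have "closed (complex_of_real ` {1..})"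
    by (intro closed_injective_linear_image) (auto simp: inj_on_def linear_iff scaleR_conv_of_real)
  thus ?thesis unfolding cut_plane_def by (rule open_Compl)
qed

lemma closed_segment_0_cut_plane:
  assumes "z \<in> cut_plane" shows "closed_segment 0 z \<subseteq> cut_plane"
proof
  fix w assume "w \<in> closed_segment 0 z"
  then obtain u where u: "0 \<le> u" "u \<le> 1" "w = of_real u * z"
    by (auto simp: closed_segment_def scaleR_conv_of_real)
  show "w \<in> cut_plane"
  proof (rule ccontr)
    assume "w \<notin> cut_plane"
    then obtain r where r: "r \<ge> 1" "of_real u * z = of_real r"
      using u by (auto simp: cut_plane_def)
    hence "u \<noteq> 0" by auto
    hence "z = of_real (r / u)" using r by (simp add: field_simps)
    moreover have "r / u \<ge> 1" using r u \<open>u \<noteq> 0\<close> by (simp add: field_simps)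
    ultimately show False using assms unfolding cut_plane_def by blast
  qed
qed

lemma zero_in_cut_plane: "0 \<in> cut_plane"
  by (auto simp: cut_plane_def)

lemma starlike_cut_plane: "starlike cut_plane"
  unfolding starlike_def using closed_segment_0_cut_plane zero_in_cut_plane by blast

lemma ball_subset_cut_plane: "ball 0 1 \<subseteq> cut_plane"
  by (auto simp: cut_plane_def)

lemma is_polylog_unique:
  assumes "is_polylog s f" "is_polylog s g" "z \<in> cut_plane"
  shows "f z = g z"
proof (rule analytic_continuation_open[of "ball 0 1" cut_plane f g])
  show "connected cut_plane" using starlike_cut_plane by (rule starlike_imp_connected)
  show "f w = g w" if "w \<in> ball 0 1" for w
    using assms that by (auto simp: is_polylog_def intro: sums_unique2)
qed (use assms open_cut_plane ball_subset_cut_plane in \<open>auto simp: is_polylog_def\<close>)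

lemma is_polylog_exists: "\<exists>f. is_polylog s f"
proof (induction s)
  case 0
  have "is_polylog 0 (\<lambda>z. z / (1 - z))"
    unfolding is_polylog_def
  proof (intro conjI allI impI)
    show "(\<lambda>z. z / (1 - z)) holomorphic_on cut_plane"
      by (intro holomorphic_intros) (auto simp: cut_plane_def image_iff dest!: spec[of _ "1::real"])
    show "(\<lambda>k. z ^ Suc k / of_nat (Suc k) ^ 0) sums (z / (1 - z))" if "norm z < 1" for z :: complex
      using sums_mult[OF geometric_sums[OF that], of z] by simp
  qed
  thus ?case by blast
next
  case (Suc s)
  then obtain f where f: "f holomorphic_on cut_plane"
    and fs: "\<And>z. norm z < 1 \<Longrightarrow> (\<lambda>k. z ^ Suc k / of_nat (Suc k) ^ s) sums f z"
    by (auto simp: is_polylog_def)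
  define c :: "nat \<Rightarrow> complex" where "c n = (if n = 0 then 0 else 1 / of_nat n ^ Suc s)" for n
  have summ: "summable (\<lambda>n. c n * z ^ n)" if "norm z < 1" for z
  proof (rule summable_comparison_test'[of "\<lambda>n. norm z ^ n" 0])
    show "summable (\<lambda>n. norm z ^ n)" using that by (simp add: summable_geometric)
    fix n :: nat
    have "norm (c n) \<le> 1"
    proof (cases "n = 0")
      case False
      hence "(1::real) \<le> real n ^ Suc s" by (intro one_le_power) auto
      thus ?thesis using False by (simp add: c_def norm_divide norm_mult norm_power field_simps)
    qed (simp add: c_def)
    thus "norm (c n * z ^ n) \<le> norm z ^ n"
      by (simp add: norm_mult norm_power mult_left_le_one_le)
  qed
  define P where "P z = (\<Sum>n. c n * z ^ n)" for z
  define h where "h z = (\<Sum>n. diffs c n * z ^ n)" for z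
  have dP: "(P has_field_derivative h z) (at z)" if "norm z < 1" for z
    unfolding P_def h_def by (rule termdiffs_strong'[OF summ that])
  have diffs: "diffs c n = 1 / of_nat (Suc n) ^ s" for n
    by (simp add: diffs_def c_def divide_simps del: of_nat_Suc)
  have hz: "z * h z = f z" if "norm z < 1" for z
  proof -
    have "summable (\<lambda>n. diffs c n * z ^ n)"
      using that by (rule termdiff_converges[OF _ summ])
    hence "(\<lambda>n. z * (diffs c n * z ^ n)) sums (z * h z)"
      unfolding h_def by (intro sums_mult summable_sums)
    moreover have "(\<lambda>n. z * (diffs c n * z ^ n)) = (\<lambda>k. z ^ Suc k / of_nat (Suc k) ^ s)"
      by (simp add: diffs fun_eq_iff)
    ultimately show ?thesis using fs[OF that] sums_unique2 by metis
  qed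
  define g where "g z = (if norm z < 1 then h z else f z / z)" for z
  have g_eq: "g z = f z / z" if "z \<noteq> 0" for z
    using hz[of z] that by (auto simp: g_def field_simps)
  have "P holomorphic_on ball 0 1"
    using dP by (force simp: holomorphic_on_open)
  hence "deriv P holomorphic_on ball 0 1" by (rule holomorphic_deriv) auto
  hence "g holomorphic_on ball 0 1"
    by (rule holomorphic_transform) (auto simp: g_def intro!: DERIV_imp_deriv dP)
  moreover have "(\<lambda>z. f z / z) holomorphic_on (cut_plane - {0})"
    by (intro holomorphic_intros holomorphic_on_subset[OF f]) auto
  hence "g holomorphic_on (cut_plane - {0})"
    by (rule holomorphic_transform) (auto simp: g_eq)
  ultimately have "g holomorphic_on (ball 0 1 \<union> (cut_plane - {0}))"
    by (intro holomorphic_on_Un open_ball open_Diff open_cut_plane) auto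
  moreover have "ball 0 1 \<union> (cut_plane - {0}) = cut_plane"
    using ball_subset_cut_plane by auto
  ultimately have g: "g holomorphic_on cut_plane" by simp
  obtain G where G: "\<And>z. z \<in> cut_plane \<Longrightarrow> (G has_field_derivative g z) (at z)"
    using holomorphic_starlike_primitive[OF holomorphic_on_imp_continuous_on[OF g]
        starlike_cut_plane open_cut_plane finite.emptyI] g open_cut_plane
    by (metis Diff_empty holomorphic_on_imp_differentiable_at)
  have "is_polylog (Suc s) (\<lambda>z. G z - G 0)"
    unfolding is_polylog_def
  proof (intro conjI allI impI)
    show "(\<lambda>z. G z - G 0) holomorphic_on cut_plane"
      using G by (intro holomorphic_intros) (auto simp: holomorphic_on_open open_cut_plane)
    fix z :: complex assume z: "norm z < 1"
    have "\<exists>C. \<forall>w\<in>ball 0 1. G w - P w = C"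
    proof (rule has_field_derivative_zero_constant)
      fix w :: complex assume w: "w \<in> ball 0 1"
      hence "(G has_field_derivative h w) (at w)"
        using G[of w] ball_subset_cut_plane by (auto simp: g_def)
      hence "((\<lambda>w. G w - P w) has_field_derivative h w - h w) (at w)"
        using w by (intro derivative_intros dP) auto
      thus "((\<lambda>w. G w - P w) has_field_derivative 0) (at w within ball 0 1)"
        by (simp add: has_field_derivative_at_within)
    qed auto
    then obtain C where C: "\<And>w. norm w < 1 \<Longrightarrow> G w - P w = C" by auto
    have "P 0 = 0" by (simp add: P_def c_def)
    hence "G z - G 0 = P z" using C[of z] C[of 0] z by (simp add: algebra_simps)
    moreover have "(\<lambda>n. c n * z ^ n) sums P z"
      unfolding P_def using summ[OF z] by (rule summable_sums)
    hence "(\<lambda>n. c (Suc n) * z ^ Suc n) sums P z"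
      by (subst sums_Suc_iff) (simp add: c_def)
    hence "(\<lambda>k. z ^ Suc k / of_nat (Suc k) ^ Suc s) sums P z"
      by (simp add: c_def)
    ultimately show "(\<lambda>k. z ^ Suc k / of_nat (Suc k) ^ Suc s) sums (G z - G 0)"
      by simp
  qed
  thus ?case by blast
qed

lemma is_polylog_polylog: "is_polylog s (polylog s)"
  unfolding polylog_def using is_polylog_exists by (rule someI_ex)


section \<open>Vector spaces over subfields of the complex numbers\<close>

abbreviation complex_ring :: "complex ring" where
  "complex_ring \<equiv> ring_1_class.ring_of_type_algebra"

definition adjoin_rat :: "complex \<Rightarrow> complex set" where
  "adjoin_rat z = generate_field complex_ring {z}"

text \<open>In \<^theory>\<open>HOL-Algebra.Embedded_Algebras\<close> the locale \<open>subalgebra K V R\<close> says that \<open>V\<close> is a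
  \<open>K\<close>-linear subspace of \<open>R\<close>; closure under products is not required.\<close>

definition span_over :: "complex set \<Rightarrow> complex set \<Rightarrow> complex set" where
  "span_over K S = (\<lambda>V. subalgebra K V complex_ring) hull S"

lemma subfield_adjoin_rat: "subfield (adjoin_rat z) complex_ring"
proof -
  interpret field complex_ring by (rule field_from_type_algebra)
  show ?thesis unfolding adjoin_rat_def
    by (rule generate_field_is_subfield) (simp add: ring_of_type_algebra_def)
qed

lemma subalgebra_complex_iff:
  "subalgebra K V complex_ring \<longleftrightarrow>
     0 \<in> V \<and> (\<forall>x\<in>V. \<forall>y\<in>V. x + y \<in> V) \<and> (\<forall>x\<in>V. - x \<in> V) \<and> (\<forall>k\<in>K. \<forall>v\<in>V. k * v \<in> V)"
proof -
  interpret field complex_ring by (rule field_from_type_algebra)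
  have inv: "inv\<^bsub>add_monoid complex_ring\<^esub> x = - x" for x
    unfolding a_inv_def[symmetric]
    by (rule minus_equality) (auto simp: ring_of_type_algebra_def)
  show ?thesis
    unfolding subalgebra_def subalgebra_axioms_def subgroup_def inv
    by (auto simp: ring_of_type_algebra_def)
qed

lemma subalgebra_span_over: "subalgebra K (span_over K S) complex_ring"
  unfolding span_over_def by (rule hull_in) (auto simp: subalgebra_complex_iff)

lemma adjoin_rat_closed:
  shows "0 \<in> adjoin_rat z" "1 \<in> adjoin_rat z"
    and "x \<in> adjoin_rat z \<Longrightarrow> y \<in> adjoin_rat z \<Longrightarrow> x + y \<in> adjoin_rat z"
    and "x \<in> adjoin_rat z \<Longrightarrow> y \<in> adjoin_rat z \<Longrightarrow> x * y \<in> adjoin_rat z"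
    and "x \<in> adjoin_rat z \<Longrightarrow> - x \<in> adjoin_rat z"
proof -
  interpret field complex_ring by (rule field_from_type_algebra)
  have sub: "subring (adjoin_rat z) complex_ring"
    using subfield_adjoin_rat by (rule subfieldE(1))
  have inv: "\<ominus>\<^bsub>complex_ring\<^esub> x = - x" for x
    by (rule minus_equality) (auto simp: ring_of_type_algebra_def)
  note * = subringE[OF sub, unfolded inv]
  show "0 \<in> adjoin_rat z" "1 \<in> adjoin_rat z"
    "x \<in> adjoin_rat z \<Longrightarrow> y \<in> adjoin_rat z \<Longrightarrow> x + y \<in> adjoin_rat z"
    "x \<in> adjoin_rat z \<Longrightarrow> y \<in> adjoin_rat z \<Longrightarrow> x * y \<in> adjoin_rat z"
    "x \<in> adjoin_rat z \<Longrightarrow> - x \<in> adjoin_rat z"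
    using * by (simp_all add: ring_of_type_algebra_def)
qed

lemma span_over_adjoin_rat:
  "span_over (adjoin_rat z) S =
     {\<Sum>v\<in>T. c v * v | T c. finite T \<and> T \<subseteq> S \<and> (\<forall>v\<in>T. c v \<in> adjoin_rat z)}"
  (is "_ = ?E")
proof (unfold span_over_def, rule hull_unique)
  let ?K = "adjoin_rat z"
  show "S \<subseteq> ?E"
  proof
    fix v assume "v \<in> S"
    thus "v \<in> ?E"
      by (intro CollectI exI[of _ "{v}"] exI[of _ "\<lambda>_. 1"]) (auto simp: adjoin_rat_closed)
  qed
  have scale: "k * x \<in> ?E" if k: "k \<in> ?K" and x: "x \<in> ?E" for k x
  proof -
    from x obtain T c where T: "finite T" "T \<subseteq> S" "\<forall>v\<in>T. c v \<in> ?K" "x = (\<Sum>v\<in>T. c v * v)"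
      by blast
    show ?thesis
      by (intro CollectI exI[of _ T] exI[of _ "\<lambda>v. k * c v"])
        (use T k in \<open>auto simp: sum_distrib_left mult.assoc adjoin_rat_closed\<close>)
  qed
  have add: "x + y \<in> ?E" if x: "x \<in> ?E" and y: "y \<in> ?E" for x y
  proof -
    from x obtain T c where T: "finite T" "T \<subseteq> S" "\<forall>v\<in>T. c v \<in> ?K" "x = (\<Sum>v\<in>T. c v * v)"
      by blast
    from y obtain U d where U: "finite U" "U \<subseteq> S" "\<forall>v\<in>U. d v \<in> ?K" "y = (\<Sum>v\<in>U. d v * v)"
      by blast
    define c' where "c' v = (if v \<in> T then c v else 0)" for v
    define d' where "d' v = (if v \<in> U then d v else 0)" for v
    have "x = (\<Sum>v\<in>T \<union> U. c' v * v)"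
      unfolding T(4) by (intro sum.mono_neutral_cong_left) (use T U in \<open>auto simp: c'_def\<close>)
    moreover have "y = (\<Sum>v\<in>T \<union> U. d' v * v)"
      unfolding U(4) by (intro sum.mono_neutral_cong_left) (use T U in \<open>auto simp: d'_def\<close>)
    ultimately have "x + y = (\<Sum>v\<in>T \<union> U. (c' v + d' v) * v)"
      by (simp add: sum.distrib distrib_right)
    moreover have "\<forall>v. c' v + d' v \<in> ?K"
      using T U by (auto simp: c'_def d'_def adjoin_rat_closed)
    ultimately show ?thesis using T U
      by (intro CollectI exI[of _ "T \<union> U"] exI[of _ "\<lambda>v. c' v + d' v"]) auto
  qed
  have zero: "0 \<in> ?E"
    by (intro CollectI exI[of _ "{}"]) auto
  have uminus: "- x \<in> ?E" if "x \<in> ?E" for x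
    using scale[OF adjoin_rat_closed(5)[OF adjoin_rat_closed(2)] that] by simp
  show "subalgebra ?K ?E complex_ring"
    unfolding subalgebra_complex_iff by (intro conjI ballI zero add uminus scale)
  fix V assume V: "S \<subseteq> V" "subalgebra ?K V complex_ring"
  have zeroV: "0 \<in> V" and addV: "\<And>x y. x \<in> V \<Longrightarrow> y \<in> V \<Longrightarrow> x + y \<in> V"
    and scaleV: "\<And>k v. k \<in> ?K \<Longrightarrow> v \<in> V \<Longrightarrow> k * v \<in> V"
    using V(2) unfolding subalgebra_complex_iff by blast+
  have sum: "(\<Sum>v\<in>T. c v * v) \<in> V" if "finite T" "T \<subseteq> S" "\<forall>v\<in>T. c v \<in> ?K" for T c
    using that
  proof (induction T rule: finite_induct)
    case empty
    show ?case using zeroV by simp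
  next
    case (insert a T)
    have "c a * a \<in> V"
      using insert.prems V(1) by (intro scaleV) auto
    moreover have "(\<Sum>v\<in>T. c v * v) \<in> V"
      using insert.prems by (intro insert.IH) auto
    ultimately show ?case using insert.hyps addV by simp
  qed
  show "?E \<subseteq> V"
  proof
    fix x assume "x \<in> ?E"
    then obtain T c where "finite T" "T \<subseteq> S" "\<forall>v\<in>T. c v \<in> ?K" "x = (\<Sum>v\<in>T. c v * v)"
      by blast
    thus "x \<in> V" using sum by simp
  qed
qed

end

(*
  Write W for the rational span of the numbers z^i and z^i * Li_s(z), z = z0. If the theorem fails, W
  has finite dimension N over the rationals. Consider the values at z of the analytic continuations of
  the series sum_t R(t) z^t, where R is a rational function with poles of order at most a at
  t = -1, ..., -n - 1 and zeros at t = 0, ..., r n - 1, normalised as a product of simple fractions with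
  integer residues. By partial fractions such a value, multiplied by Lcm(1..n)^a, is a combination of
  elements of W with coefficients at most C^(a n); writing the series as an iterated integral over
  [0, 1] shows that the value itself is at most (r + 1)^(-b n) up to factors C^(a n), where a = 2 b + r.
  With r large in terms of N only, then b large, and n a large power of 2, N linearly independent values
  violate the lower bound 1 for a nonzero integer determinant.

  Such independent values exist, because the numerator of R is left free up to degree (r + b) n: the
  values for all these R already span W. Indeed z R(t + 1) - R(t) has the elementary value - R(0), and
  modulo such functions every admissible numerator can be reduced to low degree and then to a multiple
  of t (t - 1) ... (t - r n + 1).
*)

theory Submission
  imports Defs "Jordan_Normal_Form.Determinant"
begin

text \<open>The order of choices N, r, b, n makes the argument close. The assumed dimension N over
  the rationals does not depend on the pole order a = 2 b + r, so r may be chosen after N. Per unit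
  of n, one height costs a factor 256^b and a value gains (64 / (r + 1))^b, up to factors free of b.
  A determinant with one column of values has N - 1 columns of heights, so 128 * 256^(N - 1) <= r +
  1 suffices once b absorbs the other factors.

  The decay comes from b integrations against the kernel (1 - x)^n. Such a kernel is small only
  against a high power of x, here x^(r n), and that power is what the zeros at 0, ..., r n - 1
  provide. For |z| > 1 the series diverges, so the estimates are carried along the whole segment
  from 0 to z, in the form B x^L at the point x z; integration preserves this shape.

  The determinant has to be an integer, hence the passage from Q(z) to Q: the dimension stays finite
  because z is algebraic, and multiplication by z becomes integral after scaling by an integer D,
  which costs only D^n. As the whole family of numerators spans, only upper bounds for the values
  enter.\<close>

hide_const (open) UnivPoly.up_ring.coeff UnivPoly.up_ring.monom Polynomials.degree
  Polynomials.lead_coeff Divisibility.prime Module.module.smult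

section \<open>The least common multiple of an initial interval\<close>

text \<open>In \<open>i * (p^k choose i) = p^k * (p^k - 1 choose i - 1)\<close> a binomial
  coefficient prime to \<open>p\<close> would force \<open>p^k\<close> to divide
  \<open>i\<close>.\<close>

lemma prime_dvd_prime_power_choose:
  fixes p :: nat
  assumes "prime p" "0 < i" "i < p ^ k"
  shows "p dvd (p ^ k choose i)"
proof (rule ccontr)
  assume "\<not> p dvd (p ^ k choose i)"
  hence "coprime (p ^ k) (p ^ k choose i)"
    using prime_imp_coprime[OF assms(1)] by simp
  moreover have "p ^ k dvd i * (p ^ k choose i)"
    using times_binomial_minus1_eq[of i "p ^ k"] assms(2) by simp
  ultimately have "p ^ k dvd i"
    by (metis coprime_dvd_mult_left_iff)
  thus False using assms(2,3) nat_dvd_not_less by blast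
qed

text \<open>Vandermonde's identity for \<open>2 n = p^k + (2 n - p^k)\<close>: the term
  \<open>i = 0\<close> vanishes because \<open>2 n - p^k < n\<close>, and the others are divisible
  by \<open>p\<close> because \<open>0 < i \<le> n < p^k\<close>.\<close>

lemma prime_dvd_central_binomial:
  fixes p :: nat
  assumes "prime p" "n < p ^ k" "p ^ k \<le> 2 * n"
  shows "p dvd (2 * n choose n)"
proof -
  have "(2 * n choose n) = (\<Sum>i\<le>n. (p ^ k choose i) * ((2 * n - p ^ k) choose (n - i)))"
    using vandermonde[of "p ^ k" "2 * n - p ^ k" n] assms by simp
  moreover have "p dvd (p ^ k choose i) * ((2 * n - p ^ k) choose (n - i))" if "i \<le> n" for i
  proof (cases "i = 0")
    case True
    have "(2 * n - p ^ k) choose n = 0" using assms by (intro binomial_eq_0) linarith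
    thus ?thesis using True by (metis diff_zero dvd_0_right mult_0_right)
  next
    case False
    thus ?thesis using prime_dvd_prime_power_choose[OF assms(1), of i k] that assms by simp
  qed
  ultimately show ?thesis by (metis (no_types, lifting) atMost_iff dvd_sum)
qed

lemma Lcm_interval_pos: "0 < Lcm {1..n :: nat}"
proof -
  have "Lcm {1..n} \<noteq> 0" by (subst Lcm_0_iff) simp_all
  thus ?thesis by (metis gr0I)
qed

text \<open>Compare prime powers: if \<open>p^k \<le> 2 n\<close> exceeds \<open>n\<close>, then
  \<open>p^(k-1) \<le> n\<close> already divides the smaller least common multiple and the central
  binomial coefficient supplies the missing \<open>p\<close>.\<close>

lemma Lcm_double_dvd:
  "Lcm {1..2 * n} dvd Lcm {1..n} * (2 * n choose n :: nat)"
proof (rule Lcm_least)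
  fix m :: nat assume m: "m \<in> {1..2 * n}"
  have dvdL: "x dvd Lcm {1..n}" if "1 \<le> x" "x \<le> n" for x :: nat
    using that by (intro dvd_Lcm) auto
  show "m dvd Lcm {1..n} * (2 * n choose n)"
  proof (rule multiplicity_le_imp_dvd)
    fix p :: nat assume p: "prime p"
    define k where "k = multiplicity p m"
    have pk: "p ^ k dvd m" by (simp add: k_def multiplicity_dvd)
    have le: "p ^ k \<le> 2 * n" using dvd_imp_le[OF pk] m by simp
    have "p ^ k dvd Lcm {1..n} * (2 * n choose n)"
    proof (cases "p ^ k \<le> n")
      case True
      thus ?thesis using p by (intro dvd_mult2 dvdL) (simp_all add: prime_gt_0_nat Suc_leI)
    next
      case False
      moreover have "1 \<le> n" using m by simp
      ultimately have "k \<noteq> 0" by (metis power_0)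
      then obtain l where l: "k = Suc l" using not0_implies_Suc by blast
      have "2 * p ^ l \<le> p ^ k" using prime_ge_2_nat[OF p] l by simp
      hence "p ^ l \<le> n" using le by linarith
      hence "p ^ l dvd Lcm {1..n}" using p by (intro dvdL) (simp_all add: prime_gt_0_nat Suc_leI)
      moreover have "p dvd (2 * n choose n)"
        using prime_dvd_central_binomial[OF p _ le] False by simp
      ultimately have "p ^ l * p dvd Lcm {1..n} * (2 * n choose n)" by (rule mult_dvd_mono)
      thus ?thesis using l by (simp add: mult.commute)
    qed
    moreover have "Lcm {1..n} * (2 * n choose n) \<noteq> 0" using Lcm_interval_pos[of n] by simp
    ultimately show "multiplicity p m \<le> multiplicity p (Lcm {1..n} * (2 * n choose n))"
      using not_prime_unit p unfolding k_def[symmetric] by (metis multiplicity_geI)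
  next
    show "m \<noteq> 0" using m by simp
  qed
qed

lemma Lcm_double_le: "Lcm {1..2 * n} \<le> Lcm {1..n} * (4 :: nat) ^ n"
proof -
  have "Lcm {1..2 * n} \<le> Lcm {1..n} * (2 * n choose n)"
    using Lcm_interval_pos[of n] by (intro dvd_imp_le[OF Lcm_double_dvd] mult_pos_pos) auto
  also have "(2 * n choose n) \<le> 2 ^ (2 * n)" by (rule binomial_le_pow2)
  also have "(2::nat) ^ (2 * n) = 4 ^ n" by (simp add: power_mult)
  finally show ?thesis by simp
qed

text \<open>Iterating the doubling step from 1 reaches exactly the powers of 2, where it yields the
  clean bound \<open>4^n\<close>; this is why \<open>n\<close> is later restricted to them.\<close>

lemma Lcm_power2_le: "Lcm {1..2 ^ k} \<le> (4 :: nat) ^ (2 ^ k)"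
proof (induction k)
  case 0
  have "{1..2 ^ 0} = {1::nat}" by auto
  thus ?case by (simp only: Lcm_singleton) simp
next
  case (Suc k)
  have "Lcm {1..2 * 2 ^ k} \<le> Lcm {1..2 ^ k} * (4 :: nat) ^ (2 ^ k)" by (rule Lcm_double_le)
  also have "\<dots> \<le> 4 ^ (2 ^ k) * 4 ^ (2 ^ k)" by (rule mult_right_mono[OF Suc.IH]) (rule zero_le)
  also have "\<dots> = 4 ^ (2 * 2 ^ k)" by (simp only: mult_2 power_add)
  finally show ?case by (simp only: power_Suc)
qed

section \<open>Siegel's criterion over the rationals\<close>

text \<open>Cramer's rule: a nonzero integer determinant has absolute value at least 1.\<close>
lemma nonsingular_int_mat_bound:
  fixes A :: "int mat" and w :: "nat \<Rightarrow> complex"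
  assumes A: "A \<in> carrier_mat n n" and det: "Determinant.det A \<noteq> 0" and j: "j < n"
    and H: "\<And>i j. i < n \<Longrightarrow> j < n \<Longrightarrow> \<bar>A $$ (i, j)\<bar> \<le> H"
    and e: "\<And>i. i < n \<Longrightarrow> norm (\<Sum>j<n. of_int (A $$ (i, j)) * w j) \<le> e"
  shows "norm (w j) \<le> of_nat (fact n) * of_int H ^ (n - 1) * e"
proof -
  have n: "n > 0" using j by simp
  have H0: "0 \<le> H" using H[OF j j] by simp
  have e0: "0 \<le> e" using e[OF j] norm_ge_zero order_trans by blast
  have adjA: "(\<Sum>i<n. adj_mat A $$ (j, i) * A $$ (i, l)) = (if l = j then Determinant.det A else 0)"
    if l: "l < n" for l
  proof -
    have "(adj_mat A * A) $$ (j, l) = (\<Sum>i<n. adj_mat A $$ (j, i) * A $$ (i, l))"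
      using adj_mat(1)[OF A] A j l
      by (simp add: times_mat_def scalar_prod_def lessThan_atLeast0)
    thus ?thesis using adj_mat(3)[OF A] j l by (cases "l = j") auto
  qed
  have cof: "\<bar>cofactor A i j\<bar> \<le> fact (n - 1) * H ^ (n - 1)" if i: "i < n" for i
  proof -
    let ?B = "mat_delete A i j"
    have B: "?B \<in> carrier_mat (n - 1) (n - 1)" by (rule mat_delete_carrier[OF A])
    have BH: "\<bar>?B $$ (x, y)\<bar> \<le> H" if "x < n - 1" "y < n - 1" for x y
    proof -
      have "?B $$ (x, y) = A $$ (if x < i then x else Suc x, if y < j then y else Suc y)"
        using that A by (simp add: mat_delete_def)
      thus ?thesis using that by (auto intro!: H)
    qed
    have "\<bar>Determinant.det ?B\<bar> \<le> (\<Sum>p | p permutes {0..<n - 1}. \<bar>of_int (sign p) * (\<Prod>i = 0..<n - 1. ?B $$ (i, p i))\<bar>)"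
      unfolding det_def'[OF B] by (rule sum_abs)
    also have "\<dots> \<le> (\<Sum>p | p permutes {0..<n - 1}. H ^ (n - 1))"
    proof (rule sum_mono)
      fix p assume "p \<in> {p. p permutes {0..<n - 1}}"
      hence p: "p permutes {0..<n - 1}" by simp
      have "\<bar>\<Prod>i = 0..<n - 1. ?B $$ (i, p i)\<bar> \<le> (\<Prod>i = 0..<n - 1. H)"
        unfolding abs_prod using p by (intro prod_mono conjI BH) (auto dest: permutes_in_image[of p])
      thus "\<bar>of_int (sign p) * (\<Prod>i = 0..<n - 1. ?B $$ (i, p i))\<bar> \<le> H ^ (n - 1)"
        by (simp add: abs_mult)
    qed
    also have "\<dots> = fact (n - 1) * H ^ (n - 1)"
      using card_permutations[of "{0..<n - 1}" "n - 1"] by simp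
    finally show ?thesis unfolding cofactor_def by (simp add: abs_mult power_abs)
  qed
  \<comment> \<open>This is entry \<open>j\<close> of \<open>adj A (A w) = det A w\<close>.\<close>
  have "of_int (Determinant.det A) * w j = (\<Sum>l<n. of_int (\<Sum>i<n. adj_mat A $$ (j, i) * A $$ (i, l)) * w l)"
  proof -
    have "(\<Sum>l<n. of_int (\<Sum>i<n. adj_mat A $$ (j, i) * A $$ (i, l)) * w l)
        = (\<Sum>l<n. if l = j then of_int (Determinant.det A) * w j else 0)"
      by (intro sum.cong refl) (auto simp only: adjA lessThan_iff split: if_splits, auto)
    thus ?thesis using j by simp
  qed
  also have "\<dots> = (\<Sum>l<n. \<Sum>i<n. of_int (adj_mat A $$ (j, i)) * (of_int (A $$ (i, l)) * w l))"
    by (simp add: sum_distrib_right mult.assoc)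
  also have "\<dots> = (\<Sum>i<n. of_int (adj_mat A $$ (j, i)) * (\<Sum>l<n. of_int (A $$ (i, l)) * w l))"
    by (subst sum.swap) (simp add: sum_distrib_left)
  finally have eq: "of_int (Determinant.det A) * w j = \<dots>" .
  have "norm (w j) \<le> norm (of_int (Determinant.det A) * w j)"
  proof -
    have "1 \<le> \<bar>Determinant.det A\<bar>" using det by linarith
    hence "(1::real) \<le> of_int \<bar>Determinant.det A\<bar>" by (simp only: of_int_1_le_iff)
    hence "1 \<le> norm (of_int (Determinant.det A) :: complex)" by simp
    thus ?thesis by (simp add: norm_mult mult_right_le_one_le mult_le_cancel_right1)
  qed
  also have "\<dots> \<le> (\<Sum>i<n. norm (of_int (adj_mat A $$ (j, i)) * (\<Sum>l<n. of_int (A $$ (i, l)) * w l)))"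
    unfolding eq by (rule norm_sum)
  also have "\<dots> \<le> (\<Sum>i<n. of_int (fact (n - 1) * H ^ (n - 1)) * e)"
  proof (intro sum_mono)
    fix i assume "i \<in> {..<n}"
    hence i: "i < n" by simp
    have "adj_mat A $$ (j, i) = cofactor A i j" using A i j by (simp add: adj_mat_def)
    hence "norm (of_int (adj_mat A $$ (j, i)) :: complex) \<le> of_int (fact (n - 1) * H ^ (n - 1))"
      using cof[OF i] by (metis norm_of_int of_int_abs of_int_le_iff)
    thus "norm (of_int (adj_mat A $$ (j, i)) * (\<Sum>l<n. of_int (A $$ (i, l)) * w l))
      \<le> of_int (fact (n - 1) * H ^ (n - 1)) * e"
      unfolding norm_mult using H0 by (intro mult_mono e i) auto
  qed
  also have "\<dots> = of_nat (n * fact (n - 1)) * of_int H ^ (n - 1) * e" by simp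
  also have "n * fact (n - 1) = fact n" using n by (simp add: fact_reduce)
  finally show ?thesis by simp
qed

section \<open>Rational spans stable under multiplication by a complex number\<close>

interpretation ratvec: vector_space "\<lambda>(q::rat) (x::complex). of_rat q * x"
  by unfold_locales (simp_all add: algebra_simps of_rat_add of_rat_mult)

lemma span_closed_mult:
  assumes "\<And>x. x \<in> T \<Longrightarrow> k * x \<in> ratvec.span T" "x \<in> ratvec.span T"
  shows "k * x \<in> ratvec.span T"
  using assms(2)
proof (induction rule: ratvec.span_induct_alt)
  case base
  show ?case by (simp add: ratvec.span_zero)
next
  case (step c x y)
  have "of_rat c * (k * x) + k * y \<in> ratvec.span T"
    by (intro ratvec.span_add ratvec.span_scale step assms(1))
  thus ?case by (simp add: algebra_simps)
qed

text \<open>Multiplication by \<open>k \<noteq> 0\<close> is an injective linear map of a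
  finite-dimensional space into itself, hence onto: the image of a basis is again a basis.\<close>

lemma subspace_closed_inverse:
  assumes T: "finite T" "W \<subseteq> ratvec.span T" and W: "ratvec.subspace W"
    and k: "\<And>x. x \<in> W \<Longrightarrow> k * x \<in> W" and x: "x \<in> W"
  shows "inverse k * x \<in> W"
proof (cases "k = 0")
  case True
  thus ?thesis using W by (simp add: ratvec.subspace_0)
next
  case False
  obtain B where B: "B \<subseteq> W" "ratvec.independent B" "W \<subseteq> ratvec.span B"
    using ratvec.maximal_independent_subset .
  have finB: "finite B"
    using ratvec.independent_span_bound[OF T(1) B(2)] B(1) T(2) by blast
  define B' where "B' = (*) k ` B"
  have inj: "inj_on ((*) k) B" using False by (auto intro: inj_onI)
  have B'W: "B' \<subseteq> W" using B(1) k by (auto simp: B'_def)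
  have indep: "ratvec.independent B'"
  proof
    assume "ratvec.dependent B'"
    moreover have "finite B'" using finB by (simp add: B'_def)
    ultimately obtain u where u: "\<exists>v\<in>B'. u v \<noteq> 0" "(\<Sum>v\<in>B'. of_rat (u v) * v) = 0"
      by (auto simp: ratvec.dependent_finite)
    have "k * (\<Sum>b\<in>B. of_rat (u (k * b)) * b) = (\<Sum>v\<in>B'. of_rat (u v) * v)"
      unfolding B'_def by (subst sum.reindex[OF inj]) (simp add: sum_distrib_left mult_ac)
    hence "(\<Sum>b\<in>B. of_rat (u (k * b)) * b) = 0" using u(2) False by simp
    moreover have "\<exists>b\<in>B. u (k * b) \<noteq> 0" using u(1) by (auto simp: B'_def)
    ultimately have "ratvec.dependent B"
      unfolding ratvec.dependent_finite[OF finB] by (intro exI[of _ "\<lambda>b. u (k * b)"] conjI)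
    thus False using B(2) by simp
  qed
  have "b \<in> ratvec.span B'" if b: "b \<in> B" for b
  proof (rule ccontr)
    \<comment> \<open>Otherwise \<open>insert b B'\<close> would be an independent set of
      \<open>card B + 1\<close> elements in the span of \<open>B\<close>.\<close>
    assume nb: "b \<notin> ratvec.span B'"
    hence "ratvec.independent (insert b B')" using indep by (rule ratvec.independent_insertI)
    hence "card (insert b B') \<le> card B"
      using ratvec.independent_span_bound[OF finB] b B'W B(1,3) by blast
    moreover have "b \<notin> B'" using nb ratvec.span_base by blast
    ultimately show False using finB card_image[OF inj] by (simp add: B'_def)
  qed
  hence "B \<subseteq> ratvec.span B'" by blast
  hence "x \<in> ratvec.span B'" using x B(3) ratvec.span_minimal[OF _ ratvec.subspace_span] by blast
  thus ?thesis
  proof (induction rule: ratvec.span_induct_alt)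
    case base
    show ?case using W by (simp add: ratvec.subspace_0)
  next
    case (step c x y)
    from step obtain b where b: "b \<in> B" "x = k * b" by (auto simp: B'_def)
    have "of_rat c * b + inverse k * y \<in> W"
      using step b B(1) W by (intro ratvec.subspace_add ratvec.subspace_scale) auto
    also have "of_rat c * b + inverse k * y = inverse k * (of_rat c * x + y)"
      using b False by (simp add: distrib_left)
    finally show ?case .
  qed
qed

lemma powers_in_span_if_algebraic:
  assumes "algebraic z"
  obtains d where "d > 0" "z ^ d \<in> ratvec.span ((\<lambda>i. z ^ i) ` {..<d})"
proof -
  obtain p where p: "\<And>i. coeff p i \<in> \<int>" "p \<noteq> 0" "poly p z = 0"
    using assms by (rule algebraicE) blast
  define d where "d = degree p"
  have "\<exists>q. coeff p i = of_rat q" for i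
    using p(1)[of i] by (metis Ints_cases of_rat_of_int_eq)
  then obtain c where c: "\<And>i. coeff p i = of_rat (c i)" by metis
  have sum0: "(\<Sum>i\<le>d. of_rat (c i) * z ^ i) = 0"
    using p(3) by (simp add: poly_altdef d_def c)
  have lc: "c d \<noteq> 0" using p(2) c[of d] by (auto simp: d_def)
  have "d > 0"
  proof (rule ccontr)
    assume "\<not> d > 0"
    thus False using sum0 lc by simp
  qed
  have "of_rat (c d) * z ^ d = - (\<Sum>i<d. of_rat (c i) * z ^ i)"
    using sum0 by (simp add: lessThan_Suc_atMost[symmetric] eq_neg_iff_add_eq_0 add.commute)
  hence "z ^ d = (\<Sum>i<d. of_rat (- c i / c d) * z ^ i)"
    using lc by (simp add: field_simps of_rat_divide of_rat_minus sum_divide_distrib[symmetric] sum_negf)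
  also have "\<dots> \<in> ratvec.span ((\<lambda>i. z ^ i) ` {..<d})"
    by (intro ratvec.span_sum ratvec.span_scale ratvec.span_base) auto
  finally show thesis using that \<open>d > 0\<close> by blast
qed

lemma complex_ring_simps:
  "carrier complex_ring = UNIV" "x \<otimes>\<^bsub>complex_ring\<^esub> y = x * y" "x \<oplus>\<^bsub>complex_ring\<^esub> y = x + y"
  "\<one>\<^bsub>complex_ring\<^esub> = 1" "\<zero>\<^bsub>complex_ring\<^esub> = 0"
  by (simp_all add: ring_of_type_algebra_def)

lemma complex_ring_inv:
  "\<ominus>\<^bsub>complex_ring\<^esub> x = - x" "x \<noteq> 0 \<Longrightarrow> inv\<^bsub>complex_ring\<^esub> x = inverse x"
proof -
  interpret field complex_ring by (rule field_from_type_algebra)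
  show "\<ominus>\<^bsub>complex_ring\<^esub> x = - x" by (rule minus_equality) (auto simp: complex_ring_simps)
  show "inv\<^bsub>complex_ring\<^esub> x = inverse x" if "x \<noteq> 0"
    using that by (intro comm_inv_char) (auto simp: complex_ring_simps)
qed

text \<open>Induction over the generation of the field. Sums and products are immediate; for an
  inverse the finite dimension of the span is what makes multiplication surjective.\<close>

lemma adjoin_rat_closed_subspace:
  assumes T: "finite T" and z: "\<And>x. x \<in> ratvec.span T \<Longrightarrow> z * x \<in> ratvec.span T"
    and k: "k \<in> adjoin_rat z" and x: "x \<in> ratvec.span T"
  shows "k * x \<in> ratvec.span T"
  using k[unfolded adjoin_rat_def] x
proof (induction k arbitrary: x rule: generate_field.induct)
  case (m_inv h)
  have "inverse h * x \<in> ratvec.span T"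
    using subspace_closed_inverse[OF T order_refl ratvec.subspace_span m_inv.IH m_inv.prems] .
  moreover have "h \<noteq> 0" using m_inv by (simp add: complex_ring_simps)
  ultimately show ?case by (simp add: complex_ring_inv)
next
  case (a_inv h)
  have "- (h * x) \<in> ratvec.span T" using a_inv by (intro ratvec.span_neg) auto
  thus ?case by (simp add: complex_ring_inv)
next
  case (eng_add h1 h2)
  have "h1 * x + h2 * x \<in> ratvec.span T" using eng_add by (intro ratvec.span_add) auto
  thus ?case by (simp add: complex_ring_simps distrib_right)
next
  case (eng_mult h1 h2)
  have "h1 * (h2 * x) \<in> ratvec.span T" using eng_mult by blast
  thus ?case by (simp add: complex_ring_simps mult.assoc)
next
  case one
  thus ?case by (simp add: complex_ring_simps)
next
  case (incl h)
  thus ?case using z by simp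
qed

text \<open>The products of the powers \<open>z^i\<close>, \<open>i < d\<close>, with a spanning
  list over Q(z) generate a rational space stable under \<open>z\<close>, hence under all of
  Q(z).\<close>

lemma finite_dimension_rational_span:
  assumes z: "algebraic z" and fd: "ring.finite_dimension complex_ring (adjoin_rat z) V"
  obtains T where "finite T" "insert 1 V \<subseteq> ratvec.span T"
    "\<And>x. x \<in> ratvec.span T \<Longrightarrow> z * x \<in> ratvec.span T"
proof -
  interpret field complex_ring by (rule field_from_type_algebra)
  obtain Us where Us: "Span (adjoin_rat z) Us = V"
    using fd exists_base[OF subfield_adjoin_rat] unfolding finite_dimension_def by blast
  obtain d where d: "d > 0" "z ^ d \<in> ratvec.span ((\<lambda>i. z ^ i) ` {..<d})"
    using powers_in_span_if_algebraic[OF z] .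
  \<comment> \<open>The element 1 is added because the values of the approximations also involve
    pure powers of \<open>z\<close>.\<close>
  define S where "S = insert 1 (set Us)"
  define T where "T = (\<lambda>(i, u). z ^ i * u) ` ({..<d} \<times> S)"
  have fin: "finite T" by (simp add: T_def S_def)
  have TI: "z ^ i * u \<in> ratvec.span T" if "i < d" "u \<in> S" for i u
    using that by (intro ratvec.span_base) (auto simp: T_def)
  have top: "z ^ d * u \<in> ratvec.span T" if u: "u \<in> S" for u
    using d(2)
  proof (induction rule: ratvec.span_induct_alt)
    case (step c x y)
    then obtain i where "i < d" "x = z ^ i" by auto
    hence "of_rat c * (z ^ i * u) + y * u \<in> ratvec.span T"
      using step u by (intro ratvec.span_add ratvec.span_scale TI) auto
    thus ?case using \<open>x = z ^ i\<close> by (simp add: algebra_simps)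
  qed (simp add: ratvec.span_zero)
  have "z * x \<in> ratvec.span T" if xT: "x \<in> T" for x
  proof -
    obtain i u where iu: "i < d" "u \<in> S" "x = z ^ i * u" using xT by (auto simp: T_def)
    have "z ^ Suc i * u \<in> ratvec.span T"
      using iu top TI[of "Suc i" u] by (cases "Suc i = d") auto
    thus ?thesis using iu by (simp add: mult.assoc)
  qed
  hence zT: "z * x \<in> ratvec.span T" if "x \<in> ratvec.span T" for x
    using span_closed_mult that by blast
  have ST: "u \<in> ratvec.span T" if "u \<in> S" for u using TI[of 0 u] that d(1) by simp
  have "subalgebra (adjoin_rat z) (ratvec.span T) complex_ring"
    unfolding subalgebra_complex_iff
    using adjoin_rat_closed_subspace[OF fin zT]
    by (auto intro: ratvec.span_zero ratvec.span_add ratvec.span_neg)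
  hence "Span (adjoin_rat z) Us \<subseteq> ratvec.span T"
    by (rule subalgebra_Span_incl[OF subfield_adjoin_rat]) (use ST in \<open>auto simp: S_def\<close>)
  hence "insert 1 V \<subseteq> ratvec.span T" using Us ST by (auto simp: S_def)
  thus thesis using that[OF fin _ zT] by blast
qed

section \<open>Integral combinations of a finite set, measured by the l1 norm of the
  coefficients\<close>

definition int_height :: "complex set \<Rightarrow> real \<Rightarrow> complex \<Rightarrow> bool" where
  "int_height B H x \<longleftrightarrow> (\<exists>c. x = (\<Sum>b\<in>B. of_int (c b) * b) \<and> (\<Sum>b\<in>B. real_of_int \<bar>c b\<bar>) \<le> H)"

lemma int_heightI:
  "x = (\<Sum>b\<in>B. of_int (c b) * b) \<Longrightarrow> (\<Sum>b\<in>B. real_of_int \<bar>c b\<bar>) \<le> H \<Longrightarrow> int_height B H x"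
  unfolding int_height_def by blast

lemma int_heightE:
  assumes "int_height B H x"
  obtains c where "x = (\<Sum>b\<in>B. of_int (c b) * b)" "(\<Sum>b\<in>B. real_of_int \<bar>c b\<bar>) \<le> H"
  using assms unfolding int_height_def by blast

lemma int_height_mono: "int_height B H x \<Longrightarrow> H \<le> H' \<Longrightarrow> int_height B H' x"
  unfolding int_height_def using order_trans by blast

lemma int_height_0: "int_height B 0 0"
  by (rule int_heightI[where c = "\<lambda>_. 0"]) simp_all

lemma int_height_nonneg: "int_height B H x \<Longrightarrow> 0 \<le> H"
  by (erule int_heightE, rule order_trans[rotated], assumption) (simp add: sum_nonneg)

lemma int_height_add:
  assumes "int_height B H x" "int_height B H' y"
  shows "int_height B (H + H') (x + y)"
proof -
  obtain c where c: "x = (\<Sum>b\<in>B. of_int (c b) * b)" "(\<Sum>b\<in>B. real_of_int \<bar>c b\<bar>) \<le> H"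
    using assms(1) by (rule int_heightE)
  obtain d where d: "y = (\<Sum>b\<in>B. of_int (d b) * b)" "(\<Sum>b\<in>B. real_of_int \<bar>d b\<bar>) \<le> H'"
    using assms(2) by (rule int_heightE)
  show ?thesis
  proof (rule int_heightI[where c = "\<lambda>b. c b + d b"])
    show "x + y = (\<Sum>b\<in>B. of_int (c b + d b) * b)"
      by (simp add: c(1) d(1) sum.distrib distrib_right)
    have "(\<Sum>b\<in>B. real_of_int \<bar>c b + d b\<bar>) \<le> (\<Sum>b\<in>B. real_of_int \<bar>c b\<bar> + real_of_int \<bar>d b\<bar>)"
      by (intro sum_mono) linarith
    thus "(\<Sum>b\<in>B. real_of_int \<bar>c b + d b\<bar>) \<le> H + H'"
      using c(2) d(2) by (simp add: sum.distrib)
  qed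
qed

lemma int_height_scale:
  assumes "int_height B H x"
  shows "int_height B (\<bar>of_int k\<bar> * H) (of_int k * x)"
proof -
  obtain c where c: "x = (\<Sum>b\<in>B. of_int (c b) * b)" "(\<Sum>b\<in>B. real_of_int \<bar>c b\<bar>) \<le> H"
    using assms by (rule int_heightE)
  show ?thesis
  proof (rule int_heightI[where c = "\<lambda>b. k * c b"])
    show "of_int k * x = (\<Sum>b\<in>B. of_int (k * c b) * b)"
      by (simp add: c(1) sum_distrib_left mult.assoc)
    show "(\<Sum>b\<in>B. real_of_int \<bar>k * c b\<bar>) \<le> \<bar>of_int k\<bar> * H"
      using mult_left_mono[OF c(2), of "\<bar>of_int k\<bar>"] by (simp add: abs_mult sum_distrib_left)
  qed
qed

lemma int_height_sum:
  assumes "\<And>i. i \<in> I \<Longrightarrow> int_height B (h i) (x i)"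
  shows "int_height B (\<Sum>i\<in>I. h i) (\<Sum>i\<in>I. x i)"
  using assms by (induction I rule: infinite_finite_induct) (simp_all add: int_height_0 int_height_add)

lemma int_height_in_span: "int_height B H x \<Longrightarrow> x \<in> ratvec.span B"
proof (erule int_heightE)
  fix c assume x: "x = (\<Sum>b\<in>B. of_int (c b) * b)"
  have "(\<Sum>b\<in>B. of_rat (of_int (c b)) * b) \<in> ratvec.span B"
    by (intro ratvec.span_sum ratvec.span_scale ratvec.span_base)
  thus "x \<in> ratvec.span B" using x by simp
qed

lemma int_height_base:
  assumes "finite B" "b \<in> B"
  shows "int_height B 1 b"
proof (rule int_heightI[where c = "\<lambda>b'. if b' = b then 1 else 0"])
  have "(\<Sum>b'\<in>B. of_int (if b' = b then 1 else 0) * b') = (\<Sum>b'\<in>B. if b' = b then b' else 0)"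
    by (intro sum.cong) auto
  thus "b = (\<Sum>b'\<in>B. of_int (if b' = b then 1 else 0) * b')" using assms by simp
  have "(\<Sum>b'\<in>B. real_of_int \<bar>if b' = b then 1 else 0\<bar>) = (\<Sum>b'\<in>B. if b' = b then 1 else 0)"
    by (intro sum.cong) auto
  thus "(\<Sum>b'\<in>B. real_of_int \<bar>if b' = b then 1 else 0\<bar>) \<le> 1" using assms by simp
qed

lemma int_height_clear_denominator:
  assumes "finite B" "x \<in> ratvec.span B"
  shows "\<exists>D>0. \<exists>H. int_height B H (of_int D * x)"
  using assms(2)
proof (induction rule: ratvec.span_induct_alt)
  case base
  thus ?case using int_height_0[of B] by (intro exI[of _ 1]) auto
next
  case (step c x y)
  then obtain D H where D: "D > 0" "int_height B H (of_int D * y)" by blast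
  obtain p q where pq: "quotient_of c = (p, q)" by (cases "quotient_of c")
  have q: "q > 0" using quotient_of_denom_pos[OF pq] .
  have c: "of_int p = of_int q * (of_rat c :: complex)"
    using q quotient_of_div[OF pq] by (simp add: of_rat_divide)
  have "int_height B (\<bar>of_int (p * D)\<bar> * 1 + \<bar>of_int q\<bar> * H) (of_int (p * D) * x + of_int q * (of_int D * y))"
    by (rule int_height_add[OF int_height_scale[OF int_height_base[OF assms(1) step(1)]] int_height_scale[OF D(2)]])
  also have "of_int (p * D) * x + of_int q * (of_int D * y) = of_int (q * D) * (of_rat c * x + y)"
    by (simp only: of_int_mult c distrib_left mult_ac)
  finally have "int_height B (\<bar>of_int (p * D)\<bar> * 1 + \<bar>of_int q\<bar> * H) (of_int (q * D) * (of_rat c * x + y))" .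
  moreover have "q * D > 0" using D(1) q by simp
  ultimately show ?case by blast
qed

lemma int_height_common_denominator:
  assumes "finite B" "finite Y" "Y \<subseteq> ratvec.span B"
  shows "\<exists>D::int. \<exists>H. 0 < D \<and> 1 \<le> H \<and> (\<forall>x\<in>Y. int_height B H (of_int D * x))"
  using assms(2,3)
proof (induction Y rule: finite_induct)
  case empty
  show ?case by (intro exI[of _ 1]) auto
next
  case (insert x Y)
  then obtain D H where DH: "0 < D" "1 \<le> H" "\<forall>x\<in>Y. int_height B H (of_int D * x)" by auto
  obtain E G where EG: "0 < E" "int_height B G (of_int E * x)"
    using int_height_clear_denominator[OF assms(1), of x] insert.prems by auto
  have G: "0 \<le> G" using EG(2) by (rule int_height_nonneg)
  define M where "M = \<bar>of_int D\<bar> * G + \<bar>of_int E\<bar> * H"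
  have "int_height B M (of_int (D * E) * y)" if "y \<in> insert x Y" for y
  proof (cases "y = x")
    case True
    have "int_height B (\<bar>of_int D\<bar> * G) (of_int D * (of_int E * x))"
      by (rule int_height_scale[OF EG(2)])
    thus ?thesis using True DH(2) by (auto simp: M_def mult.assoc intro: int_height_mono)
  next
    case False
    hence "int_height B (\<bar>of_int E\<bar> * H) (of_int E * (of_int D * y))"
      using that DH(3) by (intro int_height_scale) auto
    thus ?thesis using G by (auto simp: M_def mult_ac intro: int_height_mono)
  qed
  moreover have "1 \<le> M"
  proof -
    have "1 * 1 \<le> \<bar>of_int E\<bar> * H" using EG(1) DH(2) by (intro mult_mono) auto
    moreover have "0 \<le> \<bar>of_int D\<bar> * G" using G by simp
    ultimately show ?thesis unfolding M_def by linarith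
  qed
  moreover have "0 < D * E" using DH(1) EG(1) by simp
  ultimately show ?case by blast
qed

text \<open>\<open>C\<close> bounds the l1 norms of the columns of the multiplication map, hence its
  operator norm for the l1 norm.\<close>

lemma int_height_mult:
  assumes C: "0 \<le> C" and k: "\<And>b. b \<in> B \<Longrightarrow> int_height B C (k * b)" and x: "int_height B H x"
  shows "int_height B (C * H) (k * x)"
proof -
  obtain c where c: "x = (\<Sum>b\<in>B. of_int (c b) * b)" "(\<Sum>b\<in>B. real_of_int \<bar>c b\<bar>) \<le> H"
    using x by (rule int_heightE)
  have "int_height B (\<Sum>b\<in>B. \<bar>of_int (c b)\<bar> * C) (\<Sum>b\<in>B. of_int (c b) * (k * b))"
    by (intro int_height_sum int_height_scale k)
  also have "(\<Sum>b\<in>B. of_int (c b) * (k * b)) = k * x"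
    by (simp add: c(1) sum_distrib_left mult_ac)
  finally have *: "int_height B (\<Sum>b\<in>B. \<bar>of_int (c b)\<bar> * C) (k * x)" .
  have "(\<Sum>b\<in>B. \<bar>of_int (c b)\<bar> * C) \<le> C * H"
    using mult_right_mono[OF c(2) C] by (simp add: sum_distrib_left mult.commute)
  thus ?thesis using * by (rule int_height_mono[rotated])
qed

text \<open>\<open>S\<close> and \<open>B\<close> span the same rational space, so a maximal
  independent subset of \<open>S\<close> has \<open>card B\<close> elements and its coefficients
  over \<open>B\<close> form a nonsingular integer matrix. The criterion is used in this direction:
  if \<open>H ^ (card B - 1) * e\<close> can be made arbitrarily small, then \<open>b\<close> must
  vanish.\<close>

lemma siegel_bound:
  assumes fin: "finite B" and indep: "ratvec.independent B"
    and ht: "\<And>x. x \<in> S \<Longrightarrow> int_height B H x" and small: "\<And>x. x \<in> S \<Longrightarrow> norm x \<le> e"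
    and span: "B \<subseteq> ratvec.span S" and b: "b \<in> B" and H: "0 \<le> H"
  shows "norm b \<le> fact (card B) * H ^ (card B - 1) * e"
proof -
  define N where "N = card B"
  obtain S' where S': "S' \<subseteq> S" "ratvec.independent S'" "S \<subseteq> ratvec.span S'"
    using ratvec.maximal_independent_subset .
  have "S' \<subseteq> ratvec.span B" using S'(1) ht int_height_in_span by blast
  hence finS': "finite S'" "card S' \<le> N"
    using ratvec.independent_span_bound[OF fin S'(2)] by (auto simp: N_def)
  have "ratvec.span S \<subseteq> ratvec.span S'" by (rule ratvec.span_minimal[OF S'(3) ratvec.subspace_span])
  hence "N \<le> card S'"
    using ratvec.independent_span_bound[OF finS'(1) indep] span unfolding N_def by blast
  hence card: "card S' = N" using finS' by simp
  obtain f where f: "bij_betw f {..<N} S'"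
    using ex_bij_betw_nat_finite[OF finS'(1)] card by (auto simp: lessThan_atLeast0)
  obtain g where g: "bij_betw g {..<N} B"
    using ex_bij_betw_nat_finite[OF fin] by (auto simp: lessThan_atLeast0 N_def)
  have fS: "f i \<in> S" if "i < N" for i using f S'(1) that by (auto simp: bij_betw_def)
  have "\<exists>c. \<forall>i<N. f i = (\<Sum>b\<in>B. of_int (c i b) * b) \<and> (\<Sum>b\<in>B. real_of_int \<bar>c i b\<bar>) \<le> H"
    using ht[OF fS] unfolding int_height_def by metis
  then obtain c where c: "\<And>i. i < N \<Longrightarrow> f i = (\<Sum>b\<in>B. of_int (c i b) * b)"
    "\<And>i. i < N \<Longrightarrow> (\<Sum>b\<in>B. real_of_int \<bar>c i b\<bar>) \<le> H" by blast
  define A where "A = Matrix.mat N N (\<lambda>(i, j). c i (g j))"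
  have A: "A \<in> carrier_mat N N" by (simp add: A_def)
  have f_eq: "f i = (\<Sum>j<N. of_int (A $$ (i, j)) * g j)" if "i < N" for i
    using that c(1)[OF that] sum.reindex_bij_betw[OF g, of "\<lambda>b. of_int (c i b) * b"] by (simp add: A_def)
  have "Determinant.det A \<noteq> 0"
  proof
    assume "Determinant.det A = 0"
    hence "Determinant.det (transpose_mat A) = 0" using det_transpose[OF A] by simp
    \<comment> \<open>The kernel vector has integer entries, so it is directly a rational relation
      between the rows, that is, between the elements of \<open>S'\<close>.\<close>
    then obtain v where v: "v \<in> carrier_vec N" "v \<noteq> 0\<^sub>v N" "transpose_mat A *\<^sub>v v = 0\<^sub>v N"
      using det_0_iff_vec_prod_zero[of "transpose_mat A" N] A by auto
    have col: "(\<Sum>i<N. vec_index v i * A $$ (i, j)) = 0" if j: "j < N" for j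
    proof -
      have "vec_index (transpose_mat A *\<^sub>v v) j = (\<Sum>i<N. A $$ (i, j) * vec_index v i)"
        using A v(1) j by (simp add: scalar_prod_def lessThan_atLeast0)
      thus ?thesis using v(3) j by (simp add: mult.commute)
    qed
    have "(\<Sum>i<N. of_int (vec_index v i) * f i) = (\<Sum>i<N. \<Sum>j<N. of_int (vec_index v i * A $$ (i, j)) * g j)"
      by (intro sum.cong refl) (simp add: f_eq sum_distrib_left mult.assoc)
    also have "\<dots> = (\<Sum>j<N. of_int (\<Sum>i<N. vec_index v i * A $$ (i, j)) * g j)"
      by (subst sum.swap) (simp add: sum_distrib_right)
    also have "\<dots> = 0" using col by (intro sum.neutral) auto
    finally have rel: "(\<Sum>i<N. of_int (vec_index v i) * f i) = 0" .
    obtain k where k: "k < N" "vec_index v k \<noteq> 0" using v(1,2) by (metis carrier_vecD eq_vecI index_zero_vec)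
    define u where "u x = (of_int (vec_index v (the_inv_into {..<N} f x)) :: rat)" for x
    have uf: "u (f i) = of_int (vec_index v i)" if "i < N" for i
      using that f by (simp add: u_def bij_betw_def the_inv_into_f_f)
    have "(\<Sum>x\<in>S'. of_rat (u x) * x) = (\<Sum>i<N. of_rat (u (f i)) * f i)"
      by (rule sum.reindex_bij_betw[OF f, symmetric])
    also have "\<dots> = 0" using rel by (simp add: uf)
    finally have "(\<Sum>x\<in>S'. of_rat (u x) * x) = 0" .
    moreover have "f k \<in> S'" "u (f k) \<noteq> 0" using k f by (auto simp: uf bij_betw_def)
    ultimately have "ratvec.dependent S'"
      unfolding ratvec.dependent_finite[OF finS'(1)] by (intro exI[of _ u] conjI bexI[of _ "f k"])
    thus False using S'(2) by simp
  qed
  moreover obtain j where j: "j < N" "b = g j" using b g by (auto simp: bij_betw_def)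
  moreover have "\<bar>A $$ (i, j)\<bar> \<le> \<lfloor>H\<rfloor>" if ij: "i < N" "j < N" for i j
  proof -
    have "g j \<in> B" using ij g by (auto simp: bij_betw_def)
    hence "real_of_int \<bar>c i (g j)\<bar> \<le> (\<Sum>b\<in>B. real_of_int \<bar>c i b\<bar>)"
      using fin by (intro member_le_sum) auto
    also have "\<dots> \<le> H" by (rule c(2)[OF ij(1)])
    finally show ?thesis using ij by (simp add: A_def le_floor_iff)
  qed
  moreover have "norm (\<Sum>j<N. of_int (A $$ (i, j)) * g j) \<le> e" if "i < N" for i
    using small[OF fS[OF that]] f_eq[OF that] by simp
  ultimately have "norm b \<le> of_nat (fact N) * of_int \<lfloor>H\<rfloor> ^ (N - 1) * e"
    using nonsingular_int_mat_bound[OF A, of j "\<lfloor>H\<rfloor>" g e] by simp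
  also have "\<dots> \<le> fact N * H ^ (N - 1) * e"
  proof -
    have "0 \<le> e" using small[OF fS[OF j(1)]] norm_ge_zero order_trans by blast
    moreover have "real_of_int \<lfloor>H\<rfloor> ^ (N - 1) \<le> H ^ (N - 1)" using H by (intro power_mono) auto
    ultimately show ?thesis by (simp add: mult_left_mono mult_right_mono)
  qed
  finally show ?thesis by (simp add: N_def)
qed

section \<open>Analytic continuation of power series to the cut plane\<close>

definition extends :: "(nat \<Rightarrow> complex) \<Rightarrow> (complex \<Rightarrow> complex) \<Rightarrow> bool" where
  "extends c F \<longleftrightarrow> F holomorphic_on cut_plane \<and> (\<forall>z. norm z < 1 \<longrightarrow> (\<lambda>t. c t * z ^ t) sums F z)"

lemma extendsD:
  assumes "extends c F"
  shows "F holomorphic_on cut_plane" "norm z < 1 \<Longrightarrow> (\<lambda>t. c t * z ^ t) sums F z"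
  using assms by (auto simp: extends_def)

lemma extends_unique:
  assumes "extends c F" "extends c G" "z \<in> cut_plane"
  shows "F z = G z"
proof (rule analytic_continuation_open[of "ball 0 1" cut_plane F G])
  show "connected cut_plane" using starlike_cut_plane by (rule starlike_imp_connected)
  show "F w = G w" if "w \<in> ball 0 1" for w
    using assms that by (auto simp: extends_def intro: sums_unique2)
qed (use assms open_cut_plane ball_subset_cut_plane in \<open>auto simp: extends_def\<close>)

text \<open>Evaluation at \<open>z\<close> viewed as a functional of the coefficient sequence, so
  that linear identities between rational functions become identities between numbers also where the
  series diverges. It is meaningful for continuable sequences and \<open>z\<close> in the cut
  plane.\<close>

definition continued_value :: "complex \<Rightarrow> (nat \<Rightarrow> complex) \<Rightarrow> complex" where
  "continued_value z c = (SOME F. extends c F) z"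

definition continuable :: "(nat \<Rightarrow> complex) \<Rightarrow> bool" where
  "continuable c \<longleftrightarrow> (\<exists>F. extends c F)"

lemma continued_value_eqI:
  assumes "extends c F" "z \<in> cut_plane"
  shows "continued_value z c = F z"
  unfolding continued_value_def
  using extends_unique[OF someI[of "extends c", OF assms(1)] assms] .

lemma extends_add: "extends c F \<Longrightarrow> extends d G \<Longrightarrow> extends (\<lambda>t. c t + d t) (\<lambda>z. F z + G z)"
  by (auto simp: extends_def distrib_right intro!: holomorphic_intros sums_add)

lemma extends_cmult: "extends c F \<Longrightarrow> extends (\<lambda>t. a * c t) (\<lambda>z. a * F z)"
  by (auto simp: extends_def mult.assoc intro!: holomorphic_intros sums_mult)

text \<open>\<open>(F z - c 0) / z\<close> has a removable singularity at 0. The shifted power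
  series fills it in, and both descriptions agree on the punctured disc.\<close>

lemma extends_Suc:
  assumes "extends c F"
  obtains G where "extends (\<lambda>t. c (Suc t)) G" "\<And>z. z \<in> cut_plane \<Longrightarrow> z * G z = F z - c 0"
proof -
  define h where "h z = (\<Sum>t. c (Suc t) * z ^ t)" for z
  define G where "G z = (if norm z < 1 then h z else (F z - c 0) / z)" for z
  have h: "(\<lambda>t. c (Suc t) * z ^ t) sums h z" if "norm z < 1" for z
    using extendsD(2)[OF assms that] unfolding h_def
    by (intro summable_sums) (simp add: sums_iff summable_powser_split_head)
  have zh: "z * h z = F z - c 0" if "norm z < 1" for z
  proof -
    have "(\<lambda>t. z * (c (Suc t) * z ^ t)) sums (z * h z)" using h[OF that] by (rule sums_mult)
    hence "(\<lambda>t. c (Suc t) * z ^ Suc t) sums (z * h z)" by (simp add: mult_ac)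
    moreover have "(\<lambda>t. c (Suc t) * z ^ Suc t) sums (F z - c 0)"
      using extendsD(2)[OF assms that] by (subst sums_Suc_iff) simp
    ultimately show ?thesis by (rule sums_unique2)
  qed
  have G_eq: "G z = (F z - c 0) / z" if "z \<noteq> 0" for z
    using zh[of z] that by (auto simp: G_def field_simps)
  have "h holomorphic_on ball 0 1"
    by (rule power_series_holomorphic[of 0 1 "\<lambda>t. c (Suc t)"]) (use h in auto)
  hence "G holomorphic_on ball 0 1"
    by (rule holomorphic_transform) (auto simp: G_def)
  moreover have "(\<lambda>z. (F z - c 0) / z) holomorphic_on (cut_plane - {0})"
    by (intro holomorphic_intros holomorphic_on_subset[OF extendsD(1)[OF assms]]) auto
  hence "G holomorphic_on (cut_plane - {0})"
    by (rule holomorphic_transform) (auto simp: G_eq)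
  ultimately have "G holomorphic_on (ball 0 1 \<union> (cut_plane - {0}))"
    by (intro holomorphic_on_Un open_ball open_Diff open_cut_plane) auto
  moreover have "ball 0 1 \<union> (cut_plane - {0}) = cut_plane"
    using ball_subset_cut_plane by auto
  ultimately have "extends (\<lambda>t. c (Suc t)) G"
    unfolding extends_def by (auto simp: G_def h)
  moreover have "z * G z = F z - c 0" for z
    using zh[of 0] G_eq[of z] by (cases "z = 0") auto
  ultimately show thesis using that by blast
qed

text \<open>The Euler operator \<open>z d/dz\<close> multiplies the coefficient of
  \<open>z^t\<close> by \<open>t\<close>.\<close>

lemma extends_mult_index:
  assumes "extends c F"
  shows "extends (\<lambda>t. of_nat t * c t) (\<lambda>z. z * deriv F z)"
  unfolding extends_def
proof (intro conjI allI impI)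
  show "(\<lambda>z. z * deriv F z) holomorphic_on cut_plane"
    by (intro holomorphic_intros extendsD(1)[OF assms] open_cut_plane)
  fix z :: complex assume z: "norm z < 1"
  hence "z \<in> cut_plane" using ball_subset_cut_plane by auto
  hence "(F has_field_derivative deriv F z) (at z)"
    using extendsD(1)[OF assms] open_cut_plane by (simp add: holomorphic_derivI)
  hence "(\<lambda>t. diffs c t * z ^ t) sums deriv F z"
    using termdiffs_sums_strong[of 1 c F "deriv F z" z] extendsD(2)[OF assms] z by simp
  hence "(\<lambda>t. z * (diffs c t * z ^ t)) sums (z * deriv F z)" by (rule sums_mult)
  hence "(\<lambda>t. of_nat (Suc t) * c (Suc t) * z ^ Suc t) sums (z * deriv F z)"
    by (simp add: diffs_def mult_ac)
  thus "(\<lambda>t. of_nat t * c t * z ^ t) sums (z * deriv F z)"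
    by (subst (asm) sums_Suc_iff) simp
qed

lemma scaled_in_cut_plane:
  assumes "z \<in> cut_plane" "0 \<le> x" "x \<le> 1"
  shows "of_real x * z \<in> cut_plane"
  using closed_segment_0_cut_plane[OF assms(1)] assms(2,3)
  by (force simp: closed_segment_def scaleR_conv_of_real)

text \<open>Termwise, \<open>p x * (x z)^t\<close> integrates to \<open>m t * z^t\<close>. The
  integral exists on the whole cut plane because that set is starlike about 0, so it provides the
  continuation. For a polynomial \<open>p\<close> this turns multiplication of the coefficients by a
  rational function with simple poles into an integral operator.\<close>

lemma extends_moments:
  fixes p :: "real \<Rightarrow> real" and m :: "nat \<Rightarrow> real"
  assumes ext: "extends c F" and p: "continuous_on {0..1} p"
    and m: "\<And>t. ((\<lambda>x. p x * x ^ t) has_integral m t) {0..1}"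
  shows "extends (\<lambda>t. c t * of_real (m t)) (\<lambda>z. integral {0..1} (\<lambda>x. of_real (p x) * F (of_real x * z)))"
  unfolding extends_def
proof (intro conjI allI impI)
  note holo = extendsD(1)[OF ext]
  let ?G = "\<lambda>z. integral {0..1} (\<lambda>x. of_real (p x) * F (of_real x * z))"
  have cF: "continuous_on cut_plane F" using holo by (rule holomorphic_on_imp_continuous_on)
  have cdF: "continuous_on cut_plane (deriv F)"
    using holo open_cut_plane holomorphic_deriv holomorphic_on_imp_continuous_on by blast
  have int: "(\<lambda>x. of_real (p x) * F (of_real x * z)) integrable_on cbox 0 1" if "z \<in> cut_plane" for z
    using that by (intro integrable_continuous continuous_intros continuous_on_compose2[OF cF])
      (auto intro!: p scaled_in_cut_plane)
  \<comment> \<open>Differentiation under the integral sign, on a small ball around each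
    point.\<close>
  show "?G holomorphic_on cut_plane"
  proof (rule analytic_imp_holomorphic, unfold analytic_on_def, intro ballI)
    fix z assume "z \<in> cut_plane"
    then obtain r where r: "r > 0" "ball z r \<subseteq> cut_plane"
      using open_cut_plane open_contains_ball by blast
    have "(\<lambda>z. integral (cbox 0 1) (\<lambda>x. of_real (p x) * F (of_real x * z))) holomorphic_on ball z r"
    proof (rule leibniz_rule_holomorphic)
      fix w t assume w: "w \<in> ball z r" "t \<in> cbox (0::real) 1"
      hence "of_real t * w \<in> cut_plane" using r by (intro scaled_in_cut_plane) auto
      hence "(F has_field_derivative deriv F (of_real t * w)) (at (of_real t * w))"
        using holo open_cut_plane by (simp add: holomorphic_derivI)
      hence "((\<lambda>w. F (of_real t * w)) has_field_derivative deriv F (of_real t * w) * of_real t) (at w)"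
        by (rule DERIV_chain2[where f = F and g = "\<lambda>w. of_real t * w" and Db = "of_real t"])
          (auto intro!: derivative_eq_intros)
      hence "((\<lambda>w. of_real (p t) * F (of_real t * w)) has_field_derivative
          of_real (p t) * (deriv F (of_real t * w) * of_real t)) (at w)"
        by (rule DERIV_cmult)
      thus "((\<lambda>w. of_real (p t) * F (of_real t * w)) has_field_derivative
          of_real (p t) * (deriv F (of_real t * w) * of_real t)) (at w within ball z r)"
        by (rule has_field_derivative_at_within)
    next
      have "continuous_on (ball z r \<times> {0..1}) (\<lambda>y. of_real (p (snd y)) * (deriv F (of_real (snd y) * fst y) * of_real (snd y)))"
        by (intro continuous_intros continuous_on_compose2[OF cdF] continuous_on_compose2[OF p])
          (use r in \<open>auto intro!: scaled_in_cut_plane\<close>)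
      thus "continuous_on (ball z r \<times> cbox 0 1) (\<lambda>(w, t). of_real (p t) * (deriv F (of_real t * w) * of_real t))"
        by (simp add: case_prod_unfold)
    qed (use int r in auto)
    thus "\<exists>e>0. ?G holomorphic_on ball z e" using r by auto
  qed
  fix z :: complex assume z: "norm z < 1"
  have sumF: "(\<lambda>t. c t * (of_real x * z) ^ t) sums F (of_real x * z)" if "x \<in> {0..1}" for x
  proof (rule extendsD(2)[OF ext])
    have "norm (of_real x * z) \<le> 1 * norm z" unfolding norm_mult using that by (intro mult_right_mono) auto
    thus "norm (of_real x * z) < 1" using z by simp
  qed
  obtain C where C: "\<And>x. x \<in> {0..1} \<Longrightarrow> \<bar>p x\<bar> \<le> C"
  proof -
    have "bounded (p ` {0..1})" by (intro compact_imp_bounded compact_continuous_image p) auto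
    then obtain a where "\<forall>x\<in>{0..1}. \<bar>p x\<bar> \<le> a" by (auto simp: bounded_iff)
    thus thesis using that by blast
  qed
  obtain r where r: "norm z < r" "r < 1" using z dense by blast
  have "summable (\<lambda>t. c t * of_real r ^ t)"
    using extendsD(2)[OF ext, of "of_real r"] r norm_ge_zero[of z] by (auto simp: sums_iff)
  hence "summable (\<lambda>t. norm (c t * z ^ t))"
    by (rule powser_insidea) (use r norm_ge_zero[of z] in auto)
  hence summ: "summable (\<lambda>t. C * norm (c t * z ^ t))" by (rule summable_mult)
  \<comment> \<open>The series converges uniformly in \<open>x\<close>, dominated by
    \<open>C * norm (c t * z ^ t)\<close>, so sum and integral may be interchanged.\<close>
  have "uniform_limit {0..1} (\<lambda>n x. \<Sum>t<n. of_real (p x) * (c t * (of_real x * z) ^ t))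
          (\<lambda>x. \<Sum>t. of_real (p x) * (c t * (of_real x * z) ^ t)) sequentially"
  proof (rule Weierstrass_m_test[OF _ summ])
    fix t and x :: real assume x: "x \<in> {0..1}"
    have "norm (of_real (p x) * (c t * (of_real x * z) ^ t)) = \<bar>p x\<bar> * (norm (c t * z ^ t) * \<bar>x\<bar> ^ t)"
      by (simp add: norm_mult norm_power power_mult_distrib)
    also have "\<dots> \<le> C * (norm (c t * z ^ t) * 1)"
      using C[OF x] x by (intro mult_mono) (auto intro: power_le_one order_trans[OF abs_ge_zero C[OF x]])
    finally show "norm (of_real (p x) * (c t * (of_real x * z) ^ t)) \<le> C * norm (c t * z ^ t)" by simp
  qed
  also have "?this \<longleftrightarrow> uniform_limit {0..1} (\<lambda>n x. \<Sum>t<n. of_real (p x) * (c t * (of_real x * z) ^ t))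
          (\<lambda>x. of_real (p x) * F (of_real x * z)) sequentially"
    by (intro uniform_limit_cong' refl) (auto intro!: sums_unique[symmetric] sums_mult sumF)
  finally have ul: \<dots> .
  have cont: "continuous_on {0..1} (\<lambda>x. \<Sum>t<n. of_real (p x) * (c t * (of_real x * z) ^ t))" for n
    by (intro continuous_intros p)
  obtain I J where I: "\<And>n. ((\<lambda>x. \<Sum>t<n. of_real (p x) * (c t * (of_real x * z) ^ t)) has_integral I n) {0..1}"
    and J: "((\<lambda>x. of_real (p x) * F (of_real x * z)) has_integral J) {0..1}" and lim: "I \<longlonglongrightarrow> J"
    by (rule uniform_limit_integral[OF ul cont]) auto
  have "I = (\<lambda>n. \<Sum>t<n. c t * of_real (m t) * z ^ t)"
  proof (rule HOL.ext, rule has_integral_unique[OF I])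
    have "((\<lambda>x. c t * z ^ t * of_real (p x * x ^ t)) has_integral c t * z ^ t * of_real (m t)) {0..1}" for t
      by (intro has_integral_mult_right has_integral_of_real m)
    thus "((\<lambda>x. \<Sum>t<n. of_real (p x) * (c t * (of_real x * z) ^ t)) has_integral
        (\<Sum>t<n. c t * of_real (m t) * z ^ t)) {0..1}" for n
      by (intro has_integral_sum) (auto simp: power_mult_distrib mult_ac)
  qed
  thus "(\<lambda>t. c t * of_real (m t) * z ^ t) sums ?G z"
    using lim integral_unique[OF J] by (simp add: sums_def)
qed

text \<open>At the point \<open>y z\<close> the integrand is at most
  \<open>q x * B * (x y)^L\<close>: the factor \<open>y^L\<close> comes out and the rest integrates
  to \<open>B * I\<close>. The shape of the bound is preserved, so the estimate can be
  iterated.\<close>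

lemma norm_moment_integral_le:
  fixes p q :: "real \<Rightarrow> real" and F :: "complex \<Rightarrow> complex"
  assumes F: "continuous_on cut_plane F" and z: "z \<in> cut_plane" and p: "continuous_on {0..1} p"
    and bound: "\<And>x. 0 \<le> x \<Longrightarrow> x \<le> 1 \<Longrightarrow> norm (F (of_real x * z)) \<le> B * x ^ L"
    and q: "\<And>x. 0 \<le> x \<Longrightarrow> x \<le> 1 \<Longrightarrow> \<bar>p x\<bar> \<le> q x"
    and I: "((\<lambda>x. q x * x ^ L) has_integral I) {0..1}"
    and y: "0 \<le> y" "y \<le> 1"
  shows "norm (integral {0..1} (\<lambda>x. of_real (p x) * F (of_real x * (of_real y * z)))) \<le> B * I * y ^ L"
proof -
  have B: "0 \<le> B" using order_trans[OF norm_ge_zero bound[of 1]] by simp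
  have J: "((\<lambda>x. B * y ^ L * (q x * x ^ L)) has_integral B * y ^ L * I) {0..1}"
    by (intro has_integral_mult_right I)
  have "norm (integral {0..1} (\<lambda>x. of_real (p x) * F (of_real x * (of_real y * z))))
      \<le> integral {0..1} (\<lambda>x. B * y ^ L * (q x * x ^ L))"
  proof (rule Henstock_Kurzweil_Integration.integral_norm_bound_integral)
    show "(\<lambda>x. of_real (p x) * F (of_real x * (of_real y * z))) integrable_on {0..1}"
      using y z by (intro integrable_continuous_real continuous_intros continuous_on_compose2[OF F])
        (auto intro!: p scaled_in_cut_plane)
    show "(\<lambda>x. B * y ^ L * (q x * x ^ L)) integrable_on {0..1}" using J by (rule has_integral_integrable)
    fix x :: real assume x: "x \<in> {0..1}"
    have xy: "0 \<le> x * y" "x * y \<le> 1" using x y by (auto intro: mult_le_one)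
    have "norm (of_real (p x) * F (of_real x * (of_real y * z))) = \<bar>p x\<bar> * norm (F (of_real (x * y) * z))"
      by (simp add: norm_mult mult.assoc)
    also have "\<dots> \<le> q x * (B * (x * y) ^ L)"
      using x q[of x] by (intro mult_mono bound xy) auto
    finally show "norm (of_real (p x) * F (of_real x * (of_real y * z))) \<le> B * y ^ L * (q x * x ^ L)"
      by (simp add: power_mult_distrib mult_ac)
  qed
  also have "\<dots> = B * y ^ L * I" using J by (rule integral_unique)
  finally show ?thesis by (simp add: mult_ac)
qed

section \<open>Explicit continuations of the geometric and binomial series\<close>

lemma extends_const_1: "extends (\<lambda>t. 1) (\<lambda>z. 1 / (1 - z))"
  unfolding extends_def
proof (intro conjI allI impI)
  show "(\<lambda>z. 1 / (1 - z)) holomorphic_on cut_plane"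
    by (intro holomorphic_intros) (auto simp: cut_plane_def image_iff dest!: spec[of _ "1::real"])
qed (simp add: geometric_sums)

text \<open>The Cauchy product with the geometric series replaces coefficients by their partial
  sums, and the hockey-stick identity evaluates these.\<close>

lemma sums_choose:
  fixes z :: complex
  assumes "norm z < 1"
  shows "(\<lambda>t. of_nat (t choose L) * z ^ t) sums (z ^ L / (1 - z) ^ Suc L)"
  using assms
proof (induction L arbitrary: z)
  case 0
  thus ?case using geometric_sums[of z] by simp
next
  case (Suc L)
  \<comment> \<open>The coefficients are nonnegative, so absolute convergence at \<open>z\<close> is
    convergence at \<open>norm z\<close>; hence the induction over arbitrary
    \<open>z\<close>.\<close>
  have summ: "summable (\<lambda>t. norm (of_nat (t choose L) * z ^ t))"
  proof -
    have "summable (\<lambda>t. complex_of_real (real (t choose L) * norm z ^ t))"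
      using Suc.IH[of "of_real (norm z)"] Suc.prems by (simp add: sums_iff)
    hence "summable (\<lambda>t. real (t choose L) * norm z ^ t)" by (simp only: summable_complex_of_real)
    thus ?thesis by (simp add: norm_mult norm_power)
  qed
  have "(\<lambda>t. \<Sum>i\<le>t. (of_nat (i choose L) * z ^ i) * z ^ (t - i)) sums
          ((\<Sum>t. of_nat (t choose L) * z ^ t) * (\<Sum>t. z ^ t))"
    using Suc.prems by (intro Cauchy_product_sums summ) (simp add: norm_power)
  also have "(\<lambda>t. \<Sum>i\<le>t. (of_nat (i choose L) * z ^ i) * z ^ (t - i)) = (\<lambda>t. of_nat (Suc t choose Suc L) * z ^ t)"
  proof
    fix t
    have "(\<Sum>i\<le>t. (of_nat (i choose L) * z ^ i) * z ^ (t - i)) = (\<Sum>i\<le>t. of_nat (i choose L)) * z ^ t"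
      unfolding sum_distrib_right
      by (intro sum.cong refl) (simp add: mult.assoc flip: power_add)
    thus "(\<Sum>i\<le>t. (of_nat (i choose L) * z ^ i) * z ^ (t - i)) = of_nat (Suc t choose Suc L) * z ^ t"
      by (simp only: sum_choose_upper[symmetric] of_nat_sum)
  qed
  also have "(\<Sum>t. of_nat (t choose L) * z ^ t) * (\<Sum>t. z ^ t) = z ^ L / (1 - z) ^ Suc L * (1 / (1 - z))"
    using sums_unique[OF Suc.IH[OF Suc.prems]] suminf_geometric[OF Suc.prems] by simp
  finally have "(\<lambda>t. z * (of_nat (Suc t choose Suc L) * z ^ t)) sums (z * (z ^ L / (1 - z) ^ Suc L * (1 / (1 - z))))"
    by (rule sums_mult)
  hence "(\<lambda>t. of_nat (Suc t choose Suc L) * z ^ Suc t) sums (z ^ Suc L / (1 - z) ^ Suc (Suc L))"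
    by (simp only: power_Suc mult_ac times_divide_eq_left times_divide_eq_right divide_divide_eq_left mult_1_left)
  thus ?case by (subst (asm) sums_Suc_iff) simp
qed

lemma extends_choose: "extends (\<lambda>t. of_nat (t choose L)) (\<lambda>z. z ^ L / (1 - z) ^ Suc L)"
  unfolding extends_def
proof (intro conjI allI impI)
  show "(\<lambda>z. z ^ L / (1 - z) ^ Suc L) holomorphic_on cut_plane"
    by (intro holomorphic_intros) (auto simp: cut_plane_def image_iff dest!: spec[of _ "1::real"])
qed (rule sums_choose)

section \<open>Nondegeneracy\<close>

lemma continuableI: "extends c F \<Longrightarrow> continuable c"
  unfolding continuable_def by blast

lemma continuable_add: "continuable c \<Longrightarrow> continuable d \<Longrightarrow> continuable (\<lambda>t. c t + d t)"
  unfolding continuable_def using extends_add by blast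

lemma continuable_cmult: "continuable c \<Longrightarrow> continuable (\<lambda>t. a * c t)"
  unfolding continuable_def using extends_cmult by blast

lemma continuable_mult_index: "continuable c \<Longrightarrow> continuable (\<lambda>t. of_nat t * c t)"
  unfolding continuable_def using extends_mult_index by blast

lemma continued_value_add:
  assumes "continuable c" "continuable d" "z \<in> cut_plane"
  shows "continued_value z (\<lambda>t. c t + d t) = continued_value z c + continued_value z d"
proof -
  obtain F G where "extends c F" "extends d G" using assms unfolding continuable_def by blast
  thus ?thesis using assms(3) by (simp add: continued_value_eqI continued_value_eqI[OF extends_add])
qed

lemma continued_value_cmult:
  assumes "continuable c" "z \<in> cut_plane"
  shows "continued_value z (\<lambda>t. a * c t) = a * continued_value z c"
proof -
  obtain F where "extends c F" using assms unfolding continuable_def by blast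
  thus ?thesis using assms(2) by (simp add: continued_value_eqI continued_value_eqI[OF extends_cmult])
qed

lemma continued_value_Suc:
  assumes "continuable c" "z \<in> cut_plane"
  shows "continuable (\<lambda>t. c (Suc t))" "z * continued_value z (\<lambda>t. c (Suc t)) = continued_value z c - c 0"
proof -
  obtain F where F: "extends c F" using assms unfolding continuable_def by blast
  obtain G where G: "extends (\<lambda>t. c (Suc t)) G" "\<And>z. z \<in> cut_plane \<Longrightarrow> z * G z = F z - c 0"
    using extends_Suc[OF F] by metis
  show "continuable (\<lambda>t. c (Suc t))" using G(1) by (rule continuableI)
  show "z * continued_value z (\<lambda>t. c (Suc t)) = continued_value z c - c 0"
    using G(2)[OF assms(2)] continued_value_eqI[OF F assms(2)] continued_value_eqI[OF G(1) assms(2)] by simp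
qed

lemma continuable_poly: "continuable (\<lambda>t. poly P (of_nat t))"
proof (induction P)
  case 0
  show ?case using continuable_cmult[OF continuableI[OF extends_const_1], of 0] by simp
next
  case (pCons a P)
  have "continuable (\<lambda>t. a * 1 + of_nat t * poly P (of_nat t))"
    by (intro continuable_add continuable_cmult continuable_mult_index pCons continuableI[OF extends_const_1])
  thus ?case by simp
qed

lemma has_integral_monomial: "((\<lambda>x. x ^ k) has_integral 1 / (real k + 1)) {0..1::real}"
proof -
  have "((\<lambda>x. x ^ k) has_integral (1 ^ Suc k / (real k + 1) - 0 ^ Suc k / (real k + 1))) {0..1::real}"
  proof (rule fundamental_theorem_of_calculus)
    fix x :: real
    have "((\<lambda>x. x ^ Suc k / (real k + 1)) has_real_derivative x ^ k) (at x within {0..1})"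
      by (rule DERIV_cong[OF DERIV_cdivide[OF DERIV_power_Suc[OF DERIV_ident]]]) (simp add: field_simps)
    thus "((\<lambda>x. x ^ Suc k / (real k + 1)) has_vector_derivative x ^ k) (at x within {0..1})"
      by (simp only: has_real_derivative_iff_has_vector_derivative)
  qed simp
  thus ?thesis by simp
qed

text \<open>\<open>1 / (t + j + 1)\<close> is the moment of order \<open>t\<close> of
  \<open>x^j\<close> on the unit interval.\<close>

lemma continuable_divide_linear:
  assumes "continuable c"
  shows "continuable (\<lambda>t. c t / (of_nat t + of_nat j + 1))"
proof -
  obtain F where F: "extends c F" using assms unfolding continuable_def by blast
  have "continuable (\<lambda>t. c t * of_real (1 / (real (j + t) + 1)))"
  proof (rule continuableI[OF extends_moments[OF F, of "\<lambda>x. x ^ j"]])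
    show "((\<lambda>x. x ^ j * x ^ t) has_integral 1 / (real (j + t) + 1)) {0..1}" for t
      using has_integral_monomial[of "j + t"] by (simp add: power_add)
  qed (intro continuous_intros)
  thus ?thesis by (simp add: add_ac)
qed

text \<open>The number \<open>m\<close> of poles is a parameter because a shift of the index by 1
  adds one pole: telescoping leads from \<open>m = n\<close> to \<open>m = Suc n\<close>.\<close>

definition quot :: "nat \<Rightarrow> nat \<Rightarrow> complex poly \<Rightarrow> nat \<Rightarrow> complex" where
  "quot a m P t = poly P (of_nat t) / (\<Prod>i<m. of_nat t + of_nat i + 1) ^ a"

lemma continuable_quot: "continuable (quot a m P)"
proof -
  have *: "continuable (\<lambda>t. c t / (of_nat t + of_nat j + 1) ^ k)" if "continuable c" for c j k
  proof (induction k)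
    case (Suc k)
    show ?case using continuable_divide_linear[OF Suc, of j] by (simp add: mult.commute)
  qed (simp add: that)
  have "continuable (\<lambda>t. poly P (of_nat t) / (\<Prod>i<m. of_nat t + of_nat i + 1) ^ a)"
  proof (induction m)
    case (Suc m)
    from *[OF Suc, of m a] show ?case by (simp add: power_mult_distrib)
  qed (simp add: continuable_poly)
  thus ?thesis unfolding quot_def .
qed

lemma of_nat_add_1_neq_0 [simp]: "of_nat t + of_nat i + 1 \<noteq> (0 :: complex)"
  using of_nat_neq_0[of "t + i"] by (simp add: add_ac)

text \<open>The telescoping relation behind the nondegeneracy argument: rational functions of the form
  \<open>z R(t + 1) - R(t)\<close> have an explicit continued value.\<close>

lemma continued_value_telescope:
  fixes P :: "complex poly" and a n :: nat
  assumes z: "z \<in> cut_plane"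
  defines "P' \<equiv> smult z ([:1, 1:] ^ a * pcompose P [:1, 1:]) - [:of_nat n + 1, 1:] ^ a * P"
  shows "continued_value z (quot a (Suc n) P') = - (poly P 0 / fact n ^ a)"
proof -
  let ?c = "quot a n P"
  have eq: "quot a (Suc n) P' t = z * ?c (Suc t) + (- 1) * ?c t" for t
  proof -
    define D where "D = (\<Prod>i<n. of_nat t + of_nat i + (1::complex))"
    define E where "E = (\<Prod>i<n. of_nat (Suc t) + of_nat i + (1::complex))"
    \<comment> \<open>The product of \<open>n + 1\<close> factors contains both the denominator
      \<open>D\<close> at \<open>t\<close> and the denominator \<open>E\<close> at
      \<open>t + 1\<close>.\<close>
    have prod: "(\<Prod>i<Suc n. of_nat t + of_nat i + (1::complex)) = D * (of_nat t + of_nat n + 1)"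
      "(\<Prod>i<Suc n. of_nat t + of_nat i + (1::complex)) = (of_nat t + 1) * E"
      unfolding D_def E_def
      by simp (subst prod.lessThan_Suc_shift, simp add: add_ac)
    have nz: "D \<noteq> 0" "E \<noteq> 0" "(of_nat t + 1 :: complex) \<noteq> 0"
      using of_nat_add_1_neq_0[of t 0] of_nat_add_1_neq_0[of "Suc t"] by (auto simp: D_def E_def simp del: of_nat_Suc)
    have "quot a (Suc n) P' t = z * ((of_nat t + 1) ^ a * poly P (of_nat (Suc t))) / ((of_nat t + 1) * E) ^ a
        - (of_nat t + of_nat n + 1) ^ a * poly P (of_nat t) / (D * (of_nat t + of_nat n + 1)) ^ a"
      unfolding quot_def prod(2)[symmetric] prod(1)[symmetric] diff_divide_distrib[symmetric]
      by (simp add: P'_def poly_pcompose add_ac)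
    also have "\<dots> = z * (poly P (of_nat (Suc t)) / E ^ a) - poly P (of_nat t) / D ^ a"
      using nz by (simp add: power_mult_distrib)
    finally show ?thesis by (simp add: quot_def D_def E_def)
  qed
  have cv: "continued_value z (quot a (Suc n) P') = z * continued_value z (\<lambda>t. ?c (Suc t)) + (- 1) * continued_value z ?c"
    unfolding eq[abs_def] using continued_value_Suc(1)[OF continuable_quot z] continuable_quot z
    by (simp only: continued_value_add continued_value_cmult continuable_cmult)
  have "(\<Prod>i<n. of_nat i + 1) = (fact n :: complex)"
    by (induction n) (simp_all add: mult.commute add.commute)
  hence "?c 0 = poly P 0 / fact n ^ a" by (simp add: quot_def)
  thus ?thesis using cv continued_value_Suc(2)[OF continuable_quot z, of a n P] by simp
qed

lemma continued_value_quot_add: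
  assumes "z \<in> cut_plane"
  shows "continued_value z (quot a m (P + Q)) = continued_value z (quot a m P) + continued_value z (quot a m Q)"
proof -
  have "quot a m (P + Q) = (\<lambda>t. quot a m P t + quot a m Q t)"
    by (simp add: quot_def add_divide_distrib fun_eq_iff)
  thus ?thesis using assms by (simp add: continued_value_add continuable_quot)
qed

lemma continued_value_quot_smult:
  assumes "z \<in> cut_plane"
  shows "continued_value z (quot a m (smult k P)) = k * continued_value z (quot a m P)"
proof -
  have "quot a m (smult k P) = (\<lambda>t. k * quot a m P t)"
    by (simp add: quot_def fun_eq_iff)
  thus ?thesis using assms by (simp add: continued_value_cmult continuable_quot)
qed


text \<open>The separate case matters for \<open>s = 0\<close>, where \<open>1 / 0 ^ 0\<close> is
  1.\<close>

definition polylog_coeff :: "nat \<Rightarrow> nat \<Rightarrow> complex" where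
  "polylog_coeff s t = (if t = 0 then 0 else 1 / of_nat t ^ s)"

lemma extends_polylog: "extends (polylog_coeff s) (polylog s)"
  unfolding extends_def
proof (intro conjI allI impI)
  show "polylog s holomorphic_on cut_plane" using is_polylog_polylog by (simp add: is_polylog_def)
  fix w :: complex assume "norm w < 1"
  hence "(\<lambda>k. w ^ Suc k / of_nat (Suc k) ^ s) sums polylog s w"
    using is_polylog_polylog by (simp add: is_polylog_def)
  hence "(\<lambda>k. polylog_coeff s (Suc k) * w ^ Suc k) sums polylog s w" by (simp add: polylog_coeff_def)
  thus "(\<lambda>k. polylog_coeff s k * w ^ k) sums polylog s w"
    by (subst (asm) sums_Suc_iff) (simp add: polylog_coeff_def)
qed

text \<open>\<open>U\<close> stands for the rational space generated by the approximations. The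
  reduction of numerators divides by \<open>z\<close>, when the order of vanishing is raised, and by
  \<open>z - 1\<close>, when the degree is lowered; hence the two inverses.\<close>

locale stable_subspace =
  fixes z :: complex and U :: "complex set"
  assumes z: "z \<in> cut_plane" "z \<noteq> 0"
    and subspace: "ratvec.subspace U"
    and stable: "x \<in> U \<Longrightarrow> z * x \<in> U" "x \<in> U \<Longrightarrow> inverse z * x \<in> U"
      "x \<in> U \<Longrightarrow> inverse (z - 1) * x \<in> U"
begin

text \<open>The multiplier ring of \<open>U\<close>. Numerators with coefficients in it can be
  reduced without leaving \<open>U\<close>.\<close>

definition scalars :: "complex set" where
  "scalars = {k. \<forall>x\<in>U. k * x \<in> U}"

lemma scalarsD: "k \<in> scalars \<Longrightarrow> x \<in> U \<Longrightarrow> k * x \<in> U"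
  by (simp add: scalars_def)

lemma scalars_add: "k \<in> scalars \<Longrightarrow> l \<in> scalars \<Longrightarrow> k + l \<in> scalars"
  using subspace by (auto simp: scalars_def distrib_right intro: ratvec.subspace_add)

lemma scalars_mult: "k \<in> scalars \<Longrightarrow> l \<in> scalars \<Longrightarrow> k * l \<in> scalars"
  by (auto simp: scalars_def mult.assoc)

lemma scalars_of_rat: "of_rat q \<in> scalars"
  using subspace by (auto simp: scalars_def intro: ratvec.subspace_scale)

lemma scalars_of_int: "of_int q \<in> scalars"
  using scalars_of_rat[of "of_int q"] by simp

lemma scalars_of_nat: "of_nat q \<in> scalars"
  using scalars_of_rat[of "of_nat q"] by simp

lemma scalars_0: "0 \<in> scalars" and scalars_1: "1 \<in> scalars"
  using scalars_of_nat[of 0] scalars_of_nat[of 1] by simp_all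

lemma scalars_uminus: "k \<in> scalars \<Longrightarrow> - k \<in> scalars"
  using scalars_mult[OF scalars_of_int[of "-1"], of k] by simp

lemma scalars_diff: "k \<in> scalars \<Longrightarrow> l \<in> scalars \<Longrightarrow> k - l \<in> scalars"
  using scalars_add[OF _ scalars_uminus, of k l] by simp

lemma scalars_sum: "(\<And>i. i \<in> I \<Longrightarrow> f i \<in> scalars) \<Longrightarrow> sum f I \<in> scalars"
  by (induction I rule: infinite_finite_induct) (auto intro: scalars_0 scalars_add)

lemma scalars_power: "k \<in> scalars \<Longrightarrow> k ^ n \<in> scalars"
  by (induction n) (auto intro: scalars_1 scalars_mult)

lemma scalars_z: "z \<in> scalars" "inverse z \<in> scalars" "inverse (z - 1) \<in> scalars"
  using stable by (auto simp: scalars_def)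

definition spoly :: "complex poly \<Rightarrow> bool" where
  "spoly P \<longleftrightarrow> (\<forall>i. coeff P i \<in> scalars)"

lemma spoly_0: "spoly 0"
  by (simp add: spoly_def scalars_0)

lemma spoly_pCons_iff: "spoly (pCons a P) \<longleftrightarrow> a \<in> scalars \<and> spoly P"
  by (auto simp: spoly_def coeff_pCons split: nat.splits)

lemma spoly_diff: "spoly P \<Longrightarrow> spoly Q \<Longrightarrow> spoly (P - Q)"
  by (simp add: spoly_def scalars_diff)

lemma spoly_smult: "k \<in> scalars \<Longrightarrow> spoly P \<Longrightarrow> spoly (smult k P)"
  by (simp add: spoly_def scalars_mult)

lemma spoly_mult: "spoly P \<Longrightarrow> spoly Q \<Longrightarrow> spoly (P * Q)"
  by (auto simp: spoly_def coeff_mult intro!: scalars_sum scalars_mult)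

lemma spoly_1: "spoly 1"
  by (simp add: one_pCons spoly_pCons_iff spoly_0 scalars_1)

lemma spoly_power: "spoly P \<Longrightarrow> spoly (P ^ n)"
  by (induction n) (auto intro: spoly_1 spoly_mult)

lemma spoly_prod: "(\<And>i. i \<in> I \<Longrightarrow> spoly (f i)) \<Longrightarrow> spoly (prod f I)"
  by (induction I rule: infinite_finite_induct) (auto intro: spoly_1 spoly_mult)

lemma spoly_linear: "a \<in> scalars \<Longrightarrow> spoly [:a, 1:]"
  by (simp add: spoly_pCons_iff spoly_0 scalars_1)

lemma scalars_poly: "spoly P \<Longrightarrow> x \<in> scalars \<Longrightarrow> poly P x \<in> scalars"
  by (auto simp: poly_altdef spoly_def intro!: scalars_sum scalars_mult scalars_power)

lemma spoly_synthetic_div: "spoly P \<Longrightarrow> c \<in> scalars \<Longrightarrow> spoly (synthetic_div P c)"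
  by (induction P) (auto simp: spoly_pCons_iff spoly_0 scalars_poly)

lemma poly_split_at: "P = [:poly P c:] + [:- c, 1:] * synthetic_div P (c :: complex)"
  by (metis add.commute synthetic_div_correct')

abbreviation value_in :: "nat \<Rightarrow> nat \<Rightarrow> complex poly \<Rightarrow> bool" where
  "value_in a m P \<equiv> continued_value z (quot a m P) \<in> U"

lemma value_in_add: "value_in a m P \<Longrightarrow> value_in a m Q \<Longrightarrow> value_in a m (P + Q)"
  using subspace z by (simp add: continued_value_quot_add ratvec.subspace_add)

lemma value_in_smult: "k \<in> scalars \<Longrightarrow> value_in a m P \<Longrightarrow> value_in a m (smult k P)"
  using z by (simp add: continued_value_quot_smult scalarsD)

lemma value_in_0: "value_in a m 0"
  using z continued_value_quot_smult[of z a m 0 0] subspace by (simp add: ratvec.subspace_0)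

section \<open>Reduction of numerators modulo telescoping relations\<close>

definition falling :: "nat \<Rightarrow> complex poly" where
  "falling k = (\<Prod>i<k. [:- of_nat i, 1:])"

lemma falling_Suc: "falling (Suc k) = [:- of_nat k, 1:] * falling k"
  by (simp add: falling_def mult.commute)

lemma pcompose_falling_Suc: "pcompose (falling (Suc k)) [:1, 1:] = [:1, 1:] * falling k"
  unfolding falling_def
  by (subst prod.lessThan_Suc_shift) (simp add: pcompose_mult pcompose_prod pcompose_pCons)

text \<open>\<open>falling (Suc k)\<close> and its shift by 1 are both multiples of
  \<open>falling k\<close>, and the former vanishes at 0, so telescoping gives value 0 for a
  multiple of \<open>falling k\<close>. Its cofactor \<open>Br\<close> is nonzero at
  \<open>t = k\<close>, since there the subtracted part vanishes.\<close>

lemma telescope_falling: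
  fixes n a k :: nat
  defines "Br \<equiv> smult z ([:1, 1:] ^ Suc a) - [:of_nat n + 1, 1:] ^ a * [:- of_nat k, 1:]"
  shows "value_in a (Suc n) (falling k * Br)" "spoly Br" "degree Br \<le> Suc a"
    "poly Br (of_nat k) = z * (of_nat k + 1) ^ Suc a"
proof -
  have "smult z ([:1, 1:] ^ a * pcompose (falling (Suc k)) [:1, 1:]) - [:of_nat n + 1, 1:] ^ a * falling (Suc k)
      = falling k * Br"
    unfolding pcompose_falling_Suc
    unfolding falling_Suc Br_def power_Suc
    by (simp add: algebra_simps del: mult_pCons_left mult_pCons_right)
  moreover have "poly (falling (Suc k)) 0 = 0"
    by (auto simp: falling_def poly_prod prod_zero_iff)
  ultimately show "value_in a (Suc n) (falling k * Br)"
    using continued_value_telescope[OF z(1), of a n "falling (Suc k)"] subspace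
    by (simp add: ratvec.subspace_0)
  show "spoly Br"
    unfolding Br_def
    by (intro spoly_diff spoly_smult spoly_mult spoly_power spoly_linear scalars_z scalars_1
        scalars_uminus scalars_add scalars_of_nat)
  have deg: "degree ([:c, 1:] ^ e) \<le> e" for c :: complex and e
    using degree_power_le[of "[:c, 1:]" e] by simp
  have "degree ([:of_nat n + 1, 1:] ^ a * [:- of_nat k, 1 :: complex:]) \<le> a + 1"
    using order_trans[OF degree_mult_le add_mono[OF deg[of "of_nat n + 1" a] deg[of "- of_nat k" 1]]] by simp
  moreover have "degree (smult z ([:1, 1:] ^ Suc a)) \<le> Suc a"
    using deg[of 1 "Suc a"] degree_smult_le order_trans by blast
  ultimately show "degree Br \<le> Suc a" unfolding Br_def by (intro degree_diff_le) auto
  show "poly Br (of_nat k) = z * (of_nat k + 1) ^ Suc a"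
    by (simp add: Br_def algebra_simps)
qed

text \<open>Every polynomial over the scalar ring is reduced modulo the telescoping relation, first to
  degree at most \<open>L + M\<close> and then to a multiple of \<open>falling L\<close>.\<close>

lemma value_in_all:
  assumes M: "a \<le> M" and Q: "\<And>m. m \<le> M \<Longrightarrow> degree (Q m) = m" "\<And>m. m \<le> M \<Longrightarrow> lead_coeff (Q m) = 1"
      "\<And>m. m \<le> M \<Longrightarrow> spoly (Q m)"
    and base: "\<And>m. m \<le> M \<Longrightarrow> value_in a (Suc n) (falling L * Q m)"
    and P: "spoly P"
  shows "value_in a (Suc n) P"
proof -
  let ?V = "value_in a (Suc n)"
  \<comment> \<open>The \<open>Q m\<close> are monic, one for each degree up to \<open>M\<close>, so
    they are a triangular system for all cofactors of degree at most \<open>M\<close>.\<close>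
  have step1: "?V (falling L * P)" if "spoly P" "\<And>i. i \<ge> d \<Longrightarrow> coeff P i = 0" "d \<le> Suc M" for d P
    using that
  proof (induction d arbitrary: P)
    case 0
    hence "P = 0" by (intro poly_eqI) auto
    thus ?case by (simp add: value_in_0)
  next
    case (Suc d)
    hence d: "d \<le> M" by simp
    define c where "c = coeff P d"
    have c: "c \<in> scalars" using Suc.prems(1) by (simp add: spoly_def c_def)
    have "?V (falling L * (P - smult c (Q d)))"
    proof (rule Suc.IH)
      show "spoly (P - smult c (Q d))" using Suc.prems(1) Q(3)[OF d] c by (intro spoly_diff spoly_smult)
      fix i assume "d \<le> i"
      show "coeff (P - smult c (Q d)) i = 0"
      proof (cases "i = d")
        case True
        thus ?thesis using Q(1,2)[OF d] by (simp add: c_def)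
      next
        case False
        hence "coeff (Q d) i = 0" using \<open>d \<le> i\<close> Q(1)[OF d] by (intro coeff_eq_0) simp
        thus ?thesis using False \<open>d \<le> i\<close> Suc.prems(2) by simp
      qed
    qed (use d in simp)
    moreover have "?V (smult c (falling L * Q d))" by (intro value_in_smult c base d)
    ultimately have "?V (falling L * (P - smult c (Q d)) + smult c (falling L * Q d))" by (rule value_in_add)
    thus ?case by (simp add: algebra_simps)
  qed
  \<comment> \<open>Descent from \<open>k = L\<close> to 0. Division by \<open>t - k\<close> leaves
    a multiple of \<open>falling (Suc k)\<close> and a constant times \<open>falling k\<close>; the
    relation \<open>Br\<close> settles the value of \<open>falling k\<close> itself.\<close>
  have step2: "?V (falling k * P)" if "spoly P" "degree P + k \<le> L + M" "k \<le> L" for k P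
    using that(3,1,2)
  proof (induction k arbitrary: P rule: inc_induct)
    case base
    show ?case by (rule step1[OF base(1), of "Suc (degree P)"]) (use base in \<open>auto intro: coeff_eq_0\<close>)
  next
    case (step k)
    define Br where "Br = smult z ([:1, 1:] ^ Suc a) - [:of_nat n + 1, 1:] ^ a * [:- of_nat k, 1:]"
    note Br = telescope_falling[where n = n and a = a and k = k, folded Br_def]
    have rest: "?V (falling (Suc k) * synthetic_div R (of_nat k))" if "spoly R" "degree R + k \<le> L + M" for R
      using that step.hyps by (intro step.IH spoly_synthetic_div scalars_of_nat) (auto simp: degree_synthetic_div)
    have split: "falling k * R = smult (poly R (of_nat k)) (falling k) + falling (Suc k) * synthetic_div R (of_nat k)" for R
    proof -
      have "falling k * R = falling k * ([:poly R (of_nat k):] + [:- of_nat k, 1:] * synthetic_div R (of_nat k))"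
        using poly_split_at[of R "of_nat k"] by (rule arg_cong)
      thus ?thesis by (simp add: falling_Suc distrib_left mult_ac del: mult_pCons_left mult_pCons_right)
          (simp add: mult_ac)
    qed
    \<comment> \<open>The degree condition holds for \<open>Br\<close> because
      \<open>Suc a + k \<le> L + M\<close>, by \<open>k < L\<close> and
      \<open>a \<le> M\<close>.\<close>
    have "?V (smult (- 1) (falling (Suc k) * synthetic_div Br (of_nat k)))"
      using M step.hyps Br(2,3) scalars_of_int[of "-1"] by (intro value_in_smult rest) auto
    hence "?V (falling k * Br + smult (- 1) (falling (Suc k) * synthetic_div Br (of_nat k)))"
      by (intro value_in_add Br(1))
    hence "?V (smult (poly Br (of_nat k)) (falling k))"
      unfolding split[of Br] by simp
    moreover have "inverse (poly Br (of_nat k)) \<in> scalars"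
    proof -
      have "inverse (poly Br (of_nat k)) = inverse z * of_rat (1 / (of_nat k + 1) ^ Suc a)"
        unfolding Br(4) by (simp add: of_rat_divide of_rat_power of_rat_add of_rat_mult inverse_eq_divide)
      thus ?thesis by (simp only: scalars_mult scalars_z scalars_of_rat)
    qed
    ultimately have "?V (smult (inverse (poly Br (of_nat k))) (smult (poly Br (of_nat k)) (falling k)))"
      by (rule value_in_smult[rotated])
    moreover have "poly Br (of_nat k) \<noteq> 0"
      using z(2) of_nat_add_1_neq_0[of k 0] unfolding Br(4) by simp
    ultimately have "?V (falling k)" by simp
    thus ?case
      unfolding split[of P] using step.prems rest[of P]
      by (intro value_in_add value_in_smult scalars_poly scalars_of_nat) auto
  qed
  have "?V P" if "spoly P" "degree P \<le> d" for d P
    using that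
  proof (induction d arbitrary: P)
    case 0
    thus ?case using step2[of P 0] by (simp add: falling_def)
  next
    case (Suc d)
    show ?case
    proof (cases "Suc d \<le> L + M")
      case True
      thus ?thesis using step2[of P 0] Suc.prems by (simp add: falling_def)
    next
      case False
      \<comment> \<open>Telescoping with the numerator \<open>t^e\<close>, which vanishes at 0,
        gives a polynomial of degree \<open>Suc d\<close> with leading coefficient
        \<open>z - 1\<close> and continued value 0.\<close>
      define e where "e = Suc d - a"
      have e: "e > 0" "a + e = Suc d" using False M by (auto simp: e_def)
      define R where "R = smult z ([:1, 1:] ^ a * [:1, 1:] ^ e) - [:of_nat n + 1, 1:] ^ a * [:0, 1:] ^ e"
      have pc: "pcompose ([:0, 1:] ^ i) [:1, 1:] = [:1, 1 :: complex:] ^ i" for i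
        by (induction i) (simp_all add: pcompose_mult pcompose_pCons pcompose_1)
      have VR: "?V R"
        using continued_value_telescope[OF z(1), of a n "[:0, 1:] ^ e"] subspace e(1)
        by (simp add: R_def pc poly_power power_0_left ratvec.subspace_0)
      have sR: "spoly R"
        unfolding R_def by (intro spoly_diff spoly_smult spoly_mult spoly_power spoly_linear scalars_z scalars_0 scalars_1
            scalars_add scalars_of_nat)
      have lin: "degree ([:c, 1:] ^ a * [:c', 1:] ^ e) = Suc d" "coeff ([:c, 1:] ^ a * [:c', 1:] ^ e) (Suc d) = 1"
        for c c' :: complex
      proof -
        show deg: "degree ([:c, 1:] ^ a * [:c', 1:] ^ e) = Suc d"
          using e(2) by (subst degree_mult_eq) (auto simp: degree_linear_power)
        have "lead_coeff ([:c, 1:] ^ a * [:c', 1:] ^ e) = 1"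
          by (simp add: lead_coeff_mult lead_coeff_power)
        thus "coeff ([:c, 1:] ^ a * [:c', 1:] ^ e) (Suc d) = 1" unfolding deg .
      qed
      have cR: "coeff R (Suc d) = z - 1" unfolding R_def by (simp add: lin)
      have dR: "degree R \<le> Suc d"
        unfolding R_def by (intro degree_diff_le order_trans[OF degree_smult_le]) (simp_all add: lin)
      have "z \<noteq> 1" using z(1) by (auto simp: cut_plane_def image_iff dest: spec[of _ "1::real"])
      define c where "c = inverse (z - 1) * coeff P (Suc d)"
      have c: "c \<in> scalars" using Suc.prems(1) unfolding c_def by (intro scalars_mult scalars_z) (simp add: spoly_def)
      have "?V (P - smult c R)"
      proof (rule Suc.IH)
        show "spoly (P - smult c R)" by (intro spoly_diff spoly_smult Suc.prems c sR)
        have "coeff (P - smult c R) (Suc d) = 0" using \<open>z \<noteq> 1\<close> by (simp add: cR c_def)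
        moreover have "degree (P - smult c R) \<le> Suc d"
          using Suc.prems(2) dR by (intro degree_diff_le order_trans[OF degree_smult_le])
        ultimately show "degree (P - smult c R) \<le> d"
          by (metis degree_0 le_SucE leading_coeff_0_iff zero_le)
      qed
      hence "?V (P - smult c R + smult c R)" by (intro value_in_add value_in_smult c VR)
      thus ?thesis by simp
    qed
  qed
  thus ?thesis using P by blast
qed

text \<open>Telescoping with the numerator 1 has the nonzero rational value
  \<open>- 1 / n! ^ a\<close>.\<close>

lemma one_in_if_value_in_all:
  assumes "\<And>P. spoly P \<Longrightarrow> value_in a (Suc n) P"
  shows "1 \<in> U"
proof -
  define R where "R = smult z ([:1, 1:] ^ a) - [:of_nat n + 1, 1:] ^ a"
  have "spoly R"
    unfolding R_def by (intro spoly_diff spoly_smult spoly_power spoly_linear scalars_z scalars_1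
        scalars_add scalars_of_nat)
  hence "value_in a (Suc n) R" by (rule assms)
  hence "- (1 / fact n ^ a) \<in> U"
    using continued_value_telescope[OF z(1), of a n 1] by (simp add: R_def pcompose_1)
  hence "of_int (- (fact n ^ a)) * (- (1 / fact n ^ a)) \<in> U"
    by (rule scalarsD[OF scalars_of_int])
  thus ?thesis by simp
qed

text \<open>The numerator cancels every pole except \<open>t = -1\<close> and lowers that one to
  order \<open>s\<close>. What remains is the polylogarithm series with its index shifted by
  1.\<close>

lemma polylog_in_if_value_in_all:
  assumes "\<And>P. spoly P \<Longrightarrow> value_in a (Suc n) P" and s: "s \<le> a"
  shows "polylog s z \<in> U"
proof -
  define P :: "complex poly" where "P = [:1, 1:] ^ (a - s) * (\<Prod>i<n. [:of_nat (Suc i) + 1, 1:]) ^ a"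
  have "spoly P"
    unfolding P_def by (intro spoly_mult spoly_power spoly_prod spoly_linear scalars_1 scalars_add scalars_of_nat)
  hence "value_in a (Suc n) P" by (rule assms)
  also have "quot a (Suc n) P = (\<lambda>t. 1 / (of_nat t + 1) ^ s)"
  proof
    fix t
    define E where "E = (\<Prod>i<n. of_nat t + of_nat (Suc i) + (1::complex))"
    have E: "E \<noteq> 0" unfolding E_def by (simp del: of_nat_Suc)
    have nz: "(of_nat t + 1 :: complex) \<noteq> 0" using of_nat_add_1_neq_0[of t 0] by simp
    have "(\<Prod>i<Suc n. of_nat t + of_nat i + (1::complex)) = (of_nat t + 1) * E"
      unfolding E_def by (subst prod.lessThan_Suc_shift) simp
    moreover have "poly P (of_nat t) = (of_nat t + 1) ^ (a - s) * E ^ a"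
      by (simp add: P_def E_def poly_prod poly_power add_ac)
    moreover have "(of_nat t + 1) ^ a = (of_nat t + 1 :: complex) ^ (a - s) * (of_nat t + 1) ^ s"
      using s by (simp flip: power_add)
    ultimately show "quot a (Suc n) P t = 1 / (of_nat t + 1) ^ s"
      using E nz by (simp add: quot_def power_mult_distrib)
  qed
  finally have *: "continued_value z (\<lambda>t. 1 / (of_nat t + 1) ^ s) \<in> U" .
  note c = extends_polylog[of s]
  have "z * continued_value z (\<lambda>t. polylog_coeff s (Suc t)) = polylog s z"
    using continued_value_Suc(2)[OF continuableI[OF c] z(1)] continued_value_eqI[OF c z(1)]
    by (simp add: polylog_coeff_def)
  moreover have "(\<lambda>t. polylog_coeff s (Suc t)) = (\<lambda>t. 1 / (of_nat t + 1) ^ s)"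
    by (simp add: polylog_coeff_def fun_eq_iff add.commute)
  ultimately show ?thesis using stable(1)[OF *] by simp
qed

end

section \<open>Partial fractions\<close>

text \<open>\<open>frac_rep d n b H R\<close>: the rational function \<open>R\<close> is a sum of terms \<open>q / (t + j + 1) ^ s\<close> with
  \<open>1 \<le> s \<le> b\<close>, \<open>j \<le> n\<close>, in which \<open>q\<close> has a denominator dividing \<open>d ^ (b - s)\<close>; the sum of
  the absolute values of the coefficients \<open>q\<close> is at most \<open>H\<close>.\<close>

inductive frac_rep :: "nat \<Rightarrow> nat \<Rightarrow> nat \<Rightarrow> real \<Rightarrow> (nat \<Rightarrow> complex) \<Rightarrow> bool" for d n b where
  zero: "frac_rep d n b 0 (\<lambda>t. 0)"
| single: "1 \<le> s \<Longrightarrow> s \<le> b \<Longrightarrow> j \<le> n \<Longrightarrow> q * of_nat d ^ (b - s) \<in> \<int> \<Longrightarrow>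
    frac_rep d n b \<bar>real_of_rat q\<bar> (\<lambda>t. of_rat q / (of_nat t + of_nat j + 1) ^ s)"
| add: "frac_rep d n b H R \<Longrightarrow> frac_rep d n b H' R' \<Longrightarrow> frac_rep d n b (H + H') (\<lambda>t. R t + R' t)"
| mono: "frac_rep d n b H R \<Longrightarrow> H \<le> H' \<Longrightarrow> frac_rep d n b H' R"

lemma frac_rep_scale:
  assumes "frac_rep d n b H R"
  shows "frac_rep d n b (\<bar>of_int k\<bar> * H) (\<lambda>t. of_int k * R t)"
  using assms
proof induction
  case zero
  show ?case using frac_rep.zero by simp
next
  case (single s j q)
  have "of_int k * (q * of_nat d ^ (b - s)) \<in> \<int>" by (rule Ints_mult[OF Ints_of_int single(4)])
  hence "frac_rep d n b \<bar>real_of_rat (of_int k * q)\<bar> (\<lambda>t. of_rat (of_int k * q) / (of_nat t + of_nat j + 1) ^ s)"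
    using single by (intro frac_rep.single) (auto simp: mult.assoc)
  thus ?case by (simp add: of_rat_mult abs_mult)
next
  case (add H R H' R')
  from frac_rep.add[OF add.IH] show ?case by (simp add: distrib_left)
next
  case (mono H R H')
  from frac_rep.mono[OF mono.IH] show ?case using mono.hyps(2) by (simp add: mult_left_mono)
qed

lemma frac_rep_sum:
  assumes "\<And>i. i \<in> I \<Longrightarrow> frac_rep d n b (h i) (R i)"
  shows "frac_rep d n b (\<Sum>i\<in>I. h i) (\<lambda>t. \<Sum>i\<in>I. R i t)"
  using assms by (induction I rule: infinite_finite_induct) (simp_all add: frac_rep.zero frac_rep.add)

text \<open>One step of partial fractions: with \<open>u = t + j + 1\<close>, \<open>v = t + k + 1\<close> and \<open>j \<noteq> k\<close> one has
  \<open>1 / (u ^ Suc s * v) = (1 / u ^ Suc s - 1 / (u ^ s * v)) / (k - j)\<close>.\<close>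

lemma frac_rep_single_divide:
  assumes d: "\<And>i. 1 \<le> i \<Longrightarrow> i \<le> n \<Longrightarrow> i dvd d"
    and "s \<le> b" "j \<le> n" "k \<le> n" "q * of_nat d ^ (b - s) \<in> \<int>"
  shows "frac_rep d n (Suc b) (real (Suc s) * \<bar>real_of_rat q\<bar>)
           (\<lambda>t. of_rat q / ((of_nat t + of_nat j + 1) ^ s * (of_nat t + of_nat k + 1)))"
proof (cases "j = k")
  case True
  have "frac_rep d n (Suc b) \<bar>real_of_rat q\<bar> (\<lambda>t. of_rat q / (of_nat t + of_nat j + 1) ^ Suc s)"
    using assms by (intro frac_rep.single) auto
  moreover have "\<bar>real_of_rat q\<bar> \<le> real (Suc s) * \<bar>real_of_rat q\<bar>"
    using mult_right_mono[of 1 "real (Suc s)" "\<bar>real_of_rat q\<bar>"] by simp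
  ultimately have "frac_rep d n (Suc b) (real (Suc s) * \<bar>real_of_rat q\<bar>)
      (\<lambda>t. of_rat q / (of_nat t + of_nat j + 1) ^ Suc s)" by (rule frac_rep.mono)
  thus ?thesis using True by (simp only: power_Suc mult.commute)
next
  case False
  \<comment> \<open>Dividing by \<open>e\<close>, of absolute value between 1 and \<open>n\<close>,
    costs one factor \<open>d\<close>. The order of the pole drops by one in the same step, so the
    exponent \<open>b - s\<close> leaves room for it.\<close>
  define e :: int where "e = int k - int j"
  have e: "e \<noteq> 0" "nat \<bar>e\<bar> \<le> n" using False assms by (auto simp: e_def)
  have "nat \<bar>e\<bar> dvd d" using e by (intro d) auto
  hence "e dvd int d" by (simp add: nat_dvd_iff flip: int_dvd_int_iff)
  then obtain m where m: "int d = e * m" by blast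
  have m': "of_nat d = (of_int e * of_int m :: rat)" using arg_cong[OF m, of "of_int :: int \<Rightarrow> rat"] by simp
  show ?thesis
    using assms(2,5)
  proof (induction s arbitrary: q)
    case 0
    thus ?case using frac_rep.single[of 1 "Suc b" k n q d] assms(4) by simp
  next
    case (Suc s)
    define r where "r = q / of_int e"
    have rd: "r * of_nat d ^ (b - s) \<in> \<int>"
    proof -
      have "b - s = Suc (b - Suc s)" using Suc.prems(1) by simp
      hence "r * of_nat d ^ (b - s) = of_int m * (q * of_nat d ^ (b - Suc s))"
        using e(1) by (simp add: r_def m' field_simps)
      thus ?thesis using Suc.prems(2) by simp
    qed
    have r_le: "\<bar>real_of_rat r\<bar> \<le> \<bar>real_of_rat q\<bar>"
    proof -
      have "1 \<le> \<bar>real_of_int e\<bar>" using e(1) by linarith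
      hence "\<bar>real_of_rat q\<bar> / \<bar>real_of_int e\<bar> \<le> \<bar>real_of_rat q\<bar> / 1" by (intro divide_left_mono) auto
      thus ?thesis by (simp add: r_def of_rat_divide)
    qed
    have 1: "frac_rep d n (Suc b) \<bar>real_of_rat r\<bar> (\<lambda>t. of_rat r / (of_nat t + of_nat j + 1) ^ Suc s)"
      using Suc.prems(1) rd assms(3) by (intro frac_rep.single) auto
    have 2: "frac_rep d n (Suc b) (real (Suc s) * \<bar>real_of_rat (- r)\<bar>)
        (\<lambda>t. of_rat (- r) / ((of_nat t + of_nat j + 1) ^ s * (of_nat t + of_nat k + 1)))"
      using Suc.prems(1) rd by (intro Suc.IH) auto
    have "frac_rep d n (Suc b) (\<bar>real_of_rat r\<bar> + real (Suc s) * \<bar>real_of_rat (- r)\<bar>)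
        (\<lambda>t. of_rat r / (of_nat t + of_nat j + 1) ^ Suc s
           + of_rat (- r) / ((of_nat t + of_nat j + 1) ^ s * (of_nat t + of_nat k + 1)))"
      by (rule frac_rep.add[OF 1 2])
    also have "(\<lambda>t. of_rat r / (of_nat t + of_nat j + 1) ^ Suc s
           + of_rat (- r) / ((of_nat t + of_nat j + 1) ^ s * (of_nat t + of_nat k + 1)))
        = (\<lambda>t. of_rat q / ((of_nat t + of_nat j + 1) ^ Suc s * (of_nat t + of_nat k + 1 :: complex)))"
    proof
      fix t
      define u v where "u = of_nat t + of_nat j + (1 :: complex)" and "v = of_nat t + of_nat k + (1 :: complex)"
      have nz: "u \<noteq> 0" "v \<noteq> 0" by (simp_all add: u_def v_def)
      have "of_rat q = of_rat r * (of_int e :: complex)" using e(1) by (simp add: r_def of_rat_divide)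
      also have "of_int e = v - u" by (simp add: e_def u_def v_def)
      finally have "of_rat q = of_rat r * (v - u)" .
      hence "of_rat q / (u ^ Suc s * v) = of_rat r / u ^ Suc s + of_rat (- r) / (u ^ s * v)"
        using nz by (simp add: field_simps of_rat_minus)
      thus "of_rat r / (of_nat t + of_nat j + 1) ^ Suc s
           + of_rat (- r) / ((of_nat t + of_nat j + 1) ^ s * (of_nat t + of_nat k + 1))
        = of_rat q / ((of_nat t + of_nat j + 1) ^ Suc s * (of_nat t + of_nat k + 1 :: complex))"
        by (simp add: u_def v_def)
    qed
    finally show ?case
    proof (rule frac_rep.mono)
      have "real (Suc s) * \<bar>real_of_rat (- r)\<bar> \<le> real (Suc s) * \<bar>real_of_rat q\<bar>"
        using r_le by (intro mult_left_mono) (auto simp: of_rat_minus)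
      thus "\<bar>real_of_rat r\<bar> + real (Suc s) * \<bar>real_of_rat (- r)\<bar> \<le> real (Suc (Suc s)) * \<bar>real_of_rat q\<bar>"
        using r_le by (simp add: distrib_right)
    qed
  qed
qed

text \<open>A pole of order \<open>s\<close> is split at most \<open>s\<close> times, into at most
  \<open>s + 1\<close> pure terms whose coefficients do not exceed \<open>q\<close> in absolute
  value; \<open>s \<le> b\<close> makes the factor uniform.\<close>

lemma frac_rep_divide:
  assumes d: "\<And>i. 1 \<le> i \<Longrightarrow> i \<le> n \<Longrightarrow> i dvd d" and k: "k \<le> n" and "frac_rep d n b H R"
  shows "frac_rep d n (Suc b) (real (Suc b) * H) (\<lambda>t. R t / (of_nat t + of_nat k + 1))"
  using assms(3)
proof induction
  case zero
  show ?case using frac_rep.zero by simp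
next
  case (single s j q)
  have "frac_rep d n (Suc b) (real (Suc s) * \<bar>real_of_rat q\<bar>)
           (\<lambda>t. of_rat q / ((of_nat t + of_nat j + 1) ^ s * (of_nat t + of_nat k + 1)))"
    using d k single by (intro frac_rep_single_divide) auto
  moreover have "real (Suc s) * \<bar>real_of_rat q\<bar> \<le> real (Suc b) * \<bar>real_of_rat q\<bar>"
    using single by (intro mult_right_mono) auto
  ultimately show ?case using frac_rep.mono by (simp add: divide_divide_eq_left)
next
  case (add H R H' R')
  from frac_rep.add[OF add.IH] show ?case by (simp add: distrib_left add_divide_distrib)
next
  case (mono H R H')
  from frac_rep.mono[OF mono.IH] show ?case using mono.hyps(2) by (simp add: mult_left_mono)
qed

text \<open>The common building block of both estimates: its integer residues feed the partial
  fractions, and it is the moment sequence of the polynomial with coefficients \<open>c j\<close> on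
  the unit interval.\<close>

definition simple_frac :: "nat \<Rightarrow> (nat \<Rightarrow> int) \<Rightarrow> nat \<Rightarrow> complex" where
  "simple_frac n c t = (\<Sum>j\<le>n. of_int (c j) / (of_nat t + of_nat j + 1))"

lemma frac_rep_simple_frac: "frac_rep d n 1 (\<Sum>j\<le>n. \<bar>of_int (c j)\<bar>) (simple_frac n c)"
proof -
  have "frac_rep d n 1 \<bar>real_of_rat (of_int (c j))\<bar> (\<lambda>t. of_rat (of_int (c j)) / (of_nat t + of_nat j + 1) ^ 1)"
    if "j \<in> {..n}" for j using that by (intro frac_rep.single) auto
  from frac_rep_sum[OF this, of "{..n}" "\<lambda>j. j"] show ?thesis
    unfolding simple_frac_def[abs_def] by simp
qed

lemma frac_rep_mult_simple_frac:
  assumes d: "\<And>i. 1 \<le> i \<Longrightarrow> i \<le> n \<Longrightarrow> i dvd d" and R: "frac_rep d n b H R"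
  shows "frac_rep d n (Suc b) (real (Suc b) * H * (\<Sum>j\<le>n. \<bar>of_int (c j)\<bar>)) (\<lambda>t. R t * simple_frac n c t)"
proof -
  have "frac_rep d n (Suc b) (\<bar>of_int (c j)\<bar> * (real (Suc b) * H)) (\<lambda>t. of_int (c j) * (R t / (of_nat t + of_nat j + 1)))"
    if "j \<in> {..n}" for j using that d R by (intro frac_rep_scale frac_rep_divide) auto
  from frac_rep_sum[OF this, of "{..n}" "\<lambda>j. j"] show ?thesis
    unfolding simple_frac_def[abs_def] by (simp add: sum_distrib_left mult_ac)
qed

text \<open>The factors are multiplied in one at a time. The factorial depends only on their number,
  so it stays constant as \<open>n\<close> grows.\<close>

lemma frac_rep_prod_simple_frac:
  assumes d: "\<And>i. 1 \<le> i \<Longrightarrow> i \<le> n \<Longrightarrow> i dvd d"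
  shows "frac_rep d n (Suc k) (fact (Suc k) * (\<Prod>i<Suc k. \<Sum>j\<le>n. \<bar>of_int (c i j)\<bar>))
           (\<lambda>t. \<Prod>i<Suc k. simple_frac n (c i) t)"
proof (induction k)
  case 0
  show ?case using frac_rep_simple_frac[of d n "c 0"] by simp
next
  case (Suc k)
  from frac_rep_mult_simple_frac[OF d Suc, of "c (Suc k)"] show ?case by (simp add: mult_ac)
qed

section \<open>Heights of the continued values of partial fractions\<close>

lemma continued_value_shifted_polylog:
  assumes z: "z \<in> cut_plane" "z \<noteq> 0"
  shows "continuable (\<lambda>t. 1 / (of_nat t + of_nat j + 1) ^ s) \<and>
    z ^ Suc j * continued_value z (\<lambda>t. 1 / (of_nat t + of_nat j + 1) ^ s)
      = polylog s z - (\<Sum>k=1..j. z ^ k / of_nat k ^ s)"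
proof (induction j)
  case 0
  have eq: "(\<lambda>t. polylog_coeff s (Suc t)) = (\<lambda>t. 1 / (of_nat t + of_nat 0 + 1) ^ s)"
    by (simp add: polylog_coeff_def fun_eq_iff add.commute)
  have c: "continuable (polylog_coeff s)" using extends_polylog by (rule continuableI)
  show ?case
    using continued_value_Suc[OF c z(1)] continued_value_eqI[OF extends_polylog z(1), of s]
    unfolding eq by (simp add: polylog_coeff_def)
next
  case (Suc j)
  let ?c = "\<lambda>t. 1 / (of_nat t + of_nat j + 1) ^ s :: complex"
  have eq: "(\<lambda>t. ?c (Suc t)) = (\<lambda>t. 1 / (of_nat t + of_nat (Suc j) + 1) ^ s)"
    by (simp add: fun_eq_iff add_ac)
  have c: "continuable ?c" using Suc by blast
  have "z ^ Suc (Suc j) * continued_value z (\<lambda>t. ?c (Suc t)) = z ^ Suc j * (z * continued_value z (\<lambda>t. ?c (Suc t)))"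
    by (simp add: mult_ac)
  also have "\<dots> = z ^ Suc j * continued_value z ?c - z ^ Suc j * ?c 0"
    unfolding continued_value_Suc(2)[OF c z(1)] by (simp add: right_diff_distrib)
  also have "\<dots> = polylog s z - (\<Sum>k=1..Suc j. z ^ k / of_nat k ^ s)"
    using Suc by (simp add: add.commute)
  finally show ?case using continued_value_Suc(1)[OF c z(1)] unfolding eq by blast
qed

text \<open>For a pole at \<open>-(j + 1)\<close>, splitting \<open>z^(n+1)\<close> as
  \<open>z^(n-j) * z^(j+1)\<close> undoes the shift of the polylogarithm. There remain
  \<open>z^(n-j) * polylog s z\<close> and monomials \<open>z^(n-j+k)\<close> with
  \<open>k \<le> j\<close>, so all exponents are at most \<open>n\<close>.\<close>

lemma int_height_frac_rep:
  assumes z: "z \<in> cut_plane" "z \<noteq> 0" and d: "\<And>i. 1 \<le> i \<Longrightarrow> i \<le> n \<Longrightarrow> i dvd d"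
    and poly: "\<And>s i. 1 \<le> s \<Longrightarrow> s \<le> b \<Longrightarrow> i \<le> n \<Longrightarrow> int_height B K (Y * z ^ i * polylog s z)"
    and rat: "\<And>i. i \<le> n \<Longrightarrow> int_height B K (Y * z ^ i)"
    and R: "frac_rep d n b H R"
  shows "continuable R \<and>
    int_height B (H * (real d ^ b * K * real (Suc n))) (of_nat d ^ b * Y * z ^ Suc n * continued_value z R)"
  using R
proof induction
  case zero
  have "continuable (\<lambda>t. 0)" using continuable_poly[of 0] by simp
  moreover have "continued_value z (\<lambda>t. 0) = 0"
    using continued_value_cmult[OF continuable_poly[of 0] z(1), of 0] by simp
  ultimately show ?case by (simp add: int_height_0)
next
  case (single s j q)
  let ?c = "\<lambda>t. 1 / (of_nat t + of_nat j + 1) ^ s :: complex"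
  note c = continued_value_shifted_polylog[OF z, of j s]
  have K: "0 \<le> K" using rat[of 0] int_height_nonneg by blast
  define Q :: real where "Q = real d ^ b * \<bar>real_of_rat q\<bar>"
  have eq: "(\<lambda>t. of_rat q / (of_nat t + of_nat j + 1) ^ s) = (\<lambda>t. of_rat q * ?c t)" by simp
  \<comment> \<open>The denominator of \<open>q\<close> divides \<open>d^(b-s)\<close> and
    \<open>k^s\<close> divides \<open>d^s\<close>, so \<open>d^b\<close> clears both.\<close>
  have coef: "\<exists>m::int. of_nat d ^ b * of_rat q / of_nat k ^ s = (of_int m :: complex) \<and> \<bar>real_of_int m\<bar> \<le> Q"
    if k: "1 \<le> k" "k dvd d" for k
  proof -
    obtain l where l: "d = k * l" using k by blast
    obtain m0 where m0: "q * of_nat d ^ (b - s) = of_int m0" using single(4) Ints_cases by blast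
    have "d ^ b = d ^ (b - s) * d ^ s" using single by (simp flip: power_add)
    hence db: "(of_nat d ^ b :: rat) = of_nat d ^ (b - s) * of_nat d ^ s" by (metis of_nat_mult of_nat_power)
    have m: "of_nat d ^ b * q / of_nat k ^ s = of_int (m0 * int l ^ s)"
    proof -
      have "of_nat d ^ b * q / of_nat k ^ s = (q * of_nat d ^ (b - s)) * (of_nat d ^ s / of_nat k ^ s)"
        by (simp add: db)
      also have "(of_nat d ^ s / of_nat k ^ s :: rat) = of_nat l ^ s"
        using k by (simp add: l power_mult_distrib)
      finally show ?thesis by (simp add: m0)
    qed
    have "(of_rat (of_nat d ^ b * q / of_nat k ^ s) :: complex) = of_int (m0 * int l ^ s)"
      unfolding m by (rule of_rat_of_int_eq)
    moreover have "\<bar>real_of_int (m0 * int l ^ s)\<bar> \<le> Q"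
    proof -
      have "real_of_int (m0 * int l ^ s) = real d ^ b * real_of_rat q / real k ^ s"
        using arg_cong[OF m, of real_of_rat] by (simp add: of_rat_divide of_rat_mult of_rat_power)
      moreover have "real d ^ b * \<bar>real_of_rat q\<bar> / real k ^ s \<le> real d ^ b * \<bar>real_of_rat q\<bar> / 1"
        using k by (intro divide_left_mono one_le_power) auto
      ultimately show ?thesis by (simp add: Q_def abs_mult)
    qed
    ultimately show ?thesis by (intro exI[of _ "m0 * int l ^ s"]) (simp add: of_rat_divide of_rat_mult of_rat_power)
  qed
  obtain m0 where m0: "of_nat d ^ b * of_rat q = (of_int m0 :: complex)" "\<bar>real_of_int m0\<bar> \<le> Q"
    using coef[of 1] by auto
  have "\<forall>k\<in>{1..j}. \<exists>m::int. of_nat d ^ b * of_rat q / of_nat k ^ s = (of_int m :: complex) \<and> \<bar>real_of_int m\<bar> \<le> Q"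
    using coef d single(3) by auto
  then obtain m :: "nat \<Rightarrow> int" where m: "\<And>k. k \<in> {1..j} \<Longrightarrow> of_nat d ^ b * of_rat q / of_nat k ^ s = (of_int (m k) :: complex)"
    "\<And>k. k \<in> {1..j} \<Longrightarrow> \<bar>real_of_int (m k)\<bar> \<le> Q" by metis
  have h0: "int_height B (Q * K) (of_int m0 * (Y * z ^ (n - j) * polylog s z))"
    using single m0(2) K by (intro int_height_mono[OF int_height_scale[OF poly]] mult_right_mono) auto
  have h1: "int_height B (Q * K) (of_int (- m k) * (Y * z ^ (n - j + k)))" if "k \<in> {1..j}" for k
    using that single m(2)[OF that] K by (intro int_height_mono[OF int_height_scale[OF rat]] mult_right_mono) auto
  have "int_height B (Q * K + (\<Sum>k\<in>{1..j}. Q * K))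
     (of_int m0 * (Y * z ^ (n - j) * polylog s z) + (\<Sum>k\<in>{1..j}. of_int (- m k) * (Y * z ^ (n - j + k))))"
    by (intro int_height_add h0 int_height_sum h1)
  also have "(\<Sum>k\<in>{1..j}. of_int (- m k) * (Y * z ^ (n - j + k)))
      = - (of_nat d ^ b * of_rat q * Y * z ^ (n - j) * (\<Sum>k\<in>{1..j}. z ^ k / of_nat k ^ s))"
    unfolding sum_distrib_left sum_negf[symmetric]
    by (intro sum.cong refl) (simp add: m(1)[symmetric] power_add mult_ac)
  also have "of_int m0 * (Y * z ^ (n - j) * polylog s z) + \<dots>
      = of_nat d ^ b * of_rat q * Y * z ^ (n - j) * (polylog s z - (\<Sum>k\<in>{1..j}. z ^ k / of_nat k ^ s))"
    by (simp add: m0(1)[symmetric] algebra_simps)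
  also have "\<dots> = of_nat d ^ b * of_rat q * Y * (z ^ (n - j) * z ^ Suc j) * continued_value z ?c"
    using c by (simp add: mult.assoc)
  also have "z ^ (n - j) * z ^ Suc j = z ^ Suc n"
    using single(3) by (simp flip: power_add power_Suc)
  finally have "int_height B (Q * K + (\<Sum>k\<in>{1..j}. Q * K))
      (of_nat d ^ b * Y * z ^ Suc n * (of_rat q * continued_value z ?c))" by (simp add: mult_ac)
  moreover have "Q * K + (\<Sum>k\<in>{1..j}. Q * K) \<le> \<bar>real_of_rat q\<bar> * (real d ^ b * K * real (Suc n))"
  proof -
    have "Q * K + (\<Sum>k\<in>{1..j}. Q * K) = Q * K * real (Suc j)" by (simp add: algebra_simps)
    also have "\<dots> \<le> Q * K * real (Suc n)"
      using single(3) K by (intro mult_left_mono) (auto simp: Q_def)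
    finally show ?thesis by (simp add: Q_def mult_ac)
  qed
  ultimately have "int_height B (\<bar>real_of_rat q\<bar> * (real d ^ b * K * real (Suc n)))
      (of_nat d ^ b * Y * z ^ Suc n * (of_rat q * continued_value z ?c))" by (rule int_height_mono)
  thus ?case
    using continuable_cmult[of ?c "of_rat q"] continued_value_cmult[of ?c z "of_rat q"] c z(1)
    unfolding eq by simp
next
  case (add H R H' R')
  define k y where "k = real d ^ b * K * real (Suc n)" and "y = of_nat d ^ b * Y * z ^ Suc n"
  have R: "continuable R" "int_height B (H * k) (y * continued_value z R)"
    and R': "continuable R'" "int_height B (H' * k) (y * continued_value z R')"
    using add.IH unfolding k_def y_def by blast+
  have "int_height B ((H + H') * k) (y * continued_value z (\<lambda>t. R t + R' t))"
    using int_height_add[OF R(2) R'(2)] continued_value_add[OF R(1) R'(1) z(1)]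
    by (simp only: distrib_left distrib_right)
  thus ?case using continuable_add[OF R(1) R'(1)] unfolding k_def y_def by blast
next
  case (mono H R H')
  have "0 \<le> K" using rat[of 0] int_height_nonneg by blast
  hence "H * (real d ^ b * K * real (Suc n)) \<le> H' * (real d ^ b * K * real (Suc n))"
    using mono.hyps(2) by (intro mult_right_mono) auto
  thus ?case using mono.IH int_height_mono by blast
qed

section \<open>Residues of the building blocks\<close>

lemma prod_except_diff:
  assumes "k \<le> n"
  shows "(\<Prod>i\<in>{..n} - {k}. of_nat i - of_nat k :: complex) = (- 1) ^ k * (fact k * fact (n - k))"
proof -
  have "{..n} - {k} = {..<k} \<union> {Suc k..<Suc n}" using assms by auto
  moreover have "{..<k} \<inter> {Suc k..<Suc n} = {}" by auto
  ultimately have "(\<Prod>i\<in>{..n} - {k}. of_nat i - of_nat k :: complex)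
      = (\<Prod>i<k. of_nat i - of_nat k) * (\<Prod>i\<in>{Suc k..<Suc n}. of_nat i - of_nat k)"
    by (simp add: prod.union_disjoint)
  also have "(\<Prod>i<k. of_nat i - of_nat k :: complex) = (\<Prod>i<k. - of_nat (Suc i))"
    by (subst prod.nat_diff_reindex[symmetric]) (intro prod.cong, auto simp: of_nat_diff)
  also have "\<dots> = (- 1) ^ k * (\<Prod>i<k. of_nat (Suc i))" by (simp add: prod_uminus del: of_nat_Suc)
  also have "(\<Prod>i<k. of_nat (Suc i) :: complex) = fact k"
    by (simp add: fact_prod_Suc lessThan_atLeast0)
  also have "(\<Prod>i\<in>{Suc k..<Suc n}. of_nat i - of_nat k :: complex) = (\<Prod>i\<in>{0..<n - k}. of_nat (Suc i))"
  proof -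
    have "{Suc k..<Suc n} = {0 + Suc k..<(n - k) + Suc k}" using assms by simp
    thus ?thesis by (simp only: prod.shift_bounds_nat_ivl) simp
  qed
  also have "\<dots> = fact (n - k)" by (simp add: fact_prod_Suc)
  finally show ?thesis by simp
qed

text \<open>Lagrange interpolation: after clearing denominators both sides have degree at most
  \<open>n\<close> and agree at the \<open>n + 1\<close> points \<open>-(k + 1)\<close>. The
  residues are integers because \<open>q\<close> takes integer values there.\<close>

lemma simple_frac_eq:
  assumes deg: "degree q \<le> n" and v: "\<And>j. j \<le> n \<Longrightarrow> poly q (- (of_nat j + 1)) = of_int (v j)"
  shows "simple_frac n (\<lambda>j. (- 1) ^ j * int (n choose j) * v j) t
    = fact n * poly q (of_nat t) / (\<Prod>i<Suc n. of_nat t + of_nat i + 1)"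
proof -
  define c where "c j = (- 1) ^ j * int (n choose j) * v j" for j
  define P where "P j = (\<Prod>i\<in>{..n} - {j}. [:of_nat i + 1, 1 :: complex:])" for j
  have polyP: "poly (P j) x = (\<Prod>i\<in>{..n} - {j}. x + of_nat i + 1)" for j x
    by (simp add: P_def poly_prod add_ac)
  have degP: "degree (P j) \<le> n" if "j \<le> n" for j
  proof -
    have "degree (P j) \<le> sum (degree \<circ> (\<lambda>i. [:of_nat i + 1, 1 :: complex:])) ({..n} - {j})"
      unfolding P_def by (rule degree_prod_sum_le) simp
    also have "\<dots> = n" using that by simp
    finally show ?thesis .
  qed
  have "(\<Sum>j\<le>n. smult (of_int (c j)) (P j)) = smult (fact n) q"
  proof (rule poly_eqI_degree)
    let ?A = "(\<lambda>k. - (of_nat k + 1 :: complex)) ` {..n}"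
    have card: "card ?A = Suc n" by (subst card_image) (auto intro: inj_onI)
    have "degree (\<Sum>j\<le>n. smult (of_int (c j)) (P j)) \<le> n"
      by (intro degree_sum_le order_trans[OF degree_smult_le] degP) auto
    thus "degree (\<Sum>j\<le>n. smult (of_int (c j)) (P j)) < card ?A" unfolding card by simp
    show "degree (smult (fact n) q) < card ?A"
      unfolding card using deg order_trans[OF degree_smult_le deg] by (simp add: less_Suc_eq_le)
    fix x assume "x \<in> ?A"
    then obtain k where k: "k \<le> n" "x = - (of_nat k + 1)" by auto
    have zero: "poly (P j) x = 0" if "j \<noteq> k" for j
      unfolding polyP using k that by (intro prod_zero) (auto intro!: bexI[of _ k])
    have "poly (\<Sum>j\<le>n. smult (of_int (c j)) (P j)) x = (\<Sum>j\<le>n. of_int (c j) * poly (P j) x)"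
      by (simp add: poly_sum)
    also have "\<dots> = (\<Sum>j\<le>n. if j = k then of_int (c k) * poly (P k) x else 0)"
      by (intro sum.cong) (auto simp: zero)
    also have "\<dots> = of_int (c k) * poly (P k) x" using k by simp
    also have "poly (P k) x = (\<Prod>i\<in>{..n} - {k}. of_nat i - of_nat k)"
      unfolding polyP k(2) by (intro prod.cong) auto
    also have "\<dots> = (- 1) ^ k * (fact k * fact (n - k))" by (rule prod_except_diff[OF k(1)])
    also have "of_int (c k) * \<dots> = (of_nat (n choose k) * (fact k * fact (n - k))) * of_int (v k) * ((- 1) ^ k * (- 1) ^ k)"
      by (simp add: c_def mult_ac)
    also have "of_nat (n choose k) * (fact k * fact (n - k)) = (fact n :: complex)"
      using binomial_fact_lemma[OF k(1)] by (metis (mono_tags) mult.commute of_nat_fact of_nat_mult)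
    also have "(- 1) ^ k * (- 1) ^ k = (1 :: complex)" by (simp flip: power_mult_distrib)
    finally show "poly (\<Sum>j\<le>n. smult (of_int (c j)) (P j)) x = poly (smult (fact n) q) x"
      using v[OF k(1)] k(2) by simp
  qed
  from arg_cong[OF this, of "\<lambda>p. poly p (of_nat t)"]
  have sum: "(\<Sum>j\<le>n. of_int (c j) * poly (P j) (of_nat t)) = fact n * poly q (of_nat t)"
    by (simp add: poly_sum)
  define D where "D = (\<Prod>i\<le>n. of_nat t + of_nat i + (1::complex))"
  have D: "D = (of_nat t + of_nat j + 1) * poly (P j) (of_nat t)" if "j \<le> n" for j
    unfolding D_def polyP using that by (subst prod.remove[of _ j]) auto
  have D0: "D \<noteq> 0" unfolding D_def by simp
  have "of_int (c j) / (of_nat t + of_nat j + 1) = of_int (c j) * poly (P j) (of_nat t) / D" if "j \<le> n" for j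
  proof -
    have "poly (P j) (of_nat t) \<noteq> 0" using D[OF that] D0 by auto
    thus ?thesis unfolding D[OF that] by simp
  qed
  hence "simple_frac n c t = (\<Sum>j\<le>n. of_int (c j) * poly (P j) (of_nat t) / D)"
    unfolding simple_frac_def by (intro sum.cong) auto
  also have "\<dots> = fact n * poly q (of_nat t) / D"
    by (simp add: sum[symmetric] sum_divide_distrib)
  finally show ?thesis unfolding c_def D_def by (simp add: lessThan_Suc_atMost)
qed

text \<open>Residues of \<open>n! / e! * (t + 1) ... (t + e) / ((t + 1) ... (t + n + 1))\<close>;
  the factor after the binomial is the value of the numerator, divided by \<open>e!\<close>, at
  \<open>-(j + 1)\<close>.\<close>

definition rising_coeff :: "nat \<Rightarrow> nat \<Rightarrow> nat \<Rightarrow> int" where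
  "rising_coeff n e j = (- 1) ^ j * int (n choose j) * ((- 1) ^ e * int (j choose e))"

definition rising :: "nat \<Rightarrow> complex poly" where
  "rising e = (\<Prod>i<e. [:of_nat i + 1, 1:])"

lemma degree_rising: "degree (rising e) = e"
  by (simp add: rising_def degree_prod_eq_sum_degree)

lemma lead_coeff_rising: "lead_coeff (rising e) = 1"
  unfolding rising_def lead_coeff_prod by simp

lemma simple_frac_rising:
  assumes "e \<le> n"
  shows "simple_frac n (rising_coeff n e) t
    = fact n / fact e * poly (rising e) (of_nat t) / (\<Prod>i<Suc n. of_nat t + of_nat i + 1)"
proof -
  have "poly (smult (1 / fact e) (rising e)) (- (of_nat j + 1)) = of_int ((- 1) ^ e * int (j choose e))" for j
  proof -
    have "poly (rising e) (- (of_nat j + 1)) = (\<Prod>i<e. - (of_nat j - of_nat i :: complex))"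
      unfolding rising_def poly_prod by (intro prod.cong) auto
    also have "\<dots> = (- 1) ^ e * (\<Prod>i<e. of_nat j - of_nat i)" by (simp only: prod_uminus card_lessThan)
    also have "(\<Prod>i<e. of_nat j - of_nat i :: complex) = fact e * of_nat (j choose e)"
      by (simp add: binomial_gbinomial gbinomial_prod_rev lessThan_atLeast0)
    finally show ?thesis by simp
  qed
  from simple_frac_eq[OF _ this] show ?thesis
    using assms by (simp add: rising_coeff_def[abs_def] degree_rising)
qed

text \<open>Residues of the fraction whose numerator has the zeros
  \<open>i n, ..., i n + n - 1\<close>; bricks for consecutive \<open>i\<close> tile an initial
  interval of zeros.\<close>

definition brick_coeff :: "nat \<Rightarrow> nat \<Rightarrow> nat \<Rightarrow> int" where
  "brick_coeff n i j = (- 1) ^ j * int (n choose j) * ((- 1) ^ n * int ((j + i * n + n) choose n))"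

definition brick :: "nat \<Rightarrow> nat \<Rightarrow> complex poly" where
  "brick n i = (\<Prod>l<n. [:- of_nat (i * n + l), 1:])"

lemma simple_frac_brick:
  "simple_frac n (brick_coeff n i) t = poly (brick n i) (of_nat t) / (\<Prod>i<Suc n. of_nat t + of_nat i + 1)"
proof -
  have "poly (smult (1 / fact n) (brick n i)) (- (of_nat j + 1)) = of_int ((- 1) ^ n * int ((j + i * n + n) choose n))" for j
  proof -
    have "poly (brick n i) (- (of_nat j + 1)) = (\<Prod>l<n. - of_nat (j + i * n + Suc l))"
      unfolding brick_def poly_prod by (intro prod.cong) auto
    also have "\<dots> = (- 1) ^ n * (\<Prod>l<n. of_nat (j + i * n + Suc l))" by (simp only: prod_uminus card_lessThan)
    also have "(\<Prod>l<n. of_nat (j + i * n + Suc l) :: complex) = (\<Prod>l<n. of_nat (j + i * n + n) - of_nat l)"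
      by (subst prod.nat_diff_reindex[symmetric]) (intro prod.cong, auto simp: of_nat_diff Suc_diff_Suc)
    also have "\<dots> = fact n * of_nat ((j + i * n + n) choose n)"
      by (simp only: binomial_gbinomial gbinomial_prod_rev lessThan_atLeast0) simp
    finally show ?thesis by simp
  qed
  moreover have "degree (smult (1 / fact n) (brick n i)) \<le> n"
    by (simp add: brick_def degree_prod_eq_sum_degree)
  ultimately show ?thesis
    using simple_frac_eq[of "smult (1 / fact n) (brick n i)" n "\<lambda>j. (- 1) ^ n * int ((j + i * n + n) choose n)" t]
    by (simp add: brick_coeff_def[abs_def])
qed

lemma sum_choose_row_real: "(\<Sum>j\<le>n. real (n choose j)) = 2 ^ n"
  unfolding of_nat_sum[symmetric] choose_row_sum by simp

lemma sum_rising_coeff_le: "(\<Sum>j\<le>n. \<bar>real_of_int (rising_coeff n e j)\<bar>) \<le> 4 ^ n"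
proof -
  have "(\<Sum>j\<le>n. \<bar>real_of_int (rising_coeff n e j)\<bar>) \<le> (\<Sum>j\<le>n. real (n choose j) * 2 ^ n)"
  proof (intro sum_mono)
    fix j assume "j \<in> {..n}"
    hence "(2::nat) ^ j \<le> 2 ^ n" by (intro power_increasing) auto
    hence "j choose e \<le> 2 ^ n" by (rule order_trans[OF binomial_le_pow2])
    hence "real (j choose e) \<le> real (2 ^ n)" by (rule of_nat_mono)
    thus "\<bar>real_of_int (rising_coeff n e j)\<bar> \<le> real (n choose j) * 2 ^ n"
      by (simp add: rising_coeff_def abs_mult power_abs mult_left_mono)
  qed
  also have "\<dots> = 2 ^ n * 2 ^ n" by (simp only: sum_distrib_right[symmetric] sum_choose_row_real)
  also have "\<dots> = (4::real) ^ n" by (simp flip: power_mult_distrib)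
  finally show ?thesis .
qed

lemma sum_brick_coeff_le:
  assumes "i < r"
  shows "(\<Sum>j\<le>n. \<bar>real_of_int (brick_coeff n i j)\<bar>) \<le> 2 ^ ((r + 2) * n)"
proof -
  have "(\<Sum>j\<le>n. \<bar>real_of_int (brick_coeff n i j)\<bar>) \<le> (\<Sum>j\<le>n. real (n choose j) * 2 ^ ((r + 1) * n))"
  proof (intro sum_mono)
    fix j assume j: "j \<in> {..n}"
    have "(i + 2) * n \<le> (r + 1) * n" using assms by (intro mult_right_mono) auto
    hence "j + i * n + n \<le> (r + 1) * n" using j by (simp add: algebra_simps)
    hence "(2::nat) ^ (j + i * n + n) \<le> 2 ^ ((r + 1) * n)" by (intro power_increasing) auto
    hence "(j + i * n + n) choose n \<le> 2 ^ ((r + 1) * n)" by (rule order_trans[OF binomial_le_pow2])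
    hence "real ((j + i * n + n) choose n) \<le> real (2 ^ ((r + 1) * n))" by (rule of_nat_mono)
    thus "\<bar>real_of_int (brick_coeff n i j)\<bar> \<le> real (n choose j) * 2 ^ ((r + 1) * n)"
      by (simp add: brick_coeff_def abs_mult power_abs mult_left_mono)
  qed
  also have "\<dots> = 2 ^ n * 2 ^ ((r + 1) * n)" by (simp only: sum_distrib_right[symmetric] sum_choose_row_real)
  also have "\<dots> = (2::real) ^ ((r + 2) * n)" by (simp flip: power_add)
  finally show ?thesis .
qed

section \<open>The approximations\<close>

text \<open>The factor \<open>x^L\<close> records the vanishing at 0, and integral operators convert
  it into decay. Only \<open>x = 1\<close> is of interest in the end, but an integral over the
  segment needs all \<open>x\<close>.\<close>

definition ray_bound :: "complex \<Rightarrow> nat \<Rightarrow> real \<Rightarrow> (nat \<Rightarrow> complex) \<Rightarrow> bool" where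
  "ray_bound z L B R \<longleftrightarrow>
     (\<exists>F. extends R F \<and> (\<forall>x. 0 \<le> x \<longrightarrow> x \<le> 1 \<longrightarrow> norm (F (of_real x * z)) \<le> B * x ^ L))"

lemma norm_continued_value_le:
  assumes "z \<in> cut_plane" "ray_bound z L B R"
  shows "norm (continued_value z R) \<le> B"
proof -
  obtain F where F: "extends R F" "\<And>x. 0 \<le> x \<Longrightarrow> x \<le> 1 \<Longrightarrow> norm (F (of_real x * z)) \<le> B * x ^ L"
    using assms(2) unfolding ray_bound_def by blast
  from F(2)[of 1] continued_value_eqI[OF F(1) assms(1)] show ?thesis by simp
qed

lemma ray_bound_nonneg:
  assumes "ray_bound z L B R"
  shows "0 \<le> B"
proof -
  obtain F :: "complex \<Rightarrow> complex" where F: "\<And>x. 0 \<le> x \<Longrightarrow> x \<le> 1 \<Longrightarrow> norm (F (of_real x * z)) \<le> B * x ^ L"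
    using assms unfolding ray_bound_def by blast
  from order_trans[OF norm_ge_zero F[of 1]] show ?thesis by simp
qed

lemma ray_bound_mono:
  assumes "ray_bound z L B R" "B \<le> B'"
  shows "ray_bound z L B' R"
  unfolding ray_bound_def
proof -
  obtain F where F: "extends R F" "\<And>x. 0 \<le> x \<Longrightarrow> x \<le> 1 \<Longrightarrow> norm (F (of_real x * z)) \<le> B * x ^ L"
    using assms unfolding ray_bound_def by blast
  have "norm (F (of_real x * z)) \<le> B' * x ^ L" if "0 \<le> x" "x \<le> 1" for x
    using F(2)[OF that] mult_right_mono[OF assms(2), of "x ^ L"] that by simp
  thus "\<exists>F. extends R F \<and> (\<forall>x. 0 \<le> x \<longrightarrow> x \<le> 1 \<longrightarrow> norm (F (of_real x * z)) \<le> B' * x ^ L)"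
    using F(1) by blast
qed

lemma ray_bound_cmult:
  assumes "ray_bound z L B R"
  shows "ray_bound z L (norm a * B) (\<lambda>t. a * R t)"
proof -
  obtain F where F: "extends R F" "\<And>x. 0 \<le> x \<Longrightarrow> x \<le> 1 \<Longrightarrow> norm (F (of_real x * z)) \<le> B * x ^ L"
    using assms unfolding ray_bound_def by blast
  have "norm (a * F (of_real x * z)) \<le> norm a * B * x ^ L" if "0 \<le> x" "x \<le> 1" for x
    using mult_left_mono[OF F(2)[OF that], of "norm a"] by (simp add: norm_mult mult.assoc)
  thus ?thesis using extends_cmult[OF F(1), of a] unfolding ray_bound_def by blast
qed

section \<open>Decay from Beta integrals\<close>

definition real_simple_frac :: "nat \<Rightarrow> (nat \<Rightarrow> int) \<Rightarrow> nat \<Rightarrow> real" where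
  "real_simple_frac n c t = (\<Sum>j\<le>n. of_int (c j) / (real t + real j + 1))"

lemma of_real_simple_frac: "of_real (real_simple_frac n c t) = simple_frac n c t"
  by (simp add: real_simple_frac_def simple_frac_def)

lemma has_integral_simple_frac:
  "((\<lambda>x. (\<Sum>j\<le>n. of_int (c j) * x ^ j) * x ^ t) has_integral real_simple_frac n c t) {0..1}"
proof -
  have "((\<lambda>x. of_int (c j) * x ^ (j + t)) has_integral of_int (c j) * (1 / (real (j + t) + 1))) {0..1}" for j
    by (intro has_integral_mult_right has_integral_monomial)
  from has_integral_sum[OF _ this, of "{..n}" "\<lambda>j. j"] show ?thesis
    by (simp add: real_simple_frac_def sum_distrib_right power_add mult.assoc add_ac)
qed

lemma ray_bound_mult_simple_frac:
  fixes q :: "real \<Rightarrow> real"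
  assumes z: "z \<in> cut_plane" and R: "ray_bound z L B R"
    and q: "\<And>x. 0 \<le> x \<Longrightarrow> x \<le> 1 \<Longrightarrow> \<bar>\<Sum>j\<le>n. of_int (c j) * x ^ j\<bar> \<le> q x"
    and I: "((\<lambda>x. q x * x ^ L) has_integral I) {0..1}"
  shows "ray_bound z L (B * I) (\<lambda>t. R t * simple_frac n c t)"
proof -
  obtain F where F: "extends R F" "\<And>x. 0 \<le> x \<Longrightarrow> x \<le> 1 \<Longrightarrow> norm (F (of_real x * z)) \<le> B * x ^ L"
    using R unfolding ray_bound_def by blast
  define p where "p x = (\<Sum>j\<le>n. of_int (c j) * x ^ j :: real)" for x
  have p: "continuous_on {0..1} p" unfolding p_def by (intro continuous_intros)
  have "extends (\<lambda>t. R t * of_real (real_simple_frac n c t)) (\<lambda>z. integral {0..1} (\<lambda>x. of_real (p x) * F (of_real x * z)))"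
    by (rule extends_moments[OF F(1) p]) (use has_integral_simple_frac in \<open>simp add: p_def\<close>)
  moreover have "norm (integral {0..1} (\<lambda>x. of_real (p x) * F (of_real x * (of_real y * z)))) \<le> B * I * y ^ L"
    if "0 \<le> y" "y \<le> 1" for y
    by (rule norm_moment_integral_le[OF holomorphic_on_imp_continuous_on[OF extendsD(1)[OF F(1)]] z p F(2) _ I that])
      (use q in \<open>simp_all add: p_def\<close>)
  ultimately show ?thesis unfolding ray_bound_def of_real_simple_frac by blast
qed

text \<open>The crude case: the kernel is bounded by the sum of its coefficients and no decay is
  extracted.\<close>

lemma ray_bound_mult_simple_frac_sum:
  assumes z: "z \<in> cut_plane" and R: "ray_bound z L B R" and C: "(\<Sum>j\<le>n. \<bar>real_of_int (c j)\<bar>) \<le> C"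
  shows "ray_bound z L (B * C) (\<lambda>t. R t * simple_frac n c t)"
proof -
  have "ray_bound z L (B * (C * (1 / (real L + 1)))) (\<lambda>t. R t * simple_frac n c t)"
  proof (rule ray_bound_mult_simple_frac[OF z R])
    show "((\<lambda>x. C * x ^ L) has_integral C * (1 / (real L + 1))) {0..1}"
      by (intro has_integral_mult_right has_integral_monomial)
    fix x :: real assume x: "0 \<le> x" "x \<le> 1"
    have "\<bar>\<Sum>j\<le>n. of_int (c j) * x ^ j\<bar> \<le> (\<Sum>j\<le>n. \<bar>of_int (c j) * x ^ j\<bar>)" by (rule sum_abs)
    also have "\<dots> \<le> (\<Sum>j\<le>n. \<bar>of_int (c j)\<bar> * 1)"
      unfolding abs_mult using x by (intro sum_mono mult_left_mono) (auto intro: power_le_one)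
    finally show "\<bar>\<Sum>j\<le>n. of_int (c j) * x ^ j\<bar> \<le> C" using C by simp
  qed
  moreover have "B * (C * (1 / (real L + 1))) \<le> B * C"
  proof -
    have "0 \<le> C" using C by (meson abs_ge_zero order_trans sum_nonneg)
    hence "C * (1 / (real L + 1)) \<le> C * 1" by (intro mult_left_mono) auto
    thus ?thesis using ray_bound_nonneg[OF R] by (intro mult_left_mono) auto
  qed
  ultimately show ?thesis by (rule ray_bound_mono)
qed

text \<open>The last factor of the denominator is at least 1 and is dropped. The others are compared
  one by one: \<open>i + 1 \<le> n\<close> gives
  \<open>(r + 1) * (i + 1) \<le> r n + i + 1\<close>.\<close>

lemma fact_div_prod_le:
  "fact n / (\<Prod>i<Suc n. real (r * n) + real i + 1) \<le> (1 / (real r + 1)) ^ n"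
proof -
  have "(\<Prod>i<n. real (r * n) + real i + 1) > 0" by (intro prod_pos) (simp add: add_nonneg_pos del: of_nat_mult)
  moreover have "1 \<le> real (r * n) + real n + 1" using of_nat_0_le_iff[of "r * n"] by linarith
  ultimately have "(\<Prod>i<n. real (r * n) + real i + 1) * 1 \<le> (\<Prod>i<n. real (r * n) + real i + 1) * (real (r * n) + real n + 1)"
    by (intro mult_left_mono) simp_all
  hence "fact n / (\<Prod>i<Suc n. real (r * n) + real i + 1) \<le> fact n / (\<Prod>i<n. real (r * n) + real i + 1)"
    using \<open>0 < (\<Prod>i<n. real (r * n) + real i + 1)\<close> by (intro frac_le) simp_all
  also have fact: "(fact n :: real) = (\<Prod>i<n. real i + 1)"
    by (induction n) (simp_all add: mult.commute add.commute)
  also have "(\<Prod>i<n. real i + 1) / (\<Prod>i<n. real (r * n) + real i + 1) = (\<Prod>i<n. (real i + 1) / (real (r * n) + real i + 1))"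
    by (simp add: prod_dividef)
  also have "\<dots> \<le> (\<Prod>i<n. 1 / (real r + 1))"
  proof (intro prod_mono conjI)
    fix i assume "i \<in> {..<n}"
    hence "r * Suc i \<le> r * n" by (intro mult_left_mono) auto
    hence "real r * (real i + 1) \<le> real (r * n)" by (metis of_nat_Suc of_nat_le_iff of_nat_mult add.commute)
    thus "(real i + 1) / (real (r * n) + real i + 1) \<le> 1 / (real r + 1)"
    proof -
      have r1: "0 < real r + 1" and pos: "0 < real (r * n) + real i + 1"
        using of_nat_0_le_iff[of "r * n"] by linarith+
      have "(real i + 1) * (real r + 1) \<le> real (r * n) + real i + 1"
        using \<open>real r * (real i + 1) \<le> real (r * n)\<close> by (simp add: algebra_simps)
      hence "real i + 1 \<le> (real (r * n) + real i + 1) / (real r + 1)"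
        unfolding pos_le_divide_eq[OF r1] .
      thus ?thesis unfolding pos_divide_le_eq[OF pos] by simp
    qed
    show "0 \<le> (real i + 1) / (real (r * n) + real i + 1)"
      using of_nat_0_le_iff[of "r * n"] by (intro divide_nonneg_nonneg) linarith+
  qed
  finally show ?thesis unfolding fact by simp
qed

text \<open>For \<open>e = 0\<close> the kernel is \<open>(1 - x)^n\<close>, nonnegative on the unit
  interval and so its own majorant. The factor gained is its moment of order \<open>r n\<close>, a
  Beta integral.\<close>

lemma ray_bound_mult_beta:
  assumes z: "z \<in> cut_plane" and R: "ray_bound z (r * n) B R"
  shows "ray_bound z (r * n) (B * (1 / (real r + 1)) ^ n) (\<lambda>t. R t * simple_frac n (rising_coeff n 0) t)"
proof -
  have p: "(\<Sum>j\<le>n. of_int (rising_coeff n 0 j) * x ^ j) = (1 - x) ^ n" for x :: real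
    using binomial_ring[of "- x" 1 n] by (simp add: rising_coeff_def power_minus[of x] mult_ac)
  have rb: "ray_bound z (r * n) (B * real_simple_frac n (rising_coeff n 0) (r * n)) (\<lambda>t. R t * simple_frac n (rising_coeff n 0) t)"
  proof (rule ray_bound_mult_simple_frac[OF z R _ has_integral_simple_frac])
    fix x :: real assume "0 \<le> x" "x \<le> 1"
    thus "\<bar>\<Sum>j\<le>n. of_int (rising_coeff n 0 j) * x ^ j\<bar> \<le> (\<Sum>j\<le>n. of_int (rising_coeff n 0 j) * x ^ j)"
      unfolding p by simp
  qed
  have I: "real_simple_frac n (rising_coeff n 0) (r * n) = fact n / (\<Prod>i<Suc n. real (r * n) + real i + 1)"
  proof -
    have "complex_of_real (real_simple_frac n (rising_coeff n 0) (r * n))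
        = complex_of_real (fact n / (\<Prod>i<Suc n. real (r * n) + real i + 1))"
      unfolding of_real_simple_frac by (subst simple_frac_rising) (simp_all add: rising_def)
    thus ?thesis by (simp only: of_real_eq_iff)
  qed
  have "real_simple_frac n (rising_coeff n 0) (r * n) \<le> (1 / (real r + 1)) ^ n"
    unfolding I by (rule fact_div_prod_le)
  from ray_bound_mono[OF rb mult_left_mono[OF this ray_bound_nonneg[OF R]]] show ?thesis .
qed

lemma ray_bound_choose:
  assumes e: "e > 0" "\<And>x. 0 \<le> x \<Longrightarrow> x \<le> 1 \<Longrightarrow> e \<le> norm (1 - of_real x * z)"
  shows "ray_bound z L (norm z ^ L / e ^ Suc L) (\<lambda>t. of_nat (t choose L))"
  unfolding ray_bound_def
proof (intro exI conjI allI impI)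
  show "extends (\<lambda>t. of_nat (t choose L)) (\<lambda>z. z ^ L / (1 - z) ^ Suc L)" by (rule extends_choose)
  fix x :: real assume x: "0 \<le> x" "x \<le> 1"
  have "norm ((of_real x * z) ^ L / (1 - of_real x * z) ^ Suc L) = (norm z ^ L * x ^ L) / norm (1 - of_real x * z) ^ Suc L"
    using x by (simp add: norm_divide norm_power norm_mult power_mult_distrib mult_ac)
  also have "\<dots> \<le> (norm z ^ L * x ^ L) / e ^ Suc L"
    using e(1) e(2)[OF x] x less_le_trans[OF e(1) e(2)[OF x]]
    by (intro divide_left_mono power_mono mult_pos_pos zero_less_power) auto
  finally show "norm ((of_real x * z) ^ L / (1 - of_real x * z) ^ Suc L) \<le> norm z ^ L / e ^ Suc L * x ^ L"
    by simp
qed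

lemma dist_ray_from_1:
  assumes "z \<in> cut_plane"
  obtains e where "e > 0" "\<And>x. 0 \<le> x \<Longrightarrow> x \<le> 1 \<Longrightarrow> e \<le> norm (1 - of_real x * z)"
proof -
  have "continuous_on {0..1::real} (\<lambda>x. norm (1 - of_real x * z))" by (intro continuous_intros)
  from continuous_attains_inf[OF compact_Icc _ this]
  have "\<exists>x0\<in>{0..1}. \<forall>x\<in>{0..1}. norm (1 - of_real x0 * z) \<le> norm (1 - of_real x * z)" by simp
  then obtain x0 where x0: "x0 \<in> {0..1}" "\<forall>x\<in>{0..1}. norm (1 - of_real x0 * z) \<le> norm (1 - of_real x * z)" ..
  have "of_real x0 * z \<noteq> 1"
    using scaled_in_cut_plane[OF assms, of x0] x0(1) by (auto simp: cut_plane_def image_iff dest: spec[of _ "1::real"])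
  thus thesis using x0 by (intro that[of "norm (1 - of_real x0 * z)"]) auto
qed

text \<open>Each step contributes a binomial coefficient of at most \<open>2^(r n)\<close>. For
  \<open>k = r\<close> this bounds the multinomial \<open>(r n)! / n!^r\<close> that appears when
  the bricks are rewritten.\<close>

lemma fact_mult_le: "k \<le> r \<Longrightarrow> (fact (k * n) :: real) \<le> fact n ^ k * (2 ^ (r * n)) ^ k"
proof (induction k)
  case (Suc k)
  have "(fact (Suc k * n) :: nat) = fact n * fact (k * n) * (Suc k * n choose n)"
    using binomial_fact_lemma[of n "Suc k * n"] by simp
  hence "(fact (Suc k * n) :: real) = fact n * fact (k * n) * real (Suc k * n choose n)"
    by (metis of_nat_fact of_nat_mult)
  also have "\<dots> \<le> fact n * (fact n ^ k * (2 ^ (r * n)) ^ k) * 2 ^ (r * n)"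
  proof (intro mult_mono mult_left_mono)
    have "(2::nat) ^ (Suc k * n) \<le> 2 ^ (r * n)" using Suc.prems by (intro power_increasing mult_right_mono) auto
    hence "Suc k * n choose n \<le> 2 ^ (r * n)" by (rule order_trans[OF binomial_le_pow2])
    hence "real (Suc k * n choose n) \<le> real (2 ^ (r * n))" by (rule of_nat_mono)
    thus "real (Suc k * n choose n) \<le> 2 ^ (r * n)" by simp
  qed (use Suc in auto)
  finally show ?case by (simp add: mult_ac)
qed simp

text \<open>Distributes a degree \<open>m\<close> over the factors greedily: full portions
  \<open>n\<close>, then a remainder, then 0 by truncated subtraction.\<close>

definition shift_exp :: "nat \<Rightarrow> nat \<Rightarrow> nat \<Rightarrow> nat" where
  "shift_exp n m i = min n (m - n * i)"

lemma sum_shift_exp: "(\<Sum>i<b. shift_exp n m i) = min (b * n) m"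
  by (induction b) (auto simp: shift_exp_def algebra_simps)

text \<open>The first \<open>b\<close> factors carry the free numerator of degree \<open>m\<close>,
  the next \<open>b\<close> supply the decay and the last \<open>r\<close> the zeros.\<close>

definition approx :: "nat \<Rightarrow> nat \<Rightarrow> nat \<Rightarrow> nat \<Rightarrow> nat \<Rightarrow> complex" where
  "approx b r n m t = (\<Prod>i<b. simple_frac n (rising_coeff n (shift_exp n m i)) t)
     * simple_frac n (rising_coeff n 0) t ^ b * (\<Prod>i<r. simple_frac n (brick_coeff n i) t)"

definition approx_poly :: "nat \<Rightarrow> nat \<Rightarrow> nat \<Rightarrow> complex poly" where
  "approx_poly b n m = (\<Prod>i<b. rising (shift_exp n m i))"

lemma degree_approx_poly:
  assumes "m \<le> b * n"
  shows "degree (approx_poly b n m) = m"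
proof -
  have "rising e \<noteq> 0" for e using lead_coeff_rising[of e] by auto
  hence "degree (approx_poly b n m) = (\<Sum>i<b. degree (rising (shift_exp n m i)))"
    unfolding approx_poly_def by (intro degree_prod_eq_sum_degree) auto
  thus ?thesis using assms by (simp add: degree_rising sum_shift_exp)
qed

lemma lead_coeff_approx_poly: "lead_coeff (approx_poly b n m) = 1"
  unfolding approx_poly_def lead_coeff_prod by (simp only: lead_coeff_rising prod.neutral_const)

context stable_subspace begin

lemma prod_brick: "(\<Prod>i<r. brick n i) = falling (r * n)"
proof -
  have "brick n i = (\<Prod>l = i * n..<i * n + n. [:- of_nat l, 1:])" for i
    unfolding brick_def lessThan_atLeast0 using prod.shift_bounds_nat_ivl[of "\<lambda>l. [:- complex_of_nat l, 1:]" 0 "i * n" n]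
    by (simp add: add.commute)
  thus ?thesis unfolding falling_def using prod.nat_group[of "\<lambda>l. [:- complex_of_nat l, 1:]" n r] by simp
qed

lemma poly_falling: "poly (falling k) (of_nat t) = fact k * of_nat (t choose k)"
  by (simp add: falling_def poly_prod binomial_gbinomial gbinomial_prod_rev lessThan_atLeast0)

text \<open>The link to the reduction of numerators: the constant in front is a nonzero rational, so
  it does not affect membership in \<open>U\<close>.\<close>

lemma approx_eq_quot:
  "approx b r n m = quot (2 * b + r) (Suc n)
     (smult ((\<Prod>i<b. fact n / fact (shift_exp n m i)) * fact n ^ b) (falling (r * n) * approx_poly b n m))"
proof
  fix t
  define D where "D = (\<Prod>i<Suc n. of_nat t + of_nat i + (1::complex))"
  have rise: "simple_frac n (rising_coeff n e) t = fact n / fact e * poly (rising e) (of_nat t) / D" if "e \<le> n" for e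
    using simple_frac_rising[OF that] by (simp add: D_def)
  have 1: "(\<Prod>i<b. simple_frac n (rising_coeff n (shift_exp n m i)) t)
      = (\<Prod>i<b. fact n / fact (shift_exp n m i)) * poly (approx_poly b n m) (of_nat t) / D ^ b"
  proof -
    have "(\<Prod>i<b. simple_frac n (rising_coeff n (shift_exp n m i)) t)
       = (\<Prod>i<b. fact n / fact (shift_exp n m i) * poly (rising (shift_exp n m i)) (of_nat t) / D)"
      by (intro prod.cong refl rise) (simp add: shift_exp_def)
    thus ?thesis by (simp only: prod_dividef prod.distrib prod_constant card_lessThan approx_poly_def poly_prod)
  qed
  have 2: "simple_frac n (rising_coeff n 0) t ^ b = fact n ^ b / D ^ b"
    by (simp add: rise rising_def power_divide)
  have 3: "(\<Prod>i<r. simple_frac n (brick_coeff n i) t) = poly (falling (r * n)) (of_nat t) / D ^ r"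
    unfolding simple_frac_brick D_def[symmetric] prod_brick[symmetric]
    by (simp add: prod_dividef poly_prod)
  have "D ^ (2 * b + r) = D ^ b * D ^ b * D ^ r" by (simp add: mult_2 power_add)
  thus "approx b r n m t = quot (2 * b + r) (Suc n)
     (smult ((\<Prod>i<b. fact n / fact (shift_exp n m i)) * fact n ^ b) (falling (r * n) * approx_poly b n m)) t"
    unfolding approx_def 1 2 3 quot_def D_def[symmetric] by (simp add: mult_ac)
qed

text \<open>The product is regrouped: the bricks together are
  \<open>(r n)! / n!^r * (t choose r n)\<close> times \<open>r\<close> further Beta factors. The
  binomial series has an explicit continuation of size \<open>x^(r n)\<close> on the ray, and every
  other factor acts as an integral operator.\<close>

lemma ray_bound_approx:
  assumes e: "e > 0" "\<And>x. 0 \<le> x \<Longrightarrow> x \<le> 1 \<Longrightarrow> e \<le> norm (1 - of_real x * z)"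
  shows "ray_bound z (r * n)
    (norm z ^ (r * n) / e ^ Suc (r * n) * (2 ^ (r * n)) ^ r * (4 ^ n) ^ b * ((1 / (real r + 1)) ^ n) ^ b) (approx b r n m)"
proof -
  let ?s0 = "simple_frac n (rising_coeff n 0)"
  let ?q = "(1 / (real r + 1)) ^ n"
  define A where "A = norm z ^ (r * n) / e ^ Suc (r * n)"
  have A: "A \<ge> 0" using e(1) by (simp add: A_def)
  have base: "ray_bound z (r * n) A (\<lambda>t. of_nat (t choose (r * n)))"
    unfolding A_def by (rule ray_bound_choose[OF e])
  have c: "norm (fact (r * n) / fact n ^ r :: complex) \<le> (2 ^ (r * n)) ^ r"
    using fact_mult_le[of r r n] by (simp add: norm_divide norm_power divide_simps mult.commute)
  have 0: "ray_bound z (r * n) (A * (2 ^ (r * n)) ^ r) (\<lambda>t. fact (r * n) / fact n ^ r * of_nat (t choose (r * n)))"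
    using mult_right_mono[OF c A] by (intro ray_bound_mono[OF ray_bound_cmult[OF base]]) (simp add: mult.commute)
  have 1: "ray_bound z (r * n) (B * (4 ^ n) ^ k) (\<lambda>t. R t * (\<Prod>i<k. simple_frac n (rising_coeff n (shift_exp n m i)) t))"
    if "ray_bound z (r * n) B R" for k B R
  proof (induction k)
    case (Suc k)
    from ray_bound_mult_simple_frac_sum[OF z(1) Suc sum_rising_coeff_le] show ?case by (simp add: mult_ac)
  qed (simp add: that)
  have 2: "ray_bound z (r * n) (B * ?q ^ k) (\<lambda>t. R t * ?s0 t ^ k)"
    if "ray_bound z (r * n) B R" for k B R
  proof (induction k)
    case (Suc k)
    from ray_bound_mult_beta[OF z(1) Suc] show ?case by (simp add: mult_ac)
  qed (simp add: that)
  have "ray_bound z (r * n) (A * (2 ^ (r * n)) ^ r * (4 ^ n) ^ b * ?q ^ (b + r))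
     (\<lambda>t. fact (r * n) / fact n ^ r * of_nat (t choose (r * n))
        * (\<Prod>i<b. simple_frac n (rising_coeff n (shift_exp n m i)) t) * ?s0 t ^ (b + r))"
    by (intro 2 1 0)
  also have "(\<lambda>t. fact (r * n) / fact n ^ r * of_nat (t choose (r * n))
        * (\<Prod>i<b. simple_frac n (rising_coeff n (shift_exp n m i)) t) * ?s0 t ^ (b + r)) = approx b r n m"
  proof
    fix t
    define D where "D = (\<Prod>i<Suc n. of_nat t + of_nat i + (1::complex))"
    have s0: "?s0 t = fact n / D" using simple_frac_rising[of 0 n t] by (simp add: D_def rising_def)
    have "(\<Prod>i<r. simple_frac n (brick_coeff n i) t) = poly (falling (r * n)) (of_nat t) / D ^ r"
      unfolding simple_frac_brick D_def[symmetric] prod_brick[symmetric] by (simp add: prod_dividef poly_prod)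
    also have "\<dots> = fact (r * n) / fact n ^ r * of_nat (t choose (r * n)) * ?s0 t ^ r"
      by (simp add: s0 power_divide poly_falling)
    finally show "fact (r * n) / fact n ^ r * of_nat (t choose (r * n))
        * (\<Prod>i<b. simple_frac n (rising_coeff n (shift_exp n m i)) t) * ?s0 t ^ (b + r) = approx b r n m t"
      by (simp only: approx_def power_add mult_ac)
  qed
  finally have bound: "ray_bound z (r * n) (A * (2 ^ (r * n)) ^ r * (4 ^ n) ^ b * ?q ^ (b + r)) (approx b r n m)" .
  \<comment> \<open>The gain from the \<open>r\<close> Beta factors hidden in the bricks is given
    away.\<close>
  have "?q ^ (b + r) \<le> ?q ^ b" by (intro power_decreasing) (auto intro!: power_le_one)
  hence "A * (2 ^ (r * n)) ^ r * (4 ^ n) ^ b * ?q ^ (b + r) \<le> A * (2 ^ (r * n)) ^ r * (4 ^ n) ^ b * ?q ^ b"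
    using A by (intro mult_left_mono) auto
  from ray_bound_mono[OF bound this] show ?thesis unfolding A_def .
qed

end

lemma frac_rep_approx:
  assumes d: "\<And>i. 1 \<le> i \<Longrightarrow> i \<le> n \<Longrightarrow> i dvd d" and a: "2 * b + r = Suc k"
  shows "frac_rep d n (Suc k) (fact (Suc k) * ((4 ^ n) ^ (2 * b) * (2 ^ ((r + 2) * n)) ^ r)) (approx b r n m)"
proof -
  \<comment> \<open>The three groups of factors are listed as one sequence of length
    \<open>2 * b + r\<close>.\<close>
  define c where "c i = (if i < b then rising_coeff n (shift_exp n m i)
      else if i < 2 * b then rising_coeff n 0 else brick_coeff n (i - 2 * b))" for i
  have split: "(\<Prod>i<x + y. f i) = (\<Prod>i<x. f i) * (\<Prod>i<y. f (x + i))" for f :: "nat \<Rightarrow> 'a :: comm_monoid_mult" and x y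
    by (induction y) (simp_all add: mult_ac)
  have eq: "(\<Prod>i<Suc k. f (c i)) = (\<Prod>i<b. f (rising_coeff n (shift_exp n m i))) * f (rising_coeff n 0) ^ b
      * (\<Prod>i<r. f (brick_coeff n i))" for f :: "(nat \<Rightarrow> int) \<Rightarrow> 'a :: comm_monoid_mult"
  proof -
    have "(\<Prod>i<Suc k. f (c i)) = (\<Prod>i<b. f (c i)) * (\<Prod>i<b. f (c (b + i))) * (\<Prod>i<r. f (c (b + b + i)))"
      unfolding a[symmetric] mult_2 split ..
    also have "(\<Prod>i<b. f (c i)) = (\<Prod>i<b. f (rising_coeff n (shift_exp n m i)))"
      by (intro prod.cong) (auto simp: c_def)
    also have "(\<Prod>i<b. f (c (b + i))) = (\<Prod>i<b. f (rising_coeff n 0))"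
      by (intro prod.cong) (auto simp: c_def)
    also have "(\<Prod>i<r. f (c (b + b + i))) = (\<Prod>i<r. f (brick_coeff n i))"
      by (intro prod.cong) (auto simp: c_def)
    finally show ?thesis by simp
  qed
  have rep: "frac_rep d n (Suc k) (fact (Suc k) * (\<Prod>i<Suc k. \<Sum>j\<le>n. \<bar>of_int (c i j)\<bar>)) (\<lambda>t. \<Prod>i<Suc k. simple_frac n (c i) t)"
    by (rule frac_rep_prod_simple_frac[OF d])
  have fam: "(\<lambda>t. \<Prod>i<Suc k. simple_frac n (c i) t) = approx b r n m"
    unfolding eq[of "\<lambda>c. simple_frac n c _"] approx_def[abs_def] ..
  have "(\<Prod>i<Suc k. \<Sum>j\<le>n. \<bar>real_of_int (c i j)\<bar>) \<le> (4 ^ n) ^ (2 * b) * (2 ^ ((r + 2) * n)) ^ r"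
  proof -
    let ?N = "\<lambda>c. \<Sum>j\<le>n. \<bar>real_of_int (c j)\<bar>"
    have 1: "(\<Prod>i<b. ?N (rising_coeff n (shift_exp n m i))) \<le> (\<Prod>i<b. 4 ^ n)"
      by (intro prod_mono conjI sum_rising_coeff_le sum_nonneg) auto
    have 2: "?N (rising_coeff n 0) ^ b \<le> (4 ^ n) ^ b"
      by (intro power_mono sum_rising_coeff_le sum_nonneg) auto
    have 3: "(\<Prod>i<r. ?N (brick_coeff n i)) \<le> (\<Prod>i<r. 2 ^ ((r + 2) * n))"
      by (intro prod_mono conjI sum_brick_coeff_le sum_nonneg) auto
    have "(\<Prod>i<b. ?N (rising_coeff n (shift_exp n m i))) * ?N (rising_coeff n 0) ^ b * (\<Prod>i<r. ?N (brick_coeff n i))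
       \<le> (4 ^ n) ^ b * (4 ^ n) ^ b * (2 ^ ((r + 2) * n)) ^ r"
      using 1 2 3 by (intro mult_mono) (auto intro!: prod_nonneg mult_nonneg_nonneg sum_nonneg)
    thus ?thesis unfolding eq[of ?N] by (simp add: mult_2 power_add)
  qed
  from frac_rep.mono[OF rep mult_left_mono[OF this fact_ge_zero]] show ?thesis unfolding fam .
qed

section \<open>Infinite dimension\<close>

text \<open>One denominator \<open>D^n\<close> serves all exponents \<open>i \<le> n\<close>: each
  factor \<open>D\<close> is spent either on a factor \<open>z\<close> or on plain scaling, and both
  cost at most \<open>A\<close>.\<close>

lemma int_height_power_mult:
  assumes A: "\<bar>real_of_int D\<bar> \<le> A" and mult: "\<And>b. b \<in> B \<Longrightarrow> int_height B A (of_int D * z * b)"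
    and x: "int_height B H x" and "i \<le> n"
  shows "int_height B (A ^ n * H) (of_int D ^ n * z ^ i * x)"
  using \<open>i \<le> n\<close>
proof (induction n arbitrary: i)
  case 0
  thus ?case using x by simp
next
  case (Suc n)
  have A0: "0 \<le> A" using A by linarith
  show ?case
  proof (cases i)
    case 0
    have "int_height B (\<bar>of_int D\<bar> * (A ^ n * H)) (of_int D * (of_int D ^ n * z ^ 0 * x))"
      by (intro int_height_scale Suc.IH) simp
    moreover have "\<bar>of_int D\<bar> * (A ^ n * H) \<le> A * (A ^ n * H)"
      using A A0 int_height_nonneg[OF x] by (intro mult_right_mono) auto
    ultimately have "int_height B (A * (A ^ n * H)) (of_int D * (of_int D ^ n * z ^ 0 * x))"
      by (rule int_height_mono)
    thus ?thesis using 0 by (simp add: mult.assoc)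
  next
    case (Suc j)
    have "int_height B (A * (A ^ n * H)) ((of_int D * z) * (of_int D ^ n * z ^ j * x))"
      using Suc Suc.prems by (intro int_height_mult[OF A0] mult Suc.IH) auto
    thus ?thesis using Suc by (simp add: mult_ac)
  qed
qed

text \<open>Siegel's criterion applied to the numbers \<open>z ^ i * continued_value z (approx b r n m)\<close>, scaled so
  as to become integral combinations of \<open>B\<close>.\<close>

lemma basis_element_bound:
  fixes z :: complex and D E :: int
  assumes z: "z \<in> cut_plane" "z \<noteq> 0"
    and d0: "d0 > 0" "z ^ d0 \<in> ratvec.span ((\<lambda>i. z ^ i) ` {..<d0})"
    and B: "finite B" "ratvec.independent B"
      "\<And>w. w \<in> B \<Longrightarrow> \<exists>i s. s \<le> 2 * b + r \<and> (w = z ^ i \<or> w = z ^ i * polylog s z)"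
    and D: "D > 0" "of_int D \<le> A" "\<And>w. w \<in> B \<Longrightarrow> int_height B A (of_int D * z * w)"
    and E: "E > 0" "1 \<le> H" "int_height B H (of_int E)"
      "\<And>s. 1 \<le> s \<Longrightarrow> s \<le> 2 * b + r \<Longrightarrow> int_height B H (of_int E * polylog s z)"
    and e: "e > 0" "\<And>x. 0 \<le> x \<Longrightarrow> x \<le> 1 \<Longrightarrow> e \<le> norm (1 - of_real x * z)"
    and n: "2 * b + r \<le> b * n" "2 * b + r > 0" and d: "d > 0" "\<And>i. 1 \<le> i \<Longrightarrow> i \<le> n \<Longrightarrow> i dvd d"
    and w: "w \<in> B"
  shows "norm w \<le> fact (card B)
    * ((A ^ d0 * (fact (2 * b + r) * ((4 ^ n) ^ (2 * b) * (2 ^ ((r + 2) * n)) ^ r)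
         * (real d ^ (2 * b + r) * (A ^ n * H) * real (Suc n)))) ^ (card B - 1)
    * (of_int D ^ d0 * max 1 (norm z) ^ d0 * (real d ^ (2 * b + r) * (of_int E * of_int D ^ n) * norm z ^ Suc n
         * (norm z ^ (r * n) / e ^ Suc (r * n) * (2 ^ (r * n)) ^ r * (4 ^ n) ^ b * ((1 / (real r + 1)) ^ n) ^ b))))"
    (is "_ \<le> _ * (?Ht ^ _ * ?er)")
proof -
  define a where "a = 2 * b + r"
  obtain k where k: "a = Suc k" using n(2) by (cases a) (auto simp: a_def)
  define Y where "Y = (of_int E * of_int D ^ n :: complex)"
  define y where "y m = of_nat d ^ a * Y * z ^ Suc n * continued_value z (approx b r n m)" for m
  \<comment> \<open>The multiples by \<open>z^i\<close>, \<open>i < d0\<close>, make the span stable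
    under \<open>z\<close>; the factor \<open>D^d0\<close> keeps them integral over
    \<open>B\<close>.\<close>
  define S where "S = (\<lambda>(i, m). of_int D ^ d0 * z ^ i * y m) ` ({..<d0} \<times> {..b * n})"
  define U where "U = ratvec.span S"
  have A1: "1 \<le> A" using D(1,2) by linarith
  have D': "\<bar>real_of_int D\<bar> \<le> A" using D by simp
  have finS: "finite S" by (simp add: S_def)
  have top: "z ^ d0 * x \<in> ratvec.span ((\<lambda>i. z ^ i * x) ` {..<d0})" for x
    using d0(2)
  proof (induction rule: ratvec.span_induct_alt)
    case (step c u v)
    then obtain i where "i < d0" "u = z ^ i" by auto
    hence "z ^ i * x \<in> ratvec.span ((\<lambda>i. z ^ i * x) ` {..<d0})" by (intro ratvec.span_base) auto
    hence "of_rat c * (z ^ i * x) + v * x \<in> ratvec.span ((\<lambda>i. z ^ i * x) ` {..<d0})"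
      using step by (intro ratvec.span_add ratvec.span_scale)
    thus ?case using \<open>u = z ^ i\<close> by (simp add: algebra_simps)
  qed (simp add: ratvec.span_zero)
  have zS: "z * x \<in> ratvec.span S" if x: "x \<in> S" for x
  proof -
    obtain i m where im: "i < d0" "m \<le> b * n" "x = of_int D ^ d0 * z ^ i * y m" using x by (auto simp: S_def)
    have eq: "z * x = z ^ Suc i * (of_int D ^ d0 * y m)" using im(3) by (simp add: mult_ac)
    have sub: "(\<lambda>i. z ^ i * (of_int D ^ d0 * y m)) ` {..<d0} \<subseteq> S"
      unfolding S_def using im(2) by (force simp: mult_ac image_iff)
    show ?thesis
    proof (cases "Suc i = d0")
      case True
      thus ?thesis unfolding eq using top ratvec.span_mono[OF sub] by blast
    next
      case False
      hence "z ^ Suc i * (of_int D ^ d0 * y m) \<in> (\<lambda>i. z ^ i * (of_int D ^ d0 * y m)) ` {..<d0}"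
        using im(1) by (intro imageI) simp
      hence "z * x \<in> S" unfolding eq using sub by blast
      thus ?thesis by (rule ratvec.span_base)
    qed
  qed
  have zU: "z * x \<in> U" if "x \<in> U" for x using span_closed_mult[OF zS that[unfolded U_def]] unfolding U_def .
  have subU: "ratvec.subspace U" unfolding U_def by (rule ratvec.subspace_span)
  \<comment> \<open>Finite dimension turns stability under \<open>z\<close> and \<open>z - 1\<close>
    into stability under their inverses.\<close>
  have inv: "inverse c * x \<in> U" if "\<And>x. x \<in> U \<Longrightarrow> c * x \<in> U" "x \<in> U" for c x
    by (rule subspace_closed_inverse[OF finS _ subU that]) (simp add: U_def)
  have z1U: "(z - 1) * x \<in> U" if "x \<in> U" for x
    using ratvec.subspace_diff[OF subU zU[OF that] that] by (simp add: algebra_simps)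
  interpret stable_subspace z U
    by unfold_locales (use z subU zU inv[OF zU] inv[OF z1U] in auto)
  have cvU: "continued_value z (approx b r n m) \<in> U" if m: "m \<le> b * n" for m
  proof -
    have "of_int D ^ d0 * z ^ 0 * y m \<in> S" using m d0(1) unfolding S_def by (intro image_eqI[of _ _ "(0, m)"]) auto
    hence "of_int D ^ d0 * y m \<in> U" unfolding U_def by (simp add: ratvec.span_base)
    hence "inverse z ^ Suc n * of_rat (1 / (of_int D ^ d0 * of_nat d ^ a * of_int E * of_int D ^ n)) * (of_int D ^ d0 * y m) \<in> U"
      by (intro scalarsD[OF scalars_mult[OF scalars_power[OF scalars_z(2)] scalars_of_rat]])
    also have "inverse z ^ Suc n * of_rat (1 / (of_int D ^ d0 * of_nat d ^ a * of_int E * of_int D ^ n)) * (of_int D ^ d0 * y m)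
        = (inverse z * z) ^ Suc n * ((of_int D ^ d0 * of_nat d ^ a * of_int E * of_int D ^ n)
            / (of_int D ^ d0 * of_nat d ^ a * of_int E * of_int D ^ n)) * continued_value z (approx b r n m)"
      unfolding power_mult_distrib
      by (simp add: y_def Y_def of_rat_divide of_rat_mult of_rat_power mult_ac)
    also have "\<dots> = continued_value z (approx b r n m)" using z(2) D(1) E(1) d(1) by simp
    finally show ?thesis .
  qed
  have base: "value_in a (Suc n) (falling (r * n) * approx_poly b n m)" if m: "m \<le> b * n" for m
  proof -
    define c :: rat where "c = (\<Prod>i<b. fact n / fact (shift_exp n m i)) * fact n ^ b"
    have c0: "c \<noteq> 0" by (simp add: c_def)
    have fact: "of_rat (fact k) = (fact k :: complex)" for k by (metis of_nat_fact of_rat_of_nat_eq)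
    have c: "(\<Prod>i<b. fact n / fact (shift_exp n m i)) * fact n ^ b = (of_rat c :: complex)"
      by (simp add: c_def of_rat_mult of_rat_power of_rat_prod of_rat_divide fact)
    have "value_in a (Suc n) (smult (of_rat c) (falling (r * n) * approx_poly b n m))"
      using cvU[OF m] unfolding approx_eq_quot c a_def .
    hence "value_in a (Suc n) (smult (of_rat (1 / c)) (smult (of_rat c) (falling (r * n) * approx_poly b n m)))"
      by (rule value_in_smult[OF scalars_of_rat])
    thus ?thesis using c0 by (simp add: of_rat_divide)
  qed
  have all: "value_in a (Suc n) P" if "spoly P" for P
  proof (rule value_in_all[of a "b * n" "approx_poly b n", OF _ _ _ _ base that])
    show "a \<le> b * n" using n(1) by (simp add: a_def)
    show "degree (approx_poly b n m) = m" if "m \<le> b * n" for m using degree_approx_poly[OF that] .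
    show "lead_coeff (approx_poly b n m) = 1" for m by (rule lead_coeff_approx_poly)
    show "spoly (approx_poly b n m)" for m
      unfolding approx_poly_def rising_def
      by (intro spoly_prod spoly_linear scalars_add scalars_of_nat scalars_1)
  qed
  have pow: "z ^ i \<in> scalars" for i by (intro scalars_power scalars_z)
  \<comment> \<open>Nondegeneracy: \<open>U\<close> contains 1 and the polylogarithms of order up to
    \<open>a\<close>, hence, being stable under \<open>z\<close>, all of \<open>B\<close>.\<close>
  have BU: "B \<subseteq> ratvec.span S"
  proof
    fix w assume "w \<in> B"
    then obtain i s where w: "s \<le> a" "w = z ^ i \<or> w = z ^ i * polylog s z" using B(3) unfolding a_def by blast
    have "z ^ i * 1 \<in> U" by (intro scalarsD[OF pow] one_in_if_value_in_all[OF all])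
    moreover have "z ^ i * polylog s z \<in> U"
      by (intro scalarsD[OF pow] polylog_in_if_value_in_all[OF all w(1)])
    ultimately show "w \<in> ratvec.span S" using w(2) unfolding U_def by auto
  qed
  have height: "int_height B ?Ht x" if x: "x \<in> S" for x
  proof -
    obtain i m where im: "i < d0" "m \<le> b * n" "x = of_int D ^ d0 * z ^ i * y m" using x by (auto simp: S_def)
    have "continuable (approx b r n m) \<and> int_height B
        (fact (Suc k) * ((4 ^ n) ^ (2 * b) * (2 ^ ((r + 2) * n)) ^ r) * (real d ^ Suc k * (A ^ n * H) * real (Suc n)))
        (of_nat d ^ Suc k * Y * z ^ Suc n * continued_value z (approx b r n m))"
    proof (rule int_height_frac_rep[OF z d(2)])
      show "int_height B (A ^ n * H) (Y * z ^ i * polylog s z)" if "1 \<le> s" "s \<le> Suc k" "i \<le> n" for s i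
      proof -
        have "int_height B (A ^ n * H) (of_int D ^ n * z ^ i * (of_int E * polylog s z))"
          using that k by (intro int_height_power_mult[OF D' D(3)] E(4)) (auto simp: a_def)
        thus ?thesis by (simp add: Y_def mult_ac)
      qed
      show "int_height B (A ^ n * H) (Y * z ^ i)" if "i \<le> n" for i
      proof -
        have "int_height B (A ^ n * H) (of_int D ^ n * z ^ i * of_int E)"
          using that by (intro int_height_power_mult[OF D' D(3)] E(3)) auto
        thus ?thesis by (simp add: Y_def mult_ac)
      qed
      show "frac_rep d n (Suc k) (fact (Suc k) * ((4 ^ n) ^ (2 * b) * (2 ^ ((r + 2) * n)) ^ r)) (approx b r n m)"
        using k by (intro frac_rep_approx d(2)) (auto simp: a_def)
    qed
    hence "int_height B (fact a * ((4 ^ n) ^ (2 * b) * (2 ^ ((r + 2) * n)) ^ r) * (real d ^ a * (A ^ n * H) * real (Suc n))) (y m)"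
      unfolding y_def k by blast
    from int_height_power_mult[OF D' D(3) this, of i d0] show ?thesis
      using im by (simp add: a_def)
  qed
  have small: "norm x \<le> ?er" if x: "x \<in> S" for x
  proof -
    obtain i m where im: "i < d0" "m \<le> b * n" "x = of_int D ^ d0 * z ^ i * y m" using x by (auto simp: S_def)
    define bnd where "bnd = norm z ^ (r * n) / e ^ Suc (r * n) * (2 ^ (r * n)) ^ r * (4 ^ n) ^ b * ((1 / (real r + 1)) ^ n) ^ b"
    have cv: "norm (continued_value z (approx b r n m)) \<le> bnd"
      unfolding bnd_def by (rule norm_continued_value_le[OF z(1) ray_bound_approx[OF e]])
    have zi: "norm z ^ i \<le> max 1 (norm z) ^ d0"
    proof -
      have "norm z ^ i \<le> max 1 (norm z) ^ i" by (intro power_mono) auto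
      also have "\<dots> \<le> max 1 (norm z) ^ d0" using im(1) by (intro power_increasing) auto
      finally show ?thesis .
    qed
    have "norm x = of_int D ^ d0 * norm z ^ i * (real d ^ a * (of_int E * of_int D ^ n) * norm z ^ Suc n
        * norm (continued_value z (approx b r n m)))"
      using D(1) E(1) unfolding im(3) y_def Y_def by (simp only: norm_mult norm_power norm_of_int norm_of_nat)
    also have "\<dots> \<le> of_int D ^ d0 * max 1 (norm z) ^ d0 * (real d ^ a * (of_int E * of_int D ^ n) * norm z ^ Suc n * bnd)"
      using D(1) E(1) by (intro mult_mono mult_left_mono zi cv mult_nonneg_nonneg zero_le_power) auto
    finally show ?thesis by (simp only: bnd_def a_def)
  qed
  have "0 \<le> ?Ht"
    using A1 E(2) by (intro mult_nonneg_nonneg zero_le_power) auto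
  from siegel_bound[OF B(1,2) height small BU w this] show ?thesis by (simp only: mult.assoc)
qed


text \<open>Collects all \<open>n\<close>-th powers. In \<open>h\<close>, \<open>256^b\<close> is
  \<open>16^b\<close> from the residues of the \<open>2 b\<close> rising factors times
  \<open>16^b\<close> from \<open>d^(2 b)\<close>; the 2 comes from \<open>n + 1 \<le> 2^n\<close>.
  In \<open>g\<close>, \<open>64^b\<close> is \<open>16^b\<close> from \<open>d^(2 b)\<close> times
  \<open>4^b\<close> from the crude bound on the \<open>b\<close> numerator factors.\<close>

lemma basis_element_decay:
  fixes z :: complex and D E :: int and A H e :: real and b r d0 N n d :: nat
  assumes D: "D > 0" "1 \<le> A" and E: "E > 0" "1 \<le> H" and e: "e > 0"
    and d: "real d \<le> 4 ^ n"
  defines "h \<equiv> 256 ^ b * ((2 ^ (r + 2)) ^ r * 4 ^ r * A * 2)"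
    and "g \<equiv> (64 / (real r + 1)) ^ b * (4 ^ r * of_int D * norm z * (norm z / e) ^ r * (2 ^ r) ^ r)"
  shows "(A ^ d0 * (fact (2 * b + r) * ((4 ^ n) ^ (2 * b) * (2 ^ ((r + 2) * n)) ^ r)
         * (real d ^ (2 * b + r) * (A ^ n * H) * real (Suc n)))) ^ N
    * (of_int D ^ d0 * max 1 (norm z) ^ d0 * (real d ^ (2 * b + r) * (of_int E * of_int D ^ n) * norm z ^ Suc n
         * (norm z ^ (r * n) / e ^ Suc (r * n) * (2 ^ (r * n)) ^ r * (4 ^ n) ^ b * ((1 / (real r + 1)) ^ n) ^ b)))
    \<le> (A ^ d0 * fact (2 * b + r) * H) ^ N * (of_int D ^ d0 * max 1 (norm z) ^ d0 * of_int E * norm z / e) * (h ^ N * g) ^ n"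
    (is "?Ht ^ N * ?er \<le> ?k1 ^ N * ?k2 * _")
proof -
  have pc: "(x ^ n) ^ k = (x ^ k) ^ n" for x :: real and k by (simp add: mult.commute flip: power_mult)
  have pm: "x ^ (k * n) = (x ^ k) ^ n" for x :: real and k by (rule power_mult)
  have da: "real d ^ (2 * b + r) \<le> (4 ^ n) ^ (2 * b + r)" using d by (intro power_mono) auto
  have "Suc n \<le> 2 ^ n" using less_exp[of n] by (rule Suc_leI)
  hence n2: "real (Suc n) \<le> 2 ^ n" by (metis of_nat_le_iff of_nat_numeral of_nat_power)
  have b256: "(256 :: real) ^ b = 4 ^ (2 * b) * 4 ^ (2 * b)"
    by (simp add: power_mult flip: power_mult_distrib)
  have b64: "(64 / (real r + 1)) ^ b = 4 ^ (2 * b) * 4 ^ b * (1 / (real r + 1)) ^ b"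
    by (simp add: power_mult flip: power_mult_distrib)
  have "?Ht \<le> A ^ d0 * (fact (2 * b + r) * ((4 ^ n) ^ (2 * b) * (2 ^ ((r + 2) * n)) ^ r)
         * ((4 ^ n) ^ (2 * b + r) * (A ^ n * H) * 2 ^ n))"
    using D E by (intro mult_left_mono mult_mono da n2) auto
  also have "\<dots> = ?k1 * h ^ n"
    unfolding pm pc h_def b256 power_mult_distrib power_add by (simp add: mult_ac)
  finally have Ht: "?Ht \<le> ?k1 * h ^ n" .
  have "?er \<le> of_int D ^ d0 * max 1 (norm z) ^ d0 * ((4 ^ n) ^ (2 * b + r) * (of_int E * of_int D ^ n) * norm z ^ Suc n
         * (norm z ^ (r * n) / e ^ Suc (r * n) * (2 ^ (r * n)) ^ r * (4 ^ n) ^ b * ((1 / (real r + 1)) ^ n) ^ b))"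
    using D E e by (intro mult_left_mono mult_right_mono da) auto
  also have "\<dots> = ?k2 * g ^ n"
    unfolding g_def b64
    unfolding power_Suc pm pc power_mult_distrib power_add power_divide by (simp add: mult_ac)
  finally have er: "?er \<le> ?k2 * g ^ n" .
  have "?Ht ^ N * ?er \<le> (?k1 * h ^ n) ^ N * (?k2 * g ^ n)"
    using D E e by (intro mult_mono power_mono Ht er) (auto simp: h_def)
  also have "\<dots> = ?k1 ^ N * ?k2 * (h ^ N * g) ^ n"
    unfolding power_mult_distrib by (simp add: pc mult_ac)
  finally show ?thesis .
qed

theorem corollary2:
  fixes z0 :: complex
  assumes "algebraic z0" and "z0 \<noteq> 0" and "z0 \<notin> complex_of_real ` {1..}"
  shows "\<not> ring.finite_dimension complex_ring (adjoin_rat z0)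
           (span_over (adjoin_rat z0) {polylog s z0 | s. s \<ge> 1})"
proof
  let ?V = "span_over (adjoin_rat z0) {polylog s z0 | s. s \<ge> 1}"
  assume fd: "ring.finite_dimension complex_ring (adjoin_rat z0) ?V"
  have z: "z0 \<in> cut_plane" using assms(3) by (simp add: cut_plane_def)
  obtain T where T: "finite T" "insert 1 ?V \<subseteq> ratvec.span T"
    "\<And>x. x \<in> ratvec.span T \<Longrightarrow> z0 * x \<in> ratvec.span T"
    by (rule finite_dimension_rational_span[OF assms(1) fd]) blast
  have powT: "z0 ^ i * x \<in> ratvec.span T" if "x \<in> ratvec.span T" for i x
    using that by (induction i) (auto simp: mult.assoc T(3))
  define G where "G = {z0 ^ i | i. True} \<union> {z0 ^ i * polylog s z0 | i s. s \<ge> 1}"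
  have "{polylog s z0 | s. s \<ge> 1} \<subseteq> ?V" unfolding span_over_def by (rule hull_subset)
  hence "polylog s z0 \<in> ratvec.span T" if "s \<ge> 1" for s using that T(2) by blast
  moreover have "1 \<in> ratvec.span T" using T(2) by simp
  ultimately have GT: "G \<subseteq> ratvec.span T" unfolding G_def using powT[of 1] powT by fastforce
  \<comment> \<open>Choosing the basis inside \<open>G\<close> keeps its elements of the form
    \<open>z^i\<close> or \<open>z^i * polylog s z\<close>, which the nondegeneracy argument
    reaches.\<close>
  obtain B where B: "B \<subseteq> G" "ratvec.independent B" "G \<subseteq> ratvec.span B"
    using ratvec.maximal_independent_subset .
  have finB: "finite B" using ratvec.independent_span_bound[OF T(1) B(2)] B(1) GT by blast
  have zG: "z0 * w \<in> G" if w: "w \<in> G" for w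
  proof -
    consider i where "w = z0 ^ i" | i s where "s \<ge> 1" "w = z0 ^ i * polylog s z0" using w by (auto simp: G_def)
    thus ?thesis
    proof cases
      case (1 i)
      hence "z0 * w = z0 ^ Suc i" by simp
      thus ?thesis unfolding G_def by blast
    next
      case (2 i s)
      hence "z0 * w = z0 ^ Suc i * polylog s z0" by (simp add: mult.assoc)
      thus ?thesis using 2(1) unfolding G_def by blast
    qed
  qed
  have oneG: "1 \<in> G" unfolding G_def by (auto intro: exI[of _ 0])
  hence "B \<noteq> {}" using B(3) by auto
  then obtain w where w: "w \<in> B" by blast
  have w0: "w \<noteq> 0" using w B(2) ratvec.dependent_zero by blast
  have "\<exists>s. \<exists>i. w = z0 ^ i \<or> w = z0 ^ i * polylog s z0" if "w \<in> B" for w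
    using that B(1) unfolding G_def by blast
  then obtain sw where sw: "\<And>w. w \<in> B \<Longrightarrow> \<exists>i. w = z0 ^ i \<or> w = z0 ^ i * polylog (sw w) z0" by metis
  define s0 where "s0 = (\<Sum>w\<in>B. sw w)"
  have s0: "sw w \<le> s0" if "w \<in> B" for w unfolding s0_def using finB that by (intro member_le_sum) auto
  obtain d0 where d0: "d0 > 0" "z0 ^ d0 \<in> ratvec.span ((\<lambda>i. z0 ^ i) ` {..<d0})"
    using powers_in_span_if_algebraic[OF assms(1)] .
  have "(\<lambda>w. z0 * w) ` B \<subseteq> ratvec.span B" using zG B(1,3) by blast
  then obtain D :: int and A0 where D: "0 < D" "1 \<le> A0"
    "\<forall>x\<in>(\<lambda>w. z0 * w) ` B. int_height B A0 (of_int D * x)"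
    using int_height_common_denominator[OF finB, of "(\<lambda>w. z0 * w) ` B"] finB by auto
  \<comment> \<open>\<open>A\<close> dominates both multiplication by \<open>D z\<close> on
    \<open>B\<close> and scaling by \<open>D\<close>.\<close>
  define A where "A = max A0 (of_int D)"
  have A: "1 \<le> A" "of_int D \<le> A" using D by (auto simp: A_def)
  have multA: "int_height B A (of_int D * z0 * w)" if "w \<in> B" for w
    using D(3) that by (auto simp: A_def mult.assoc intro: int_height_mono)
  obtain e where e: "e > 0" "\<And>x. 0 \<le> x \<Longrightarrow> x \<le> 1 \<Longrightarrow> e \<le> norm (1 - of_real x * z0)"
    by (rule dist_ray_from_1[OF z]) blast
  define N where "N = card B - 1"
  \<comment> \<open>Chosen so that \<open>256^N * 64 / (r + 1) \<le> 1 / 2\<close>; it depends on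
    the dimension only, and \<open>b\<close> is still free.\<close>
  define r :: nat where "r = 128 * 256 ^ N"
  define h0 where "h0 = (2 ^ (r + 2)) ^ r * 4 ^ r * A * 2"
  define g0 where "g0 = 4 ^ r * of_int D * norm z0 * (norm z0 / e) ^ r * (2 ^ r) ^ r"
  have h0: "h0 > 0" using A by (simp add: h0_def)
  have g0: "g0 > 0" using D e assms(2) by (simp add: g0_def)
  obtain b0 where b0: "(1 / 2) ^ b0 < 1 / (2 * (h0 ^ N * g0))"
    using real_arch_pow_inv[of "1 / (2 * (h0 ^ N * g0))" "1 / 2"] h0 g0 by auto
  \<comment> \<open>\<open>b0\<close> absorbs the factors that depend on \<open>r\<close> but not on
    \<open>b\<close>, \<open>r\<close> ensures \<open>2 b + r \<le> 3 b \<le> b n\<close> for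
    \<open>n \<ge> 4\<close>, and \<open>s0\<close> covers the orders of the polylogarithms in
    \<open>B\<close>.\<close>
  define b where "b = max b0 (max r (s0 + 1))"
  define a where "a = 2 * b + r"
  define h where "h = 256 ^ b * h0"
  define g where "g = (64 / (real r + 1)) ^ b * g0"
  have hg: "h ^ N * g \<le> 1 / 2"
  proof -
    have "256 ^ N * 64 \<le> 1 / 2 * (real r + 1)" by (simp add: r_def)
    moreover have "0 < real r + 1" by simp
    ultimately have "256 ^ N * 64 / (real r + 1) \<le> 1 / 2" by (simp only: pos_divide_le_eq)
    hence "256 ^ N * (64 / (real r + 1)) \<le> 1 / 2" by simp
    hence "(256 ^ N * (64 / (real r + 1))) ^ b \<le> (1 / 2) ^ b" by (intro power_mono) auto
    also have "\<dots> \<le> (1 / 2 :: real) ^ b0" by (intro power_decreasing) (auto simp: b_def)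
    also have "\<dots> \<le> 1 / (2 * (h0 ^ N * g0))" using b0 by simp
    finally have "(256 ^ N * (64 / (real r + 1))) ^ b * (h0 ^ N * g0) \<le> 1 / (2 * (h0 ^ N * g0)) * (h0 ^ N * g0)"
      using h0 g0 by (intro mult_right_mono) auto
    also have "\<dots> = 1 / 2" using h0 g0 by simp
    also have "(256 ^ N * (64 / (real r + 1))) ^ b * (h0 ^ N * g0) = h ^ N * g"
    proof -
      have "(256 ^ b) ^ N = ((256 ^ N) ^ b :: real)" by (simp add: mult.commute flip: power_mult)
      thus ?thesis unfolding h_def g_def power_mult_distrib by (simp add: mult_ac)
    qed
    finally show ?thesis .
  qed
  have hg0: "0 \<le> h ^ N * g" using h0 g0 by (simp add: h_def g_def)
  have "insert 1 ((\<lambda>s. polylog s z0) ` {1..a}) \<subseteq> ratvec.span B"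
  proof -
    have "polylog s z0 \<in> G" if "s \<ge> 1" for s
    proof -
      have "polylog s z0 = z0 ^ 0 * polylog s z0" by simp
      thus ?thesis using that unfolding G_def by blast
    qed
    thus ?thesis using oneG B(3) by auto
  qed
  then obtain E :: int and H where E: "0 < E" "1 \<le> H"
    "\<forall>x\<in>insert 1 ((\<lambda>s. polylog s z0) ` {1..a}). int_height B H (of_int E * x)"
    using int_height_common_denominator[OF finB, of "insert 1 ((\<lambda>s. polylog s z0) ` {1..a})"] by auto
  \<comment> \<open>\<open>E\<close>, \<open>H\<close> and \<open>C\<close> depend on
    \<open>a\<close> but not on \<open>n\<close>, so the decay in \<open>n\<close> prevails.\<close>
  define C where "C = fact (card B) * ((A ^ d0 * fact a * H) ^ N
      * (of_int D ^ d0 * max 1 (norm z0) ^ d0 * of_int E * norm z0 / e))"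
  have C: "C > 0" using A D E e assms(2) by (auto simp: C_def intro!: mult_pos_pos divide_pos_pos zero_less_power)
  have bound: "norm w \<le> C * (1 / 2) ^ n" if n: "n = 2 ^ q" "q \<ge> 2" for n q
  proof -
    define d where "d = Lcm {1..n}"
    have n4: "4 \<le> n" using power_increasing[OF n(2), of "2::nat"] n(1) by simp
    have "b \<ge> r" "b > 0" by (auto simp: b_def)
    hence "2 * b + r \<le> b * 4" "2 * b + r > 0" by auto
    moreover have "b * 4 \<le> b * n" using n4 by simp
    ultimately have bn: "2 * b + r \<le> b * n" "2 * b + r > 0" by linarith+
    have dpos: "d > 0" unfolding d_def by (rule Lcm_interval_pos)
    have ddvd: "i dvd d" if "1 \<le> i" "i \<le> n" for i unfolding d_def using that by (intro dvd_Lcm) auto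
    have "d \<le> 4 ^ n" unfolding d_def n(1) by (rule Lcm_power2_le)
    hence dle: "real d \<le> 4 ^ n" by (metis of_nat_le_iff of_nat_numeral of_nat_power)
    have Bform: "\<exists>i s. s \<le> 2 * b + r \<and> (w = z0 ^ i \<or> w = z0 ^ i * polylog s z0)" if "w \<in> B" for w
    proof -
      have "s0 + 1 \<le> b" unfolding b_def by (intro max.coboundedI2 order_refl)
      hence "sw w \<le> 2 * b + r" using s0[OF that] by linarith
      thus ?thesis using sw[OF that] by blast
    qed
    have E1: "int_height B H (of_int E)" using E(3) by simp
    have E2: "int_height B H (of_int E * polylog s z0)" if "1 \<le> s" "s \<le> 2 * b + r" for s
      using E(3) that by (auto simp: a_def)
    note elem = basis_element_bound[OF z assms(2) d0 finB B(2) Bform D(1) A(2) multA E(1,2) E1 E2 e bn dpos ddvd w]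
    note decay = basis_element_decay[OF D(1) A(1) E(1,2) e(1) dle, of d0 b r "card B - 1" z0]
    have "norm w \<le> C * (h ^ N * g) ^ n"
      unfolding C_def N_def h_def g_def h0_def g0_def a_def mult.assoc[of "fact (card B)"]
      by (rule order_trans[OF elem mult_left_mono[OF decay fact_ge_zero]])
    also have "\<dots> \<le> C * (1 / 2) ^ n" using hg hg0 C by (intro mult_left_mono power_mono) auto
    finally show ?thesis .
  qed
  obtain m where m: "(1 / 2) ^ m < norm w / C"
    using real_arch_pow_inv[of "norm w / C" "1 / 2"] w0 C by auto
  define q where "q = max m 2"
  have "m \<le> q" by (simp add: q_def)
  also have "q \<le> 2 ^ q" by (rule less_imp_le[OF less_exp])
  finally have "m \<le> 2 ^ q" .
  hence "(1 / 2 :: real) ^ (2 ^ q) \<le> (1 / 2) ^ m" by (intro power_decreasing) auto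
  hence "(1 / 2) ^ (2 ^ q) < norm w / C" using m by (rule le_less_trans)
  hence "C * (1 / 2) ^ (2 ^ q) < C * (norm w / C)" using C by (rule mult_strict_left_mono)
  moreover have "norm w \<le> C * (1 / 2) ^ (2 ^ q)" by (rule bound[OF refl]) (simp add: q_def)
  ultimately show False using C by simp
qed

end
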